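(* Consider the reinforcement-learning signaling process described in the context. Let $\mathcal{G}$ be any bipartite graph on the vertex set $\mathcal{S}=\mathcal{S}_1\cup\mathcal{S}_2$ (with every edge joining an element of $\mathcal{S}_1$ to an element of $\mathcal{S}_2$) such that property $(P)_{\mathcal{G}}$ holds. Then, with positive probability, both of the following occur: (a) $x_n$ converges, as $n\to\infty$, to some (random) $x\in\Delta$ such that $\mathcal{G}_x=\mathcal{G}$ (same edge set); (b) for all $i,j\in\mathcal{S}$, $V(\infty,i,j)=\infty$ if and only if $\{i,j\}$ is an edge of $\mathcal{G}$, where $V(\infty,i,j)=\lim_{n\to\infty}V(n,i,j)$.
   Context: Model. Let $M_1,M_2\ge 1$ be integers, let $\mathcal{S}_1,\mathcal{S}_2$ be disjoint finite sets with $|\mathcal{S}_1|=M_1$ (states, which are also the acts) and $|\mathcal{S}_2|=M_2$ (signals), and $\mathcal{S}=\mathcal{S}_1\cup\mathcal{S}_2$. The random process $V(n,i,j)$, $n\in\mathbb{N}=\{0,1,2,\dots\}$, $i\in\mathcal{S}_1$, $j\in\mathcal{S}_2$, starts from $V(0,i,j)=1$ for all $i,j$. At each step, given the past up to time $n$: a state $i\in\mathcal{S}_1$ is drawn uniformly (probability $1/M_1$ each), independently of the past; Sender then chooses signal $j\in\mathcal{S}_2$ with probability $V(n,i,j)/\sum_{l\in\mathcal{S}_2}V(n,i,l)$; then Receiver, seeing only $j$, chooses an act $k\in\mathcal{S}_1$ with probability $V(n,k,j)/\sum_{l\in\mathcal{S}_1}V(n,l,j)$. If $k=i$, then $V(n+1,i,j)=V(n,i,j)+1$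 and all other entries are unchanged; if $k\ne i$, no entry changes. Notation. Extend $V$ symmetrically to $\mathcal{S}\times\mathcal{S}$: $V(n,j,i)=V(n,i,j)$ for $i\in\mathcal{S}_1,j\in\mathcal{S}_2$, and $V(n,i,j)=0$ if $i,j$ are both in $\mathcal{S}_1$ or both in $\mathcal{S}_2$. Let $T_n=\sum_{i\in\mathcal{S}_1,j\in\mathcal{S}_2}V(n,i,j)$, $x_{ij}^n=V(n,i,j)/T_n$, $x_n=(x_{ij}^n)_{i,j\in\mathcal{S}}$. $\Delta$ is the simplex of symmetric arrays $(x_{ij})_{i,j\in\mathcal{S}}$ with $x_{ij}=x_{ji}\ge0$, $x_{ij}=0$ if $i,j$ are in the same part, and $\sum_{i\in\mathcal{S}_1,j\in\mathcal{S}_2}x_{ij}=1$. For $x\in\Delta$, $\mathcal{G}_x$ is the bipartite graph on $\mathcal{S}$ in which $i\in\mathcal{S}_1$ and $j\in\mathcal{S}_2$ are adjacent if and only if $x_{ij}>0$. Property $(P)_{\mathcal{G}}$: for every connected component $\mathcal{C}$ of $\mathcal{G}$, $\mathcal{C}\cap\mathcal{S}_1$ or $\mathcal{C}\cap\mathcal{S}_2$ is a singleton; and every vertex is incident to at least one edge. *)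

theory Defs
  imports "HOL-Probability.Probability"
begin

datatype 'a play = Play (state: 'a) (signal: 'a) (act: 'a)

text \<open>
  A sequence of plays determines the weights. \<open>weight h n i j\<close> is meant for a state \<open>i\<close> and a
  signal \<open>j\<close>; it depends on \<open>h 0, \<dots>, h (n - 1)\<close> only.
\<close>

primrec weight :: "(nat \<Rightarrow> 'a play) \<Rightarrow> nat \<Rightarrow> 'a \<Rightarrow> 'a \<Rightarrow> real" where
  "weight h 0 i j = 1"
| "weight h (Suc n) i j =
     weight h n i j + (if state (h n) = i \<and> signal (h n) = j \<and> act (h n) = i then 1 else 0)"

definition V :: "'a set \<Rightarrow> 'a set \<Rightarrow> (nat \<Rightarrow> 'a play) \<Rightarrow> nat \<Rightarrow> 'a \<Rightarrow> 'a \<Rightarrow> real" where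
  "V S\<^sub>1 S\<^sub>2 h n i j =
     (if i \<in> S\<^sub>1 \<and> j \<in> S\<^sub>2 then weight h n i j
      else if i \<in> S\<^sub>2 \<and> j \<in> S\<^sub>1 then weight h n j i
      else 0)"

definition V_infinity :: "'a set \<Rightarrow> 'a set \<Rightarrow> (nat \<Rightarrow> 'a play) \<Rightarrow> 'a \<Rightarrow> 'a \<Rightarrow> ereal" where
  "V_infinity S\<^sub>1 S\<^sub>2 h i j = lim (\<lambda>n. ereal (V S\<^sub>1 S\<^sub>2 h n i j))"

definition total_weight :: "'a set \<Rightarrow> 'a set \<Rightarrow> (nat \<Rightarrow> 'a play) \<Rightarrow> nat \<Rightarrow> real" where
  "total_weight S\<^sub>1 S\<^sub>2 h n = (\<Sum>i\<in>S\<^sub>1. \<Sum>j\<in>S\<^sub>2. V S\<^sub>1 S\<^sub>2 h n i j)"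

definition proportion :: "'a set \<Rightarrow> 'a set \<Rightarrow> (nat \<Rightarrow> 'a play) \<Rightarrow> nat \<Rightarrow> 'a \<Rightarrow> 'a \<Rightarrow> real" where
  "proportion S\<^sub>1 S\<^sub>2 h n i j = V S\<^sub>1 S\<^sub>2 h n i j / total_weight S\<^sub>1 S\<^sub>2 h n"

text \<open>
  Any realisation of the process on a probability space \<open>M\<close>: \<open>play n \<omega>\<close> is the play leading from
  time \<open>n\<close> to time \<open>n + 1\<close>. There are finitely many possible pasts up to time \<open>n\<close>, so the
  conditional laws are given by elementary conditional probabilities on each past \<open>h\<close> of positive
  probability. There the first law makes the state independent of the past, and all the conditioning
  events below have positive probability as well (as weights are at least 1).
\<close>

locale signaling_process = prob_space M
  for M :: "'w measure" +
  fixes S\<^sub>1 S\<^sub>2 :: "'a set"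
    and play :: "nat \<Rightarrow> 'w \<Rightarrow> 'a play"
  assumes finite_states: "finite S\<^sub>1" and states_nonempty: "S\<^sub>1 \<noteq> {}"
    and finite_signals: "finite S\<^sub>2" and signals_nonempty: "S\<^sub>2 \<noteq> {}"
    and disjoint: "S\<^sub>1 \<inter> S\<^sub>2 = {}"
    and measurable_state: "\<And>n. (\<lambda>\<omega>. state (play n \<omega>)) \<in> measurable M (count_space S\<^sub>1)"
    and measurable_signal: "\<And>n. (\<lambda>\<omega>. signal (play n \<omega>)) \<in> measurable M (count_space S\<^sub>2)"
    and measurable_act: "\<And>n. (\<lambda>\<omega>. act (play n \<omega>)) \<in> measurable M (count_space S\<^sub>1)"
    and state_law:
      "\<And>n h i. \<P>(\<omega> in M. \<forall>m<n. play m \<omega> = h m) > 0 \<Longrightarrow> i \<in> S\<^sub>1 \<Longrightarrow>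
         \<P>(\<omega> in M. state (play n \<omega>) = i \<bar> \<forall>m<n. play m \<omega> = h m) = 1 / card S\<^sub>1"
    and signal_law:
      "\<And>n h i j. \<P>(\<omega> in M. \<forall>m<n. play m \<omega> = h m) > 0 \<Longrightarrow> i \<in> S\<^sub>1 \<Longrightarrow> j \<in> S\<^sub>2 \<Longrightarrow>
         \<P>(\<omega> in M. signal (play n \<omega>) = j \<bar>
             (\<forall>m<n. play m \<omega> = h m) \<and> state (play n \<omega>) = i)
         = V S\<^sub>1 S\<^sub>2 h n i j / (\<Sum>l\<in>S\<^sub>2. V S\<^sub>1 S\<^sub>2 h n i l)"
    and act_law:
      "\<And>n h i j k. \<P>(\<omega> in M. \<forall>m<n. play m \<omega> = h m) > 0 \<Longrightarrow>
         i \<in> S\<^sub>1 \<Longrightarrow> j \<in> S\<^sub>2 \<Longrightarrow> k \<in> S\<^sub>1 \<Longrightarrow>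
         \<P>(\<omega> in M. act (play n \<omega>) = k \<bar>
             (\<forall>m<n. play m \<omega> = h m) \<and> state (play n \<omega>) = i \<and> signal (play n \<omega>) = j)
         = V S\<^sub>1 S\<^sub>2 h n k j / (\<Sum>l\<in>S\<^sub>1. V S\<^sub>1 S\<^sub>2 h n l j)"

text \<open>
  Arrays indexed by \<open>S\<^sub>1 \<union> S\<^sub>2\<close> are functions on the whole type that vanish off that index set.
\<close>

definition Delta :: "'a set \<Rightarrow> 'a set \<Rightarrow> ('a \<Rightarrow> 'a \<Rightarrow> real) set" where
  "Delta S\<^sub>1 S\<^sub>2 = {x.
     (\<forall>i j. x i j = x j i \<and> x i j \<ge> 0) \<and>
     (\<forall>i j. i \<in> S\<^sub>1 \<and> j \<in> S\<^sub>1 \<or> i \<in> S\<^sub>2 \<and> j \<in> S\<^sub>2 \<longrightarrow> x i j = 0) \<and>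
     (\<forall>i j. i \<notin> S\<^sub>1 \<union> S\<^sub>2 \<longrightarrow> x i j = 0) \<and>
     (\<Sum>i\<in>S\<^sub>1. \<Sum>j\<in>S\<^sub>2. x i j) = 1}"

text \<open>
  A graph on the fixed vertex set \<open>S\<^sub>1 \<union> S\<^sub>2\<close> is represented by its set of edges \<open>{i, j}\<close>.
\<close>

definition bipartite_graph :: "'a set \<Rightarrow> 'a set \<Rightarrow> 'a set set \<Rightarrow> bool" where
  "bipartite_graph S\<^sub>1 S\<^sub>2 G \<longleftrightarrow> (\<forall>e\<in>G. \<exists>i\<in>S\<^sub>1. \<exists>j\<in>S\<^sub>2. e = {i, j})"

definition graph_of :: "'a set \<Rightarrow> 'a set \<Rightarrow> ('a \<Rightarrow> 'a \<Rightarrow> real) \<Rightarrow> 'a set set" where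
  "graph_of S\<^sub>1 S\<^sub>2 x = {{i, j} |i j. i \<in> S\<^sub>1 \<and> j \<in> S\<^sub>2 \<and> x i j > 0}"

definition connected_components :: "'a set \<Rightarrow> 'a set set \<Rightarrow> 'a set set" where
  "connected_components W G = W // {(u, v) \<in> W \<times> W. (u, v) \<in> {(u, v). {u, v} \<in> G}\<^sup>*}"

definition property_P :: "'a set \<Rightarrow> 'a set \<Rightarrow> 'a set set \<Rightarrow> bool" where
  "property_P S\<^sub>1 S\<^sub>2 G \<longleftrightarrow>
     (\<forall>C\<in>connected_components (S\<^sub>1 \<union> S\<^sub>2) G. is_singleton (C \<inter> S\<^sub>1) \<or> is_singleton (C \<inter> S\<^sub>2)) \<and>
     (\<forall>v\<in>S\<^sub>1 \<union> S\<^sub>2. \<exists>e\<in>G. v \<in> e)"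

end

theory Submission
  imports Defs
begin

text \<open>
  Property (P) makes the graph a disjoint union of stars. Start from a history, attained with positive
  probability, after which every edge has a large weight \<open>K\<close> and every non-edge still has weight 1.
  While non-edges are not reinforced, the edges of a star behave like a Polya urn with a perturbation
  of relative size \<open>1 / tot\<close>, where \<open>tot\<close> is the total weight at the center. Hence the share \<open>x\<close> of an
  edge satisfies that \<open>(x - a)\<^sup>2 + A / tot\<close> is a supermartingale for every constant \<open>a\<close>. This gives both
  the fact that with positive probability all shares stay bounded below and no non-edge is ever
  reinforced (the latter has probability of order \<open>1 / tot\<^sup>2\<close> at each step), and second moment bounds
  of order \<open>1 / n\<close> for the oscillation of the shares after time \<open>n\<close>, hence their convergence.
  Similarly \<open>tot / n\<close> converges to the inverse of the number of states, by a second moment estimate.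
\<close>

section \<open>Drift estimates for urns on stars\<close>

text \<open>The obstacle is that the growth of \<open>tot\<close> is not known beforehand. A stray
  reinforcement has probability of order \<open>1 / tot\<^sup>2\<close>, which is summable only if
  \<open>tot\<close> grows fast enough, and this growth in turn relies on the process staying near
  the stars. The compensator breaks the circle. In an exact Polya urn the share is a martingale;
  here its drift is a bias of order \<open>1 / tot\<close> times a step of order
  \<open>1 / tot\<close>, and the squared jumps are also of order \<open>1 / tot\<^sup>2\<close>.
  The drift of \<open>1 / tot\<close> is negative and of the same order, so a fixed multiple of it
  pays for bias, jumps and stray reinforcements at once, whatever the speed of \<open>tot\<close>.

  Nothing is conditioned on survival. All estimates are expectations restricted to the event of
  being still alive; one-step inequalities over finite pasts suffice for these, and the mass that is
  lost only helps when the functions are nonnegative. Jensen's inequality applied to the same drift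
  of \<open>1 / tot\<close> gives its mean decay of order \<open>1 / n\<close>, on which all moment
  bounds rest.\<close>

text \<open>
  The weights as long as only edges of a disjoint union of stars have been reinforced: \<open>L\<close> is the set
  of leaves, \<open>f\<close> sends a leaf to its center, \<open>u l\<close> is the weight of the edge between \<open>l\<close> and \<open>f l\<close>,
  and \<open>d a\<close> counts the entries at \<open>a\<close> that still have their initial weight 1. States and signals
  enter symmetrically: the edge is reinforced with probability \<open>rate u l\<close>, whichever of its endpoints
  is the state, since drawing the state, the signal and the act contributes the factors \<open>1 / N\<close>,
  \<open>u l / (d l + u l)\<close> and \<open>u l / tot u (f l)\<close>, the last two in either order.
\<close>

locale star_urns =
  fixes L :: "'a set" and f :: "'a \<Rightarrow> 'a" and d :: "'a \<Rightarrow> real" and N D :: real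
  assumes finite_L: "finite L"
    and d_nonneg: "\<And>a. 0 \<le> d a" and d_le: "\<And>a. d a \<le> D"
    and card_L_le: "card L \<le> D" and D_ge: "1 \<le> D" and N_ge: "1 \<le> N"
begin

definition tot :: "('a \<Rightarrow> real) \<Rightarrow> 'a \<Rightarrow> real" where
  "tot u c = d c + (\<Sum>l | l \<in> L \<and> f l = c. u l)"

definition share :: "('a \<Rightarrow> real) \<Rightarrow> 'a \<Rightarrow> real" where
  "share u l = u l / tot u (f l)"

definition rate :: "('a \<Rightarrow> real) \<Rightarrow> 'a \<Rightarrow> real" where
  "rate u l = (u l)\<^sup>2 / (N * (d l + u l) * tot u (f l))"

definition arrival :: "('a \<Rightarrow> real) \<Rightarrow> 'a \<Rightarrow> real" where
  "arrival u c = (\<Sum>l | l \<in> L \<and> f l = c. rate u l)"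

text \<open>
  The expected change of \<open>\<phi>\<close> in one step, not counting the reinforcement of non-edges.
\<close>

definition gen :: "(('a \<Rightarrow> real) \<Rightarrow> real) \<Rightarrow> ('a \<Rightarrow> real) \<Rightarrow> real" where
  "gen \<phi> u = (\<Sum>l\<in>L. rate u l * (\<phi> (u(l := u l + 1)) - \<phi> u))"

section \<open>Exact formulas for the one-step drift\<close>

lemma finite_star [simp]: "finite {l \<in> L. f l = c}"
  using finite_L by simp

lemma tot_bump:
  assumes "k \<in> L"
  shows "tot (u(k := u k + 1)) c = tot u c + (if f k = c then 1 else 0)"
proof -
  have "(\<Sum>l | l \<in> L \<and> f l = c. (u(k := u k + 1)) l)
      = (\<Sum>l | l \<in> L \<and> f l = c. u l + (if l = k then 1 else 0))"
    by (intro sum.cong) auto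
  also have "\<dots> = (\<Sum>l | l \<in> L \<and> f l = c. u l) + (if f k = c then 1 else 0)"
    using assms by (simp add: sum.distrib)
  finally show ?thesis by (simp add: tot_def)
qed

text \<open>Only the star of \<open>f l\<close> matters: reinforcing \<open>l\<close> raises both
  arguments of \<open>g\<close>, reinforcing another leaf of the star raises only the total. The
  difference of \<open>arrival\<close> and \<open>rate\<close> is the combined rate of those other
  leaves.\<close>

lemma gen_leaf:
  assumes l: "l \<in> L"
  shows "gen (\<lambda>u. g (u l) (tot u (f l))) u =
     rate u l * (g (u l + 1) (tot u (f l) + 1) - g (u l) (tot u (f l)))
     + (arrival u (f l) - rate u l) * (g (u l) (tot u (f l) + 1) - g (u l) (tot u (f l)))"
proof -
  define t where "t = tot u (f l)"
  define h where "h k = rate u k * (g ((u(k := u k + 1)) l) (tot (u(k := u k + 1)) (f l)) - g (u l) t)" for k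
  have rest: "h k = rate u k * (g (u l) (t + 1) - g (u l) t)" if "k \<in> {k \<in> L. f k = f l} - {l}" for k
  proof -
    have "tot (u(k := u k + 1)) (f l) = t + 1" "k \<noteq> l"
      using that tot_bump [of k u "f l"] by (auto simp: t_def)
    then show ?thesis by (simp add: h_def)
  qed
  have hl: "h l = rate u l * (g (u l + 1) (t + 1) - g (u l) t)"
    using l by (simp add: h_def t_def tot_bump)
  have "gen (\<lambda>u. g (u l) (tot u (f l))) u = sum h L"
    by (simp add: gen_def h_def t_def)
  also have "\<dots> = sum h {k \<in> L. f k = f l}"
    by (rule sum.mono_neutral_right) (use finite_L l in \<open>auto simp: h_def t_def tot_bump\<close>)
  also have "\<dots> = h l + sum h ({k \<in> L. f k = f l} - {l})"
    using l by (simp add: sum.remove)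
  also have "\<dots> = h l + (\<Sum>k\<in>{k \<in> L. f k = f l} - {l}. rate u k) * (g (u l) (t + 1) - g (u l) t)"
    using rest by (simp add: sum_distrib_right)
  also have "(\<Sum>k\<in>{k \<in> L. f k = f l} - {l}. rate u k) = arrival u (f l) - rate u l"
    using l by (simp add: arrival_def sum_diff1)
  finally show ?thesis by (simp only: hl t_def)
qed

lemma gen_tot:
  "gen (\<lambda>u. g (tot u c)) u = arrival u c * (g (tot u c + 1) - g (tot u c))"
proof -
  have "gen (\<lambda>u. g (tot u c)) u
      = (\<Sum>k | k \<in> L \<and> f k = c. rate u k * (g (tot (u(k := u k + 1)) c) - g (tot u c)))"
    unfolding gen_def
    by (rule sum.mono_neutral_right) (use finite_L in \<open>auto simp: tot_bump\<close>)
  also have "\<dots> = (\<Sum>k | k \<in> L \<and> f k = c. rate u k * (g (tot u c + 1) - g (tot u c)))"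
    by (rule sum.cong) (auto simp: tot_bump)
  finally show ?thesis by (simp add: arrival_def sum_distrib_right)
qed

lemma gen_sum: "gen (\<lambda>u. \<Sum>i\<in>I. \<phi> i u) u = (\<Sum>i\<in>I. gen (\<phi> i) u)"
  by (simp add: gen_def sum_subtractf [symmetric] sum_distrib_left sum.swap [of _ I L])

lemma gen_add: "gen (\<lambda>u. \<phi> u + \<psi> u) u = gen \<phi> u + gen \<psi> u"
  by (simp add: gen_def sum.distrib [symmetric] algebra_simps)

lemma gen_cmult: "gen (\<lambda>u. c * \<phi> u) u = c * gen \<phi> u"
  by (simp add: gen_def sum_distrib_left algebra_simps)

section \<open>Comparison with the exact Polya urn\<close>

context
  fixes u :: "'a \<Rightarrow> real"
  assumes u_ge: "\<And>l. l \<in> L \<Longrightarrow> 1 \<le> u l"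
begin

lemma leaf_le_tot:
  assumes "l \<in> L"
  shows "u l \<le> tot u (f l)"
proof -
  have "u l \<le> (\<Sum>k | k \<in> L \<and> f k = f l. u k)"
    by (rule member_le_sum) (use assms u_ge in \<open>auto intro: order_trans [OF zero_le_one]\<close>)
  then show ?thesis using d_nonneg [of "f l"] by (simp add: tot_def)
qed

lemma tot_ge_1: "l \<in> L \<Longrightarrow> 1 \<le> tot u (f l)"
  using leaf_le_tot u_ge by (meson order_trans)

lemma share_nonneg: "l \<in> L \<Longrightarrow> 0 \<le> share u l"
  using tot_ge_1 [of l] u_ge [of l] by (simp add: share_def)

lemma share_le_1: "l \<in> L \<Longrightarrow> share u l \<le> 1"
  using tot_ge_1 [of l] leaf_le_tot [of l] by (simp add: share_def divide_simps)

lemma rate_nonneg: "l \<in> L \<Longrightarrow> 0 \<le> rate u l"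
  using tot_ge_1 [of l] u_ge [of l] d_nonneg [of l] N_ge by (simp add: rate_def)

lemma rate_le:
  assumes "l \<in> L" shows "rate u l \<le> share u l / N"
  using tot_ge_1 [OF assms] u_ge [OF assms] d_nonneg [of l] N_ge
  by (simp add: rate_def share_def divide_simps power2_eq_square)

text \<open>Since \<open>(u l - d l) * (u l + d l) \<le> (u l)\<^sup>2\<close>, the entries of
  weight 1 at the leaf bring the factor \<open>(u l)\<^sup>2 / (d l + u l)\<close> at most
  \<open>d l \<le> D\<close> below \<open>u l\<close>.\<close>

lemma rate_ge:
  assumes "l \<in> L" shows "(share u l - D / tot u (f l)) / N \<le> rate u l"
proof -
  have "(u l - D) * (d l + u l) \<le> (u l)\<^sup>2"
  proof -
    have "(u l - D) * (d l + u l) \<le> (u l - d l) * (d l + u l)"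
      using u_ge [OF assms] d_nonneg [of l] d_le [of l] by (intro mult_right_mono) auto
    also have "\<dots> \<le> (u l)\<^sup>2" by (simp add: algebra_simps power2_eq_square)
    finally show ?thesis .
  qed
  then have "(u l - D) / (N * tot u (f l)) \<le> (u l)\<^sup>2 / (d l + u l) / (N * tot u (f l))"
    using tot_ge_1 [OF assms] u_ge [OF assms] d_nonneg [of l] N_ge
    by (intro divide_right_mono) (auto simp: pos_le_divide_eq)
  then show ?thesis by (simp add: rate_def share_def diff_divide_distrib mult_ac)
qed

lemma sum_share:
  assumes "k \<in> L"
  shows "(\<Sum>l | l \<in> L \<and> f l = f k. share u l) = 1 - d (f k) / tot u (f k)"
proof -
  have "(\<Sum>l | l \<in> L \<and> f l = f k. share u l) = (tot u (f k) - d (f k)) / tot u (f k)"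
    by (simp add: tot_def share_def sum_divide_distrib)
  then show ?thesis using tot_ge_1 [OF assms] by (simp add: diff_divide_distrib)
qed

lemma arrival_le:
  assumes "k \<in> L" shows "arrival u (f k) \<le> 1 / N"
proof -
  have "arrival u (f k) \<le> (\<Sum>l | l \<in> L \<and> f l = f k. share u l / N)"
    unfolding arrival_def by (intro sum_mono rate_le) auto
  also have "\<dots> = (1 - d (f k) / tot u (f k)) / N"
    using sum_share [OF assms] by (simp add: sum_divide_distrib [symmetric])
  also have "\<dots> \<le> 1 / N"
    using tot_ge_1 [OF assms] d_nonneg [of "f k"] N_ge by (intro divide_right_mono) auto
  finally show ?thesis .
qed

lemma arrival_ge:
  assumes "k \<in> L" shows "(1 - 2 * D\<^sup>2 / tot u (f k)) / N \<le> arrival u (f k)"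
proof -
  let ?t = "tot u (f k)"
  let ?S = "{l \<in> L. f l = f k}"
  have t: "1 \<le> ?t" by (rule tot_ge_1 [OF assms])
  have "card ?S \<le> card L" by (rule card_mono) (use finite_L in auto)
  then have c: "real (card ?S) * D \<le> D * D"
    using card_L_le D_ge by (intro mult_right_mono) auto
  \<comment> \<open>The loss is at most \<open>D\<close> at the center and at most \<open>D\<close>
    at each of at most \<open>D\<close> leaves; \<open>D \<le> D\<^sup>2\<close> merges the
    two.\<close>
  have "d (f k) + card ?S * D \<le> 2 * D\<^sup>2"
    using c d_le [of "f k"] D_ge mult_mono [of 1 D D D] unfolding power2_eq_square by linarith
  then have "(d (f k) + card ?S * D) / ?t \<le> 2 * D\<^sup>2 / ?t"
    using t by (intro divide_right_mono) auto
  then have "(1 - 2 * D\<^sup>2 / ?t) / N \<le> ((1 - d (f k) / ?t) - card ?S * (D / ?t)) / N"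
    using N_ge by (intro divide_right_mono) (auto simp: add_divide_distrib)
  also have "\<dots> = (\<Sum>l\<in>?S. (share u l - D / ?t) / N)"
    using sum_share [OF assms] by (simp add: sum_divide_distrib [symmetric] sum_subtractf)
  also have "\<dots> \<le> arrival u (f k)"
    unfolding arrival_def by (intro sum_mono) (metis (mono_tags, lifting) mem_Collect_eq rate_ge)
  finally show ?thesis .
qed

lemma arrival_nonneg: "0 \<le> arrival u c"
  unfolding arrival_def by (intro sum_nonneg) (auto intro: rate_nonneg)

lemma arrival_minus_rate_nonneg:
  assumes "l \<in> L" shows "rate u l \<le> arrival u (f l)"
  unfolding arrival_def by (rule member_le_sum) (use assms rate_nonneg in auto)

text \<open>With rate \<open>p\<close>, arrival rate \<open>q\<close> and share \<open>x\<close>,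
  one step moves the share on average by \<open>(p * (1 - x) - (q - p) * x) / (tot + 1) = (p - x *
  q) / (tot + 1)\<close>. In the exact urn \<open>p = x / N\<close> and \<open>q = 1 / N\<close>,
  and the numerator vanishes; here both differ from these values by a term of order
  \<open>1 / tot\<close>.\<close>

lemma abs_drift_share_le:
  assumes "l \<in> L"
  shows "\<bar>rate u l - share u l * arrival u (f l)\<bar> \<le> 2 * D\<^sup>2 / (N * tot u (f l))"
proof -
  let ?t = "tot u (f l)" and ?x = "share u l"
  note t = tot_ge_1 [OF assms] and x = share_nonneg [OF assms] share_le_1 [OF assms]
  have *: "?x * ((1 - 2 * D\<^sup>2 / ?t) / N) \<le> ?x * arrival u (f l)"
    by (intro mult_left_mono arrival_ge assms x)
  have "?x * (2 * D\<^sup>2 / (N * ?t)) \<le> 1 * (2 * D\<^sup>2 / (N * ?t))"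
    using t x N_ge by (intro mult_right_mono) auto
  then have 1: "rate u l - ?x * arrival u (f l) \<le> 2 * D\<^sup>2 / (N * ?t)"
    using * rate_le [OF assms] by (simp add: algebra_simps diff_divide_distrib)
  have **: "?x * arrival u (f l) \<le> ?x * (1 / N)"
    by (intro mult_left_mono arrival_le assms x)
  have "D \<le> 2 * D\<^sup>2" using D_ge mult_mono [of 1 D D D] by (simp add: power2_eq_square)
  then have "D / (N * ?t) \<le> 2 * D\<^sup>2 / (N * ?t)"
    using t N_ge by (intro divide_right_mono) auto
  then have 2: "- (2 * D\<^sup>2 / (N * ?t)) \<le> rate u l - ?x * arrival u (f l)"
    using ** rate_ge [OF assms] by (simp add: algebra_simps diff_divide_distrib)
  from 1 2 show ?thesis by (simp add: abs_le_iff)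
qed

text \<open>Expanding the square, the part linear in the jump has coefficient at most 2 because
  \<open>share u l\<close> and \<open>a\<close> lie between 0 and 1, so the drift bound turns it
  into \<open>4 * D\<^sup>2\<close>. The squared jumps, of size at most
  \<open>1 / (tot + 1)\<close>, add 1, and
  \<open>4 * D\<^sup>2 + 1 \<le> 5 * D\<^sup>2\<close>.\<close>

lemma gen_share_square_le:
  assumes "l \<in> L" "0 \<le> a" "a \<le> 1"
  shows "gen (\<lambda>u. (share u l - a)\<^sup>2) u \<le> 5 * D\<^sup>2 / (N * (tot u (f l))\<^sup>2)"
proof -
  let ?t = "tot u (f l)" and ?x = "share u l" and ?p = "rate u l" and ?q = "arrival u (f l)"
  note t = tot_ge_1 [OF assms(1)] and x = share_nonneg [OF assms(1)] share_le_1 [OF assms(1)]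
  have u: "u l = ?x * ?t" using t by (simp add: share_def)
  have hit: "(u l + 1) / (?t + 1) = ?x + (1 - ?x) / (?t + 1)"
    using t by (simp add: u divide_simps) (simp add: algebra_simps)
  have miss: "u l / (?t + 1) = ?x - ?x / (?t + 1)"
    using t by (simp add: u divide_simps) (simp add: algebra_simps)
  have "gen (\<lambda>u. (share u l - a)\<^sup>2) u
      = ?p * (((u l + 1) / (?t + 1) - a)\<^sup>2 - (?x - a)\<^sup>2)
        + (?q - ?p) * ((u l / (?t + 1) - a)\<^sup>2 - (?x - a)\<^sup>2)"
    using gen_leaf [OF assms(1), where g = "\<lambda>y t. (y / t - a)\<^sup>2"] by (simp add: share_def)
  also have "\<dots> = 2 * (?x - a) * (?p - ?x * ?q) / (?t + 1)
        + (?p * (1 - ?x)\<^sup>2 + (?q - ?p) * ?x\<^sup>2) / (?t + 1)\<^sup>2"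
  proof -
    have "((?x + e) - a)\<^sup>2 - (?x - a)\<^sup>2 = 2 * (?x - a) * e + e\<^sup>2" for e
      by (simp add: power2_eq_square algebra_simps)
    from this [of "(1 - ?x) / (?t + 1)"] this [of "- (?x / (?t + 1))"]
    have *: "((?x + (1 - ?x) / (?t + 1)) - a)\<^sup>2 - (?x - a)\<^sup>2
        = 2 * (?x - a) * ((1 - ?x) / (?t + 1)) + ((1 - ?x) / (?t + 1))\<^sup>2"
      "((?x - ?x / (?t + 1)) - a)\<^sup>2 - (?x - a)\<^sup>2
        = - (2 * (?x - a) * (?x / (?t + 1))) + (?x / (?t + 1))\<^sup>2"
      by simp_all
    \<comment> \<open>\<open>r\<close> stands for the reciprocal of \<open>?t + 1\<close>, which
      makes the identity polynomial.\<close>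
    have alg: "p * (2 * y * ((1 - x) * r) + ((1 - x) * r)\<^sup>2) + (q - p) * (- (2 * y * (x * r)) + (x * r)\<^sup>2)
        = 2 * y * (p - x * q) * r + (p * (1 - x)\<^sup>2 + (q - p) * x\<^sup>2) * r\<^sup>2" for p q x y r :: real
      by (simp add: power2_eq_square algebra_simps)
    show ?thesis
      unfolding hit miss *
      using alg [of ?p "?x - a" ?x "inverse (?t + 1)" ?q]
      by (simp only: divide_inverse power_inverse)
  qed
  also have "\<dots> \<le> 4 * D\<^sup>2 / (N * ?t\<^sup>2) + 1 / (N * ?t\<^sup>2)"
  proof (rule add_mono)
    have "(?x - a) * (?p - ?x * ?q) \<le> \<bar>?x - a\<bar> * \<bar>?p - ?x * ?q\<bar>"
      by (simp add: abs_mult [symmetric])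
    also have "\<dots> \<le> 1 * (2 * D\<^sup>2 / (N * ?t))"
      using x assms by (intro mult_mono abs_drift_share_le) auto
    finally have "2 * ((?x - a) * (?p - ?x * ?q)) / (?t + 1) \<le> 4 * D\<^sup>2 / (N * ?t) / (?t + 1)"
      using t by (intro divide_right_mono) linarith+
    then have "2 * (?x - a) * (?p - ?x * ?q) / (?t + 1) \<le> 4 * D\<^sup>2 / (N * ?t) / (?t + 1)"
      by (simp only: mult.assoc)
    also have "\<dots> \<le> 4 * D\<^sup>2 / (N * ?t) / ?t"
      using t N_ge by (intro divide_left_mono) auto
    finally show "2 * (?x - a) * (?p - ?x * ?q) / (?t + 1) \<le> 4 * D\<^sup>2 / (N * ?t\<^sup>2)"
      by (simp add: power2_eq_square mult_ac)
  next
    have "(1 - ?x)\<^sup>2 \<le> 1" "?x\<^sup>2 \<le> 1"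
      using x by (auto simp: power_le_one_iff abs_square_le_1)
    then have "?p * (1 - ?x)\<^sup>2 + (?q - ?p) * ?x\<^sup>2 \<le> ?p * 1 + (?q - ?p) * 1"
      using rate_nonneg [OF assms(1)] arrival_minus_rate_nonneg [OF assms(1)]
      by (intro add_mono mult_left_mono) auto
    also have "\<dots> \<le> 1 / N" using arrival_le [OF assms(1)] by simp
    finally have "(?p * (1 - ?x)\<^sup>2 + (?q - ?p) * ?x\<^sup>2) / (?t + 1)\<^sup>2 \<le> 1 / N / (?t + 1)\<^sup>2"
      by (intro divide_right_mono) auto
    also have "\<dots> \<le> 1 / N / ?t\<^sup>2"
      using t N_ge by (intro divide_left_mono power_mono) auto
    finally show "(?p * (1 - ?x)\<^sup>2 + (?q - ?p) * ?x\<^sup>2) / (?t + 1)\<^sup>2 \<le> 1 / (N * ?t\<^sup>2)"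
      by simp
  qed
  also have "\<dots> \<le> 5 * D\<^sup>2 / (N * ?t\<^sup>2)"
  proof -
    have "4 * D\<^sup>2 + 1 \<le> 5 * D\<^sup>2" using D_ge by (simp add: one_le_power)
    then show ?thesis
      unfolding add_divide_distrib [symmetric] using N_ge by (intro divide_right_mono) auto
  qed
  finally show ?thesis .
qed

text \<open>The lower bound on \<open>tot\<close> keeps the arrival rate at least at half of its
  ideal value \<open>1 / N\<close>; a second factor \<open>1 / 2\<close> comes from
  \<open>tot * (tot + 1) \<le> 2 * tot\<^sup>2\<close>. This negative drift compensates all errors
  of order \<open>1 / tot\<^sup>2\<close>.\<close>

lemma gen_inverse_tot_le:
  assumes "k \<in> L" and t4: "4 * D\<^sup>2 \<le> tot u (f k)"
  shows "gen (\<lambda>u. 1 / tot u (f k)) u \<le> - (1 / (4 * N * (tot u (f k))\<^sup>2))"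
proof -
  let ?t = "tot u (f k)" and ?q = "arrival u (f k)"
  note t = tot_ge_1 [OF assms(1)]
  have "2 * D\<^sup>2 / ?t \<le> 1 / 2" using t t4 by (simp add: divide_simps)
  then have "1 / 2 / N \<le> (1 - 2 * D\<^sup>2 / ?t) / N"
    using N_ge by (intro divide_right_mono) auto
  then have q: "1 / (2 * N) \<le> ?q" using arrival_ge [OF assms(1)] by simp
  have "1 / (?t + 1) - 1 / ?t = - (1 / (?t * (?t + 1)))"
    using t by (simp add: divide_simps)
  then have "gen (\<lambda>u. 1 / tot u (f k)) u = - (?q * (1 / (?t * (?t + 1))))"
    using gen_tot [where g = "\<lambda>t. 1 / t"] by simp
  moreover have "1 / (2 * N) * (1 / (?t * (?t + ?t))) \<le> ?q * (1 / (?t * (?t + 1)))"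
    using q t N_ge arrival_nonneg
    by (intro mult_mono divide_left_mono mult_left_mono mult_pos_pos) auto
  ultimately show ?thesis by (simp add: power2_eq_square mult_ac)
qed

end

end

section \<open>One step of the process\<close>

text \<open>Takes the place of measurability with respect to the past: plays have finitely many
  values, so along the process every such real function is a finite sum of multiples of indicators
  of cylinders, hence measurable and integrable at once.\<close>

definition adapted :: "nat \<Rightarrow> ((nat \<Rightarrow> 'a) \<Rightarrow> 'b) \<Rightarrow> bool" where
  "adapted n F \<longleftrightarrow> (\<forall>h h'. (\<forall>m<n. h m = h' m) \<longrightarrow> F h = F h')"

lemma adaptedI: "(\<And>h h'. (\<And>m. m < n \<Longrightarrow> h m = h' m) \<Longrightarrow> F h = F h') \<Longrightarrow> adapted n F"
  unfolding adapted_def by blast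

lemma adaptedD: "adapted n F \<Longrightarrow> (\<And>m. m < n \<Longrightarrow> h m = h' m) \<Longrightarrow> F h = F h'"
  unfolding adapted_def by blast

lemma adapted_mono: "adapted m F \<Longrightarrow> m \<le> n \<Longrightarrow> adapted n F"
  unfolding adapted_def by (meson order_less_le_trans)

lemma adapted_const: "adapted n (\<lambda>h. c)"
  by (simp add: adapted_def)

lemma adapted_comp: "adapted n F \<Longrightarrow> adapted n (\<lambda>h. g (F h))"
  unfolding adapted_def by metis

lemma adapted_comp2: "adapted n F \<Longrightarrow> adapted n G \<Longrightarrow> adapted n (\<lambda>h. g (F h) (G h))"
  unfolding adapted_def by metis

text \<open>For evaluating a function chosen by the past at a random argument, as in
  \<open>\<phi> h (val n h)\<close>.\<close>

lemma adapted_app: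
  fixes G :: "(nat \<Rightarrow> 'a) \<Rightarrow> 'b \<Rightarrow> 'c"
  assumes G: "\<And>x. adapted n (\<lambda>h. G h x)" and X: "adapted n X"
  shows "adapted n (\<lambda>h. G h (X h))"
proof (rule adaptedI)
  fix h h' :: "nat \<Rightarrow> 'a" assume eq: "\<And>m. m < n \<Longrightarrow> h m = h' m"
  have "X h = X h'" by (rule adaptedD [OF X eq])
  moreover have "G h (X h) = G h' (X h)" by (rule adaptedD [OF G eq])
  ultimately show "G h (X h) = G h' (X h')" by simp
qed

lemma adapted_weight: "adapted n (\<lambda>h. weight h n)"
proof (rule adaptedI)
  fix h h' :: "nat \<Rightarrow> 'a play"
  show "(\<And>m. m < n \<Longrightarrow> h m = h' m) \<Longrightarrow> weight h n = weight h' n"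
    by (induction n) (auto intro!: ext)
qed

lemma weight_ge_1: "1 \<le> weight h n i j"
  by (induction n) auto

lemma weight_pos: "0 < weight h n i j"
  using weight_ge_1 [of h n i j] by linarith

lemma weight_mono: "m \<le> n \<Longrightarrow> weight h m i j \<le> weight h n i j"
  by (rule lift_Suc_mono_le [of "\<lambda>n. weight h n i j"]) auto

definition bump :: "'a \<Rightarrow> 'a \<Rightarrow> ('a \<Rightarrow> 'a \<Rightarrow> real) \<Rightarrow> 'a \<Rightarrow> 'a \<Rightarrow> real" where
  "bump i j v = v(i := (v i)(j := v i j + 1))"

lemma weight_Suc_upd:
  "weight (h(n := q)) (Suc n) =
     (if act q = state q then bump (state q) (signal q) (weight h n) else weight h n)"
proof -
  have "weight (h(n := q)) n = weight h n"
    by (rule adaptedD [OF adapted_weight]) auto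
  then show ?thesis by (auto simp: bump_def fun_eq_iff)
qed

section \<open>The law of one step given the past\<close>

context signaling_process
begin

definition path :: "'w \<Rightarrow> nat \<Rightarrow> 'a play" where
  "path \<omega> = (\<lambda>n. play n \<omega>)"

definition plays :: "'a play set" where
  "plays = {q. state q \<in> S\<^sub>1 \<and> signal q \<in> S\<^sub>2 \<and> act q \<in> S\<^sub>1}"

definition cyl :: "(nat \<Rightarrow> 'a play) \<Rightarrow> nat \<Rightarrow> 'w set" where
  "cyl h n = {\<omega> \<in> space M. \<forall>m<n. play m \<omega> = h m}"

definition play_prob :: "('a \<Rightarrow> 'a \<Rightarrow> real) \<Rightarrow> 'a play \<Rightarrow> real" where
  "play_prob v q = 1 / card S\<^sub>1 * (v (state q) (signal q) / (\<Sum>l\<in>S\<^sub>2. v (state q) l))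
     * (v (act q) (signal q) / (\<Sum>l\<in>S\<^sub>1. v l (signal q)))"

lemma plays_eq: "plays = (\<lambda>(i, j, k). Play i j k) ` (S\<^sub>1 \<times> S\<^sub>2 \<times> S\<^sub>1)"
proof -
  have "q \<in> (\<lambda>(i, j, k). Play i j k) ` (S\<^sub>1 \<times> S\<^sub>2 \<times> S\<^sub>1)" if "q \<in> plays" for q
    using that by (intro image_eqI [of _ _ "(state q, signal q, act q)"]) (auto simp: plays_def)
  then show ?thesis by (auto simp: plays_def)
qed

lemma finite_plays: "finite plays"
  using finite_states finite_signals by (simp add: plays_eq)

lemma sum_plays: "(\<Sum>q\<in>plays. g q) = (\<Sum>i\<in>S\<^sub>1. \<Sum>j\<in>S\<^sub>2. \<Sum>k\<in>S\<^sub>1. g (Play i j k))"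
proof -
  have "inj_on (\<lambda>(i, j, k). Play i j k) (S\<^sub>1 \<times> S\<^sub>2 \<times> S\<^sub>1)"
    by (auto simp: inj_on_def)
  then have "(\<Sum>q\<in>plays. g q) = (\<Sum>p\<in>S\<^sub>1 \<times> S\<^sub>2 \<times> S\<^sub>1. g (case p of (i, j, k) \<Rightarrow> Play i j k))"
    unfolding plays_eq by (rule sum.reindex [unfolded comp_def])
  also have "\<dots> = (\<Sum>i\<in>S\<^sub>1. \<Sum>j\<in>S\<^sub>2. \<Sum>k\<in>S\<^sub>1. g (Play i j k))"
    by (simp only: sum.cartesian_product case_prod_unfold)
  finally show ?thesis .
qed

lemma play_in_plays: "\<omega> \<in> space M \<Longrightarrow> play n \<omega> \<in> plays"
  using measurable_space [OF measurable_state, of \<omega> n]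
    measurable_space [OF measurable_signal, of \<omega> n]
    measurable_space [OF measurable_act, of \<omega> n]
  by (simp add: plays_def)

lemma measurable_state_eq [measurable]: "{\<omega> \<in> space M. state (play n \<omega>) = i} \<in> sets M"
proof (cases "i \<in> S\<^sub>1")
  case True
  then show ?thesis using measurable_sets [OF measurable_state, of "{i}" n]
    by (simp add: vimage_def Int_def conj_commute)
next
  case False
  then have "{\<omega> \<in> space M. state (play n \<omega>) = i} = {}"
    using play_in_plays by (auto simp: plays_def)
  then show ?thesis by (metis sets.empty_sets)
qed

lemma measurable_signal_eq [measurable]: "{\<omega> \<in> space M. signal (play n \<omega>) = i} \<in> sets M"
proof (cases "i \<in> S\<^sub>2")
  case True
  then show ?thesis using measurable_sets [OF measurable_signal, of "{i}" n]
    by (simp add: vimage_def Int_def conj_commute)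
next
  case False
  then have "{\<omega> \<in> space M. signal (play n \<omega>) = i} = {}"
    using play_in_plays by (auto simp: plays_def)
  then show ?thesis by (metis sets.empty_sets)
qed

lemma measurable_act_eq [measurable]: "{\<omega> \<in> space M. act (play n \<omega>) = i} \<in> sets M"
proof (cases "i \<in> S\<^sub>1")
  case True
  then show ?thesis using measurable_sets [OF measurable_act, of "{i}" n]
    by (simp add: vimage_def Int_def conj_commute)
next
  case False
  then have "{\<omega> \<in> space M. act (play n \<omega>) = i} = {}"
    using play_in_plays by (auto simp: plays_def)
  then show ?thesis by (metis sets.empty_sets)
qed

lemma play_eq_iff: "p = q \<longleftrightarrow> state p = state q \<and> signal p = signal q \<and> act p = act q"
  by (auto simp: play.expand)

lemma measurable_play_eq [measurable]: "{\<omega> \<in> space M. play n \<omega> = q} \<in> sets M"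
  unfolding play_eq_iff by (intro sets.sets_Collect_conj) measurable

lemma sets_cyl [measurable]: "cyl h n \<in> sets M"
  unfolding cyl_def by measurable

lemma row_sum_pos: "0 < (\<Sum>l\<in>S\<^sub>2. weight h n i l)"
  using finite_signals signals_nonempty by (intro sum_pos) (auto simp: weight_pos)

lemma col_sum_pos: "0 < (\<Sum>l\<in>S\<^sub>1. weight h n l j)"
  using finite_states states_nonempty by (intro sum_pos) (auto simp: weight_pos)

lemma card_states_pos: "0 < card S\<^sub>1"
  using finite_states states_nonempty by (simp add: card_gt_0_iff)

text \<open>The chain rule for the three conditional laws. Positive weights keep each intermediate
  conditioning event at positive probability, so the quotients can be cleared; for a past of
  probability 0 both sides are 0.\<close>

lemma prob_cyl_play:
  assumes q: "q \<in> plays"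
  shows "prob (cyl h n \<inter> {\<omega> \<in> space M. play n \<omega> = q}) = prob (cyl h n) * play_prob (weight h n) q"
proof (cases "prob (cyl h n) > 0")
  case False
  then have 0: "prob (cyl h n) = 0" by (simp add: zero_less_measure_iff)
  have "prob (cyl h n \<inter> {\<omega> \<in> space M. play n \<omega> = q}) \<le> prob (cyl h n)"
    by (rule finite_measure_mono) auto
  then show ?thesis using 0 by (simp add: measure_le_0_iff)
next
  case True
  let ?i = "state q" and ?j = "signal q" and ?k = "act q"
  have mem: "?i \<in> S\<^sub>1" "?j \<in> S\<^sub>2" "?k \<in> S\<^sub>1" using q by (auto simp: plays_def)
  let ?P0 = "\<P>(\<omega> in M. \<forall>m<n. play m \<omega> = h m)"
  let ?P1 = "\<P>(\<omega> in M. (\<forall>m<n. play m \<omega> = h m) \<and> state (play n \<omega>) = ?i)"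
  let ?P2 = "\<P>(\<omega> in M. (\<forall>m<n. play m \<omega> = h m) \<and> state (play n \<omega>) = ?i \<and> signal (play n \<omega>) = ?j)"
  let ?P3 = "\<P>(\<omega> in M. (\<forall>m<n. play m \<omega> = h m) \<and> state (play n \<omega>) = ?i \<and> signal (play n \<omega>) = ?j \<and> act (play n \<omega>) = ?k)"
  have P0: "?P0 = prob (cyl h n)" by (simp add: cyl_def)
  have P3: "?P3 = prob (cyl h n \<inter> {\<omega> \<in> space M. play n \<omega> = q})"
    by (rule arg_cong [of _ _ prob]) (auto simp: cyl_def play_eq_iff [of _ q])
  have V: "V S\<^sub>1 S\<^sub>2 h n i j = weight h n i j" if "i \<in> S\<^sub>1" "j \<in> S\<^sub>2" for i j
    using that by (simp add: V_def)
  have mult: "x = y * r" if "x / y = r" "0 < y" for x y r :: real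
    using that by auto
  have c1: "?P1 = ?P0 * (1 / card S\<^sub>1)"
    using state_law [of n h ?i] True mem unfolding P0 [symmetric] cond_prob_def
    by (intro mult) (simp_all add: conj_commute)
  then have pos1: "?P1 > 0" using True P0 card_states_pos by simp
  have c2: "?P2 = ?P1 * (weight h n ?i ?j / (\<Sum>l\<in>S\<^sub>2. weight h n ?i l))"
    using signal_law [of n h ?i ?j] True mem pos1 unfolding P0 [symmetric] cond_prob_def
    by (intro mult) (simp_all add: V conj_ac)
  have pos2: "?P2 > 0"
    unfolding c2 by (intro mult_pos_pos divide_pos_pos pos1 weight_pos row_sum_pos)
  have c3: "?P3 = ?P2 * (weight h n ?k ?j / (\<Sum>l\<in>S\<^sub>1. weight h n l ?j))"
    using act_law [of n h ?i ?j ?k] True mem pos2 unfolding P0 [symmetric] cond_prob_def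
    by (intro mult) (simp_all add: V conj_ac)
  show ?thesis
    unfolding P3 [symmetric] P0 [symmetric] c3 c2 c1 by (simp add: play_prob_def)
qed

text \<open>The extensional functions on \<open>{..<n}\<close> contain exactly one representative of
  each past, so exactly one of the cylinders contains \<open>\<omega>\<close>.\<close>

lemma adapted_eq_sum_indicator:
  fixes F :: "(nat \<Rightarrow> 'a play) \<Rightarrow> real"
  assumes F: "adapted n F" and \<omega>: "\<omega> \<in> space M"
  shows "F (path \<omega>) = (\<Sum>h\<in>{..<n} \<rightarrow>\<^sub>E plays. F h * indicator (cyl h n) \<omega>)"
proof -
  let ?r = "restrict (path \<omega>) {..<n}"
  have fin: "finite ({..<n} \<rightarrow>\<^sub>E plays)" by (intro finite_PiE) (auto simp: finite_plays)
  have r: "?r \<in> {..<n} \<rightarrow>\<^sub>E plays" using play_in_plays [OF \<omega>] by (auto simp: path_def)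
  have "(\<Sum>h\<in>{..<n} \<rightarrow>\<^sub>E plays. F h * indicator (cyl h n) \<omega>) = (\<Sum>h\<in>{?r}. F h * indicator (cyl h n) \<omega>)"
  proof (rule sum.mono_neutral_right [OF fin])
    show "{?r} \<subseteq> {..<n} \<rightarrow>\<^sub>E plays" using r by auto
    show "\<forall>h\<in>({..<n} \<rightarrow>\<^sub>E plays) - {?r}. F h * indicator (cyl h n) \<omega> = 0"
    proof
      fix h assume h: "h \<in> ({..<n} \<rightarrow>\<^sub>E plays) - {?r}"
      have "\<omega> \<notin> cyl h n"
      proof
        assume "\<omega> \<in> cyl h n"
        then have "h = ?r" using h by (intro PiE_ext [of h "{..<n}" "\<lambda>_. plays" ?r]) (use r in \<open>auto simp: cyl_def path_def\<close>)
        with h show False by simp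
      qed
      then show "F h * indicator (cyl h n) \<omega> = 0" by simp
    qed
  qed
  also have "\<dots> = F ?r" using \<omega> by (simp add: cyl_def path_def indicator_def)
  also have "\<dots> = F (path \<omega>)" by (rule adaptedD [OF F]) auto
  finally show ?thesis by simp
qed

lemma integrable_adapted:
  fixes F :: "(nat \<Rightarrow> 'a play) \<Rightarrow> real"
  assumes F: "adapted n F"
  shows "integrable M (\<lambda>\<omega>. F (path \<omega>))"
proof -
  have "integrable M (\<lambda>\<omega>. \<Sum>h\<in>{..<n} \<rightarrow>\<^sub>E plays. F h * indicator (cyl h n) \<omega>)"
    by (intro Bochner_Integration.integrable_sum integrable_mult_right integrable_real_indicator)
      (auto simp: emeasure_eq_measure)
  then show ?thesis
    by (rule Bochner_Integration.integrable_cong [THEN iffD2, rotated 2])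
      (auto simp: adapted_eq_sum_indicator [OF F])
qed

lemma sets_adapted:
  assumes "adapted n P"
  shows "{\<omega> \<in> space M. P (path \<omega>)} \<in> sets M"
proof -
  have "(\<lambda>\<omega>. (if P (path \<omega>) then 1 else 0 :: real)) \<in> borel_measurable M"
    by (rule borel_measurable_integrable)
      (rule integrable_adapted [OF adapted_comp [OF assms, of "\<lambda>b. if b then 1 else 0"]])
  then have "{\<omega> \<in> space M. (if P (path \<omega>) then 1 else 0 :: real) = 1} \<in> sets M"
    by measurable
  also have "{\<omega> \<in> space M. (if P (path \<omega>) then 1 else 0 :: real) = 1} = {\<omega> \<in> space M. P (path \<omega>)}"
    by auto
  finally show ?thesis .
qed

lemma expectation_play:
  fixes F :: "(nat \<Rightarrow> 'a play) \<Rightarrow> real"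
  assumes F: "adapted n F" and q: "q \<in> plays"
  shows "expectation (\<lambda>\<omega>. indicator {\<omega> \<in> space M. play n \<omega> = q} \<omega> * F (path \<omega>))
       = expectation (\<lambda>\<omega>. play_prob (weight (path \<omega>) n) q * F (path \<omega>))"
proof -
  let ?B = "{\<omega> \<in> space M. play n \<omega> = q}"
  let ?H = "{..<n} \<rightarrow>\<^sub>E plays"
  have "expectation (\<lambda>\<omega>. indicator ?B \<omega> * F (path \<omega>))
      = expectation (\<lambda>\<omega>. \<Sum>h\<in>?H. F h * indicator (cyl h n \<inter> ?B) \<omega>)"
    by (intro Bochner_Integration.integral_cong)
      (auto simp: adapted_eq_sum_indicator [OF F] sum_distrib_left indicator_inter_arith mult_ac)
  also have "\<dots> = (\<Sum>h\<in>?H. F h * prob (cyl h n \<inter> ?B))"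
    by (subst Bochner_Integration.integral_sum)
      (auto simp: emeasure_eq_measure Int_absorb2 sets.sets_into_space)
  also have "\<dots> = (\<Sum>h\<in>?H. play_prob (weight h n) q * F h * prob (cyl h n))"
    by (intro sum.cong) (simp_all add: prob_cyl_play [OF q])
  also have "\<dots> = expectation (\<lambda>\<omega>. \<Sum>h\<in>?H. play_prob (weight h n) q * F h * indicator (cyl h n) \<omega>)"
    by (subst Bochner_Integration.integral_sum)
      (auto simp: emeasure_eq_measure Int_absorb2 sets.sets_into_space)
  also have "\<dots> = expectation (\<lambda>\<omega>. play_prob (weight (path \<omega>) n) q * F (path \<omega>))"
    by (intro Bochner_Integration.integral_cong refl
        adapted_eq_sum_indicator [symmetric, where F = "\<lambda>h. play_prob (weight h n) q * F h"]
        adapted_comp2 [OF adapted_weight F, where g = "\<lambda>v x. play_prob v q * x"])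
  finally show ?thesis .
qed

text \<open>Takes the place of conditioning on the past: once \<open>q\<close> is written in as play
  \<open>n\<close>, the value of \<open>F\<close> depends on the first \<open>n\<close> plays only,
  and the indicator that play \<open>n\<close> equals \<open>q\<close> can be exchanged for its
  conditional probability.\<close>

lemma expectation_step_plays:
  fixes F :: "(nat \<Rightarrow> 'a play) \<Rightarrow> real"
  assumes F: "adapted (Suc n) F"
  shows "expectation (\<lambda>\<omega>. F (path \<omega>))
       = expectation (\<lambda>\<omega>. \<Sum>q\<in>plays. play_prob (weight (path \<omega>) n) q * F ((path \<omega>)(n := q)))"
proof -
  have F': "adapted n (\<lambda>h. F (h(n := q)))" for q
  proof (rule adaptedI)
    fix h h' :: "nat \<Rightarrow> 'a play" assume "\<And>m. m < n \<Longrightarrow> h m = h' m"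
    then show "F (h(n := q)) = F (h'(n := q))"
      by (intro adaptedD [OF F]) (auto simp: less_Suc_eq)
  qed
  have step: "adapted n (\<lambda>h. play_prob (weight h n) q * F (h(n := q)))" for q
    using adapted_comp2 [where g = "\<lambda>v x. play_prob v q * x", OF adapted_weight F' [of q]] .
  have eq: "F (path \<omega>) = (\<Sum>q\<in>plays. indicator {\<omega> \<in> space M. play n \<omega> = q} \<omega> * F ((path \<omega>)(n := q)))"
    if "\<omega> \<in> space M" for \<omega>
  proof -
    have "(\<Sum>q\<in>plays. indicator {\<omega> \<in> space M. play n \<omega> = q} \<omega> * F ((path \<omega>)(n := q)))
        = (\<Sum>q\<in>plays. if q = play n \<omega> then F ((path \<omega>)(n := q)) else 0)"
      using that by (intro sum.cong) (auto simp: indicator_def)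
    also have "\<dots> = F ((path \<omega>)(n := play n \<omega>))"
      using finite_plays play_in_plays [OF that] by simp
    also have "(path \<omega>)(n := play n \<omega>) = path \<omega>" by (auto simp: path_def)
    finally show ?thesis by (rule sym)
  qed
  have "expectation (\<lambda>\<omega>. F (path \<omega>))
      = expectation (\<lambda>\<omega>. \<Sum>q\<in>plays. indicator {\<omega> \<in> space M. play n \<omega> = q} \<omega> * F ((path \<omega>)(n := q)))"
    by (intro Bochner_Integration.integral_cong refl eq)
  also have "\<dots> = (\<Sum>q\<in>plays. expectation (\<lambda>\<omega>. indicator {\<omega> \<in> space M. play n \<omega> = q} \<omega> * F ((path \<omega>)(n := q))))"
    by (intro Bochner_Integration.integral_sum)
      (use integrable_mult_indicator [OF measurable_play_eq integrable_adapted [OF F']] in \<open>simp only: real_scaleR_def\<close>)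
  also have "\<dots> = (\<Sum>q\<in>plays. expectation (\<lambda>\<omega>. play_prob (weight (path \<omega>) n) q * F ((path \<omega>)(n := q))))"
    by (intro sum.cong refl) (rule expectation_play [OF F'])
  also have "\<dots> = expectation (\<lambda>\<omega>. \<Sum>q\<in>plays. play_prob (weight (path \<omega>) n) q * F ((path \<omega>)(n := q)))"
    by (intro Bochner_Integration.integral_sum [symmetric] integrable_adapted [OF step])
  finally show ?thesis .
qed

text \<open>The probability that the entry \<open>(i, j)\<close> is reinforced; Sender and Receiver
  both have to pick it, hence the square.\<close>

definition success :: "('a \<Rightarrow> 'a \<Rightarrow> real) \<Rightarrow> 'a \<Rightarrow> 'a \<Rightarrow> real" where
  "success v i j = (v i j)\<^sup>2 / (real (card S\<^sub>1) * (\<Sum>l\<in>S\<^sub>2. v i l) * (\<Sum>l\<in>S\<^sub>1. v l j))"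

lemma sum_play_prob:
  assumes v: "\<And>i j. i \<in> S\<^sub>1 \<Longrightarrow> j \<in> S\<^sub>2 \<Longrightarrow> 0 < v i j"
  shows "(\<Sum>q\<in>plays. play_prob v q) = 1"
proof -
  have r: "(\<Sum>l\<in>S\<^sub>2. v i l) \<noteq> 0" if "i \<in> S\<^sub>1" for i
    using sum_pos [OF finite_signals signals_nonempty, of "v i"] v that by force
  have c: "(\<Sum>l\<in>S\<^sub>1. v l j) \<noteq> 0" if "j \<in> S\<^sub>2" for j
    using sum_pos [OF finite_states states_nonempty, of "\<lambda>l. v l j"] v that by force
  have "(\<Sum>q\<in>plays. play_prob v q)
      = (\<Sum>i\<in>S\<^sub>1. \<Sum>j\<in>S\<^sub>2. 1 / card S\<^sub>1 * (v i j / (\<Sum>l\<in>S\<^sub>2. v i l)))"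
    unfolding sum_plays play_prob_def
    by (intro sum.cong refl)
      (simp only: play.sel sum_distrib_left [symmetric] sum_divide_distrib [symmetric], simp add: c)
  also have "\<dots> = (\<Sum>i\<in>S\<^sub>1. 1 / card S\<^sub>1)"
    by (intro sum.cong refl)
      (simp only: play.sel sum_distrib_left [symmetric] sum_divide_distrib [symmetric], simp add: r)
  also have "\<dots> = 1" using card_states_pos by simp
  finally show ?thesis .
qed

lemma sum_plays_bump:
  assumes v: "\<And>i j. i \<in> S\<^sub>1 \<Longrightarrow> j \<in> S\<^sub>2 \<Longrightarrow> 0 < v i j"
  shows "(\<Sum>q\<in>plays. play_prob v q * (if act q = state q then \<psi> (bump (state q) (signal q) v) else \<psi> v))
     = (1 - (\<Sum>i\<in>S\<^sub>1. \<Sum>j\<in>S\<^sub>2. success v i j)) * \<psi> v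
       + (\<Sum>i\<in>S\<^sub>1. \<Sum>j\<in>S\<^sub>2. success v i j * \<psi> (bump i j v))"
proof -
  have "(\<Sum>q\<in>plays. play_prob v q * (if act q = state q then \<psi> (bump (state q) (signal q) v) else \<psi> v))
      = (\<Sum>q\<in>plays. play_prob v q * \<psi> v
          + (if act q = state q then play_prob v q * (\<psi> (bump (state q) (signal q) v) - \<psi> v) else 0))"
    by (intro sum.cong) (auto simp: algebra_simps)
  also have "\<dots> = \<psi> v + (\<Sum>q\<in>plays. if act q = state q then play_prob v q * (\<psi> (bump (state q) (signal q) v) - \<psi> v) else 0)"
    by (simp only: sum.distrib sum_distrib_right [symmetric] sum_play_prob [OF v] mult_1_left)
  also have "(\<Sum>q\<in>plays. if act q = state q then play_prob v q * (\<psi> (bump (state q) (signal q) v) - \<psi> v) else 0)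
      = (\<Sum>i\<in>S\<^sub>1. \<Sum>j\<in>S\<^sub>2. success v i j * (\<psi> (bump i j v) - \<psi> v))"
    unfolding sum_plays
    by (intro sum.cong refl) (simp add: finite_states play_prob_def success_def power2_eq_square)
  also have "\<dots> = (\<Sum>i\<in>S\<^sub>1. \<Sum>j\<in>S\<^sub>2. success v i j * \<psi> (bump i j v)) - (\<Sum>i\<in>S\<^sub>1. \<Sum>j\<in>S\<^sub>2. success v i j) * \<psi> v"
    by (simp only: right_diff_distrib sum_subtractf sum_distrib_right)
  finally show ?thesis by (simp add: algebra_simps)
qed

text \<open>The past and the current weights are separate arguments of \<open>\<Psi>\<close>, so
  that weights of earlier times can be kept as frozen parameters in the first one while only the
  second one moves.\<close>

lemma expectation_step:
  fixes \<Psi> :: "(nat \<Rightarrow> 'a play) \<Rightarrow> ('a \<Rightarrow> 'a \<Rightarrow> real) \<Rightarrow> real"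
  assumes \<Psi>: "\<And>v. adapted n (\<lambda>h. \<Psi> h v)"
  shows "expectation (\<lambda>\<omega>. \<Psi> (path \<omega>) (weight (path \<omega>) (Suc n)))
    = expectation (\<lambda>\<omega>. (1 - (\<Sum>i\<in>S\<^sub>1. \<Sum>j\<in>S\<^sub>2. success (weight (path \<omega>) n) i j))
          * \<Psi> (path \<omega>) (weight (path \<omega>) n)
        + (\<Sum>i\<in>S\<^sub>1. \<Sum>j\<in>S\<^sub>2. success (weight (path \<omega>) n) i j
          * \<Psi> (path \<omega>) (bump i j (weight (path \<omega>) n))))"
proof -
  have upd: "\<Psi> (h(n := q)) = \<Psi> h" for h q
    by (rule ext, rule adaptedD [OF \<Psi>]) auto
  have "adapted (Suc n) (\<lambda>h. \<Psi> h (weight h (Suc n)))"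
  proof (rule adaptedI)
    fix h h' :: "nat \<Rightarrow> 'a play" assume *: "\<And>m. m < Suc n \<Longrightarrow> h m = h' m"
    have "\<Psi> h v = \<Psi> h' v" for v by (rule adaptedD [OF \<Psi>]) (use * in auto)
    moreover have "weight h (Suc n) = weight h' (Suc n)"
      by (rule adaptedD [OF adapted_weight *])
    ultimately show "\<Psi> h (weight h (Suc n)) = \<Psi> h' (weight h' (Suc n))" by simp
  qed
  note step = expectation_step_plays [OF this]
  have eq: "\<Psi> (h(n := q)) (weight (h(n := q)) (Suc n)) =
      (if act q = state q then \<Psi> h (bump (state q) (signal q) (weight h n)) else \<Psi> h (weight h n))" for h q
    unfolding weight_Suc_upd upd by simp
  show ?thesis
    unfolding step eq by (subst sum_plays_bump) (rule weight_pos, rule refl)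
qed

lemma success_nonneg: "0 \<le> success (weight h n) i j"
  unfolding success_def
  by (intro divide_nonneg_nonneg mult_nonneg_nonneg zero_le_power2 of_nat_0_le_iff
      less_imp_le [OF row_sum_pos] less_imp_le [OF col_sum_pos])

text \<open>The test function is the indicator of the current weights. A bump always changes them,
  so the one-step identity equates one minus the sum with the probability of a play whose act
  differs from the state.\<close>

lemma sum_success_le_1: "(\<Sum>i\<in>S\<^sub>1. \<Sum>j\<in>S\<^sub>2. success (weight h n) i j) \<le> 1"
proof -
  let ?v = "weight h n"
  have "0 \<le> play_prob ?v q" for q
    unfolding play_prob_def
    by (intro divide_nonneg_nonneg mult_nonneg_nonneg zero_le_one of_nat_0_le_iff
        less_imp_le [OF weight_pos] less_imp_le [OF row_sum_pos] less_imp_le [OF col_sum_pos])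
  then have "0 \<le> (\<Sum>q\<in>plays. play_prob ?v q * (if act q = state q then 0 else 1))"
    by (intro sum_nonneg) auto
  moreover have "bump i j ?v \<noteq> ?v" for i j
  proof
    assume "bump i j ?v = ?v"
    then have "bump i j ?v i j = ?v i j" by (rule fun_cong [THEN fun_cong])
    then show False by (simp add: bump_def)
  qed
  ultimately show ?thesis
    using sum_plays_bump [where v = ?v and \<psi> = "\<lambda>v. if v = ?v then 1 else 0", OF weight_pos]
    by (simp cong: if_cong)
qed

end

section \<open>The process near a union of stars\<close>

locale star_signaling = signaling_process M S\<^sub>1 S\<^sub>2 play
  for M :: "'w measure" and S\<^sub>1 S\<^sub>2 :: "'a set" and play +
  fixes L :: "'a set" and f :: "'a \<Rightarrow> 'a"
  assumes leaves_subset: "L \<subseteq> S\<^sub>1 \<union> S\<^sub>2"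
    and center_of_state: "\<And>l. l \<in> L \<Longrightarrow> l \<in> S\<^sub>1 \<Longrightarrow> f l \<in> S\<^sub>2 - L"
    and center_of_signal: "\<And>l. l \<in> L \<Longrightarrow> l \<in> S\<^sub>2 \<Longrightarrow> f l \<in> S\<^sub>1 - L"
    and center_has_leaf: "\<And>a. a \<in> S\<^sub>1 \<union> S\<^sub>2 \<Longrightarrow> a \<notin> L \<Longrightarrow> \<exists>l\<in>L. f l = a"
begin

section \<open>Leaves, edges and arrays with untouched non-edges\<close>

definition st :: "'a \<Rightarrow> 'a" where "st l = (if l \<in> S\<^sub>1 then l else f l)"

definition sg :: "'a \<Rightarrow> 'a" where "sg l = (if l \<in> S\<^sub>1 then f l else l)"

definition edge :: "'a \<Rightarrow> 'a \<Rightarrow> bool" where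
  "edge i j \<longleftrightarrow> i \<in> L \<and> f i = j \<or> j \<in> L \<and> f j = i"

definition missing :: "'a \<Rightarrow> real" where
  "missing a = (if a \<in> S\<^sub>1 then card {j \<in> S\<^sub>2. \<not> edge a j} else card {i \<in> S\<^sub>1. \<not> edge i a})"

text \<open>Plays the part of \<open>D\<close>: it bounds the number of leaves and every
  \<open>missing a\<close>.\<close>

definition nverts :: real where "nverts = card S\<^sub>1 + card S\<^sub>2"

text \<open>The value 0 off \<open>L\<close> makes agreement of leaf weights an equality of
  functions, as in \<open>leafval_bump\<close> and \<open>start_val\<close>.\<close>

definition leafval :: "('a \<Rightarrow> 'a \<Rightarrow> real) \<Rightarrow> 'a \<Rightarrow> real" where
  "leafval v l = (if l \<in> L then v (st l) (sg l) else 0)"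

definition flat :: "('a \<Rightarrow> 'a \<Rightarrow> real) \<Rightarrow> bool" where
  "flat v \<longleftrightarrow> (\<forall>i\<in>S\<^sub>1. \<forall>j\<in>S\<^sub>2. \<not> edge i j \<longrightarrow> v i j = 1)"

lemma finite_leaves: "finite L"
  using leaves_subset finite_states finite_signals by (meson finite_UnI finite_subset)

lemma nverts_ge_1: "1 \<le> nverts"
  using card_states_pos by (simp add: nverts_def)

sublocale star_urns L f missing "card S\<^sub>1" nverts
proof
  show "finite L" by (rule finite_leaves)
  show "0 \<le> missing a" for a by (simp add: missing_def)
  show "missing a \<le> nverts" for a
  proof -
    have "card {j \<in> S\<^sub>2. \<not> edge a j} \<le> card S\<^sub>2" "card {i \<in> S\<^sub>1. \<not> edge i a} \<le> card S\<^sub>1"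
      using finite_states finite_signals by (auto intro: card_mono)
    then show ?thesis by (simp add: missing_def nverts_def)
  qed
  have "card L \<le> card (S\<^sub>1 \<union> S\<^sub>2)"
    using finite_states finite_signals leaves_subset by (intro card_mono) auto
  also have "\<dots> \<le> card S\<^sub>1 + card S\<^sub>2" by (rule card_Un_le)
  finally show "card L \<le> nverts" by (simp add: nverts_def)
  show "1 \<le> nverts" by (rule nverts_ge_1)
  show "1 \<le> real (card S\<^sub>1)" using card_states_pos by simp
qed

lemma st_sg_cases:
  assumes "l \<in> L"
  obtains (state) "l \<in> S\<^sub>1" "l \<notin> S\<^sub>2" "f l \<in> S\<^sub>2" "f l \<notin> S\<^sub>1" "f l \<notin> L" "st l = l" "sg l = f l"
    | (signal) "l \<in> S\<^sub>2" "l \<notin> S\<^sub>1" "f l \<in> S\<^sub>1" "f l \<notin> S\<^sub>2" "f l \<notin> L" "st l = f l" "sg l = l"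
proof (cases "l \<in> S\<^sub>1")
  case True
  then show ?thesis
    using center_of_state [OF assms True] disjoint by (intro state) (auto simp: st_def sg_def)
next
  case False
  then have "l \<in> S\<^sub>2" using leaves_subset assms by auto
  then show ?thesis
    using center_of_signal [OF assms] False disjoint by (intro signal) (auto simp: st_def sg_def)
qed

lemma
  assumes "l \<in> L"
  shows st_in: "st l \<in> S\<^sub>1" and sg_in: "sg l \<in> S\<^sub>2" and edge_st_sg: "edge (st l) (sg l)"
proof -
  have "st l \<in> S\<^sub>1 \<and> sg l \<in> S\<^sub>2 \<and> edge (st l) (sg l)"
    by (rule st_sg_cases [OF assms]) (use assms in \<open>auto simp: edge_def\<close>)
  then show "st l \<in> S\<^sub>1" "sg l \<in> S\<^sub>2" "edge (st l) (sg l)" by auto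
qed

lemma center_notin: assumes "l \<in> L" shows "f l \<notin> L"
  using assms by (rule st_sg_cases)

lemma inj_st_sg:
  assumes "k \<in> L" "l \<in> L" "st k = st l" "sg k = sg l"
  shows "k = l"
  using assms(1)
proof (cases rule: st_sg_cases)
  case k: state
  show ?thesis using assms(2) by (cases rule: st_sg_cases) (use assms k in auto)
next
  case k: signal
  show ?thesis using assms(2) by (cases rule: st_sg_cases) (use assms k in auto)
qed

lemma edge_iff_leaf:
  assumes "i \<in> S\<^sub>1" "j \<in> S\<^sub>2"
  shows "edge i j \<longleftrightarrow> (\<exists>l\<in>L. i = st l \<and> j = sg l)"
proof
  assume "edge i j"
  then consider "i \<in> L" "f i = j" | "j \<in> L" "f j = i" by (auto simp: edge_def)
  then show "\<exists>l\<in>L. i = st l \<and> j = sg l"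
  proof cases
    case 1 then show ?thesis using assms disjoint by (intro bexI [of _ i]) (auto simp: st_def sg_def)
  next
    case 2 then show ?thesis using assms disjoint by (intro bexI [of _ j]) (auto simp: st_def sg_def)
  qed
qed (auto simp: edge_st_sg)

lemma sum_edges:
  "(\<Sum>i\<in>S\<^sub>1. \<Sum>j\<in>S\<^sub>2. if edge i j then g i j else 0) = (\<Sum>l\<in>L. g (st l) (sg l))"
proof -
  let ?h = "\<lambda>l. (st l, sg l)"
  have E: "{p \<in> S\<^sub>1 \<times> S\<^sub>2. edge (fst p) (snd p)} = ?h ` L"
    using edge_iff_leaf st_in sg_in edge_st_sg by (auto simp: image_iff)
  have inj: "inj_on ?h L"
    using inj_st_sg by (auto simp: inj_on_def)
  have "(\<Sum>i\<in>S\<^sub>1. \<Sum>j\<in>S\<^sub>2. if edge i j then g i j else 0)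
      = (\<Sum>p\<in>S\<^sub>1 \<times> S\<^sub>2. if edge (fst p) (snd p) then g (fst p) (snd p) else 0)"
    by (simp only: sum.cartesian_product case_prod_unfold)
  also have "\<dots> = (\<Sum>p\<in>?h ` L. g (fst p) (snd p))"
    unfolding E [symmetric] using finite_states finite_signals by (intro sum.inter_filter [symmetric]) auto
  also have "\<dots> = (\<Sum>l\<in>L. g (st l) (sg l))"
    by (subst sum.reindex [OF inj]) simp
  finally show ?thesis .
qed

text \<open>A leaf has one edge and a center has those of its star; the remaining entries are all 1
  and add up to \<open>missing i\<close>. Together with the column version this identifies
  \<open>success\<close> on an edge with \<open>rate\<close>.\<close>

lemma row_sum_flat:
  assumes v: "flat v" and i: "i \<in> S\<^sub>1"
  shows "(\<Sum>j\<in>S\<^sub>2. v i j) = (if i \<in> L then missing i + leafval v i else tot (leafval v) i)"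
proof -
  have "(\<Sum>j\<in>S\<^sub>2. v i j) = (\<Sum>j | j \<in> S\<^sub>2 \<and> edge i j. v i j) + (\<Sum>j | j \<in> S\<^sub>2 \<and> \<not> edge i j. v i j)"
    using finite_signals by (subst sum.union_disjoint [symmetric]) (auto intro!: sum.cong)
  also have "(\<Sum>j | j \<in> S\<^sub>2 \<and> \<not> edge i j. v i j) = missing i"
    using v i by (simp add: flat_def missing_def)
  also have "(\<Sum>j | j \<in> S\<^sub>2 \<and> edge i j. v i j)
      = (if i \<in> L then leafval v i else (\<Sum>l | l \<in> L \<and> f l = i. leafval v l))"
  proof (cases "i \<in> L")
    case True
    have "{j. j \<in> S\<^sub>2 \<and> edge i j} = {f i}"
      using center_of_state [OF True i] center_notin True by (auto simp: edge_def)
    then show ?thesis using True i by (simp add: leafval_def st_def sg_def)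
  next
    case False
    have "{j. j \<in> S\<^sub>2 \<and> edge i j} = {l. l \<in> L \<and> f l = i}"
      using False i disjoint by (auto simp: edge_def elim: st_sg_cases)
    moreover have "leafval v l = v i l" if "l \<in> L" "f l = i" for l
      using that(1) by (cases rule: st_sg_cases) (use that i disjoint in \<open>auto simp: leafval_def\<close>)
    ultimately show ?thesis using False by simp
  qed
  finally show ?thesis by (simp add: tot_def)
qed

lemma col_sum_flat:
  assumes v: "flat v" and j: "j \<in> S\<^sub>2"
  shows "(\<Sum>i\<in>S\<^sub>1. v i j) = (if j \<in> L then missing j + leafval v j else tot (leafval v) j)"
proof -
  have j1: "j \<notin> S\<^sub>1" using j disjoint by auto
  have "(\<Sum>i\<in>S\<^sub>1. v i j) = (\<Sum>i | i \<in> S\<^sub>1 \<and> edge i j. v i j) + (\<Sum>i | i \<in> S\<^sub>1 \<and> \<not> edge i j. v i j)"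
    using finite_states by (subst sum.union_disjoint [symmetric]) (auto intro!: sum.cong)
  also have "(\<Sum>i | i \<in> S\<^sub>1 \<and> \<not> edge i j. v i j) = missing j"
    using v j j1 by (simp add: flat_def missing_def)
  also have "(\<Sum>i | i \<in> S\<^sub>1 \<and> edge i j. v i j)
      = (if j \<in> L then leafval v j else (\<Sum>l | l \<in> L \<and> f l = j. leafval v l))"
  proof (cases "j \<in> L")
    case True
    have "{i. i \<in> S\<^sub>1 \<and> edge i j} = {f j}"
      using center_of_signal [OF True j] center_notin True by (auto simp: edge_def)
    then show ?thesis using True j1 by (simp add: leafval_def st_def sg_def)
  next
    case False
    have "{i. i \<in> S\<^sub>1 \<and> edge i j} = {l. l \<in> L \<and> f l = j}"
      using False j disjoint by (auto simp: edge_def elim: st_sg_cases)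
    moreover have "leafval v l = v l j" if "l \<in> L" "f l = j" for l
      using that(1) by (cases rule: st_sg_cases) (use that j disjoint in \<open>auto simp: leafval_def\<close>)
    ultimately show ?thesis using False by simp
  qed
  finally show ?thesis by (simp add: tot_def)
qed

lemma success_leaf:
  assumes v: "flat v" and l: "l \<in> L"
  shows "success v (st l) (sg l) = rate (leafval v) l"
  using l
proof (cases rule: st_sg_cases)
  case state
  then show ?thesis
    using l by (simp add: success_def rate_def row_sum_flat [OF v] col_sum_flat [OF v]) (simp add: leafval_def)
next
  case signal
  then show ?thesis
    using l by (simp add: success_def rate_def row_sum_flat [OF v] col_sum_flat [OF v] mult_ac) (simp add: leafval_def)
qed

lemma flat_bump:
  assumes "flat v" "i \<in> S\<^sub>1" "j \<in> S\<^sub>2"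
  shows "flat (bump i j v) \<longleftrightarrow> edge i j"
proof
  assume "flat (bump i j v)"
  show "edge i j"
  proof (rule ccontr)
    assume "\<not> edge i j"
    then have "bump i j v i j = 1" "v i j = 1"
      using assms \<open>flat (bump i j v)\<close> by (auto simp: flat_def)
    then show False by (simp add: bump_def)
  qed
next
  assume "edge i j"
  then show "flat (bump i j v)" using assms by (auto simp: flat_def bump_def)
qed

lemma leafval_bump:
  assumes "l \<in> L"
  shows "leafval (bump (st l) (sg l) v) = (leafval v)(l := leafval v l + 1)"
proof
  fix k
  show "leafval (bump (st l) (sg l) v) k = ((leafval v)(l := leafval v l + 1)) k"
    using inj_st_sg [OF assms, of k] assms by (auto simp: leafval_def bump_def)
qed

section \<open>Stray reinforcements and the killed process\<close>

definition stray :: "('a \<Rightarrow> 'a \<Rightarrow> real) \<Rightarrow> real" where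
  "stray v = (\<Sum>i\<in>S\<^sub>1. \<Sum>j\<in>S\<^sub>2. if edge i j then 0 else success v i j)"

lemma sum_success_flat:
  assumes v: "flat v"
  shows "(\<Sum>i\<in>S\<^sub>1. \<Sum>j\<in>S\<^sub>2. success v i j * g i j)
    = (\<Sum>l\<in>L. rate (leafval v) l * g (st l) (sg l))
      + (\<Sum>i\<in>S\<^sub>1. \<Sum>j\<in>S\<^sub>2. if edge i j then 0 else success v i j * g i j)"
proof -
  have "(\<Sum>i\<in>S\<^sub>1. \<Sum>j\<in>S\<^sub>2. success v i j * g i j)
    = (\<Sum>i\<in>S\<^sub>1. \<Sum>j\<in>S\<^sub>2. (if edge i j then success v i j * g i j else 0) + (if edge i j then 0 else success v i j * g i j))"
    by (intro sum.cong) auto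
  also have "\<dots> = (\<Sum>l\<in>L. success v (st l) (sg l) * g (st l) (sg l))
      + (\<Sum>i\<in>S\<^sub>1. \<Sum>j\<in>S\<^sub>2. if edge i j then 0 else success v i j * g i j)"
    by (simp only: sum.distrib sum_edges)
  also have "(\<Sum>l\<in>L. success v (st l) (sg l) * g (st l) (sg l)) = (\<Sum>l\<in>L. rate (leafval v) l * g (st l) (sg l))"
    by (intro sum.cong refl) (simp add: success_leaf [OF v])
  finally show ?thesis .
qed

text \<open>One step of the process killed at a stray reinforcement, with reward \<open>q\<close> at
  that moment: \<open>q = 1\<close> charges for the death, \<open>q = 0\<close> ignores it. The
  exact identity contains the further term \<open>- stray * \<phi>\<close>, which may be dropped
  because \<open>\<phi>\<close> is nonnegative there.\<close>

lemma expectation_killed_step: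
  fixes \<phi> :: "(nat \<Rightarrow> 'a play) \<Rightarrow> ('a \<Rightarrow> real) \<Rightarrow> real"
  assumes P: "adapted n P" and P_flat: "\<And>h. P h \<Longrightarrow> flat (weight h n)"
    and \<phi>: "\<And>u. adapted n (\<lambda>h. \<phi> h u)" and \<phi>_nonneg: "\<And>h. P h \<Longrightarrow> 0 \<le> \<phi> h (leafval (weight h n))"
  shows "expectation (\<lambda>\<omega>. if P (path \<omega>) then
        (if flat (weight (path \<omega>) (Suc n)) then \<phi> (path \<omega>) (leafval (weight (path \<omega>) (Suc n))) else q) else 0)
    \<le> expectation (\<lambda>\<omega>. if P (path \<omega>) then
        \<phi> (path \<omega>) (leafval (weight (path \<omega>) n)) + gen (\<phi> (path \<omega>)) (leafval (weight (path \<omega>) n))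
          + q * stray (weight (path \<omega>) n) else 0)"
proof -
  define \<Psi> where "\<Psi> h v = (if P h then (if flat v then \<phi> h (leafval v) else q) else 0)" for h v
  have \<Psi>: "adapted n (\<lambda>h. \<Psi> h v)" for v
    unfolding \<Psi>_def by (rule adapted_comp2 [where g = "\<lambda>p x. if p then (if flat v then x else q) else 0", OF P \<phi>])
  have \<phi>_eq: "\<phi> h = \<phi> h'" if "\<And>m. m < n \<Longrightarrow> h m = h' m" for h h'
    by (rule ext, rule adaptedD [OF \<phi>]) (rule that)
  have \<Psi>_eq: "\<Psi> h = \<Psi> h'" if "\<And>m. m < n \<Longrightarrow> h m = h' m" for h h'
    by (rule ext, rule adaptedD [OF \<Psi>]) (rule that)
  let ?step = "\<lambda>h. (1 - (\<Sum>i\<in>S\<^sub>1. \<Sum>j\<in>S\<^sub>2. success (weight h n) i j)) * \<Psi> h (weight h n)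
        + (\<Sum>i\<in>S\<^sub>1. \<Sum>j\<in>S\<^sub>2. success (weight h n) i j * \<Psi> h (bump i j (weight h n)))"
  let ?rhs = "\<lambda>h. if P h then \<phi> h (leafval (weight h n)) + gen (\<phi> h) (leafval (weight h n)) + q * stray (weight h n) else 0"
  have le: "?step h \<le> ?rhs h" for h
  proof (cases "P h")
    case False
    then show ?thesis by (simp add: \<Psi>_def)
  next
    case True
    let ?v = "weight h n"
    let ?u = "leafval ?v"
    have v: "flat ?v" by (rule P_flat [OF True])
    have "(\<Sum>i\<in>S\<^sub>1. \<Sum>j\<in>S\<^sub>2. success ?v i j * 1) = (\<Sum>l\<in>L. rate ?u l) + stray ?v"
      unfolding sum_success_flat [OF v] stray_def by (simp cong: if_cong)
    then have total: "(\<Sum>i\<in>S\<^sub>1. \<Sum>j\<in>S\<^sub>2. success ?v i j) = (\<Sum>l\<in>L. rate ?u l) + stray ?v"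
      by simp
    have "(\<Sum>i\<in>S\<^sub>1. \<Sum>j\<in>S\<^sub>2. success ?v i j * \<Psi> h (bump i j ?v))
        = (\<Sum>l\<in>L. rate ?u l * \<Psi> h (bump (st l) (sg l) ?v))
          + (\<Sum>i\<in>S\<^sub>1. \<Sum>j\<in>S\<^sub>2. if edge i j then 0 else success ?v i j * \<Psi> h (bump i j ?v))"
      by (rule sum_success_flat [OF v])
    also have "(\<Sum>l\<in>L. rate ?u l * \<Psi> h (bump (st l) (sg l) ?v)) = (\<Sum>l\<in>L. rate ?u l * \<phi> h (?u(l := ?u l + 1)))"
      using True by (intro sum.cong refl) (simp add: \<Psi>_def flat_bump [OF v] st_in sg_in edge_st_sg leafval_bump)
    also have "(\<Sum>i\<in>S\<^sub>1. \<Sum>j\<in>S\<^sub>2. if edge i j then 0 else success ?v i j * \<Psi> h (bump i j ?v))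
        = (\<Sum>i\<in>S\<^sub>1. \<Sum>j\<in>S\<^sub>2. q * (if edge i j then 0 else success ?v i j))"
      using True by (intro sum.cong refl) (simp add: \<Psi>_def flat_bump [OF v])
    also have "\<dots> = q * stray ?v"
      by (simp only: stray_def sum_distrib_left)
    finally have moved: "(\<Sum>i\<in>S\<^sub>1. \<Sum>j\<in>S\<^sub>2. success ?v i j * \<Psi> h (bump i j ?v))
        = (\<Sum>l\<in>L. rate ?u l * \<phi> h (?u(l := ?u l + 1))) + q * stray ?v" .
    have stay: "\<Psi> h ?v = \<phi> h ?u" using True v by (simp add: \<Psi>_def)
    have gen: "gen (\<phi> h) ?u = (\<Sum>l\<in>L. rate ?u l * \<phi> h (?u(l := ?u l + 1))) - (\<Sum>l\<in>L. rate ?u l) * \<phi> h ?u"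
      by (simp only: gen_def right_diff_distrib sum_subtractf sum_distrib_right)
    have "?step h = ?rhs h - stray ?v * \<phi> h ?u"
      unfolding moved stay total gen if_P [OF True] by (simp add: algebra_simps)
    also have "\<dots> \<le> ?rhs h"
      using \<phi>_nonneg [OF True] by (simp add: stray_def sum_nonneg success_nonneg)
    finally show ?thesis .
  qed
  have weight_eq: "weight h n = weight h' n" if "\<And>m. m < n \<Longrightarrow> h m = h' m" for h h' :: "nat \<Rightarrow> 'a play"
    by (rule adaptedD [OF adapted_weight]) (rule that)
  have P_eq: "P h = P h'" if "\<And>m. m < n \<Longrightarrow> h m = h' m" for h h'
    by (rule adaptedD [OF P]) (rule that)
  have "adapted n ?step"
  proof (rule adaptedI)
    fix h h' :: "nat \<Rightarrow> 'a play" assume "\<And>m. m < n \<Longrightarrow> h m = h' m"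
    then have "weight h n = weight h' n" "\<Psi> h = \<Psi> h'" using weight_eq \<Psi>_eq by blast+
    then show "?step h = ?step h'" by simp
  qed
  moreover have "adapted n ?rhs"
  proof (rule adaptedI)
    fix h h' :: "nat \<Rightarrow> 'a play" assume "\<And>m. m < n \<Longrightarrow> h m = h' m"
    then have "weight h n = weight h' n" "\<phi> h = \<phi> h'" "P h = P h'" using weight_eq \<phi>_eq P_eq by blast+
    then show "?rhs h = ?rhs h'" by simp
  qed
  ultimately have "expectation (\<lambda>\<omega>. ?step (path \<omega>)) \<le> expectation (\<lambda>\<omega>. ?rhs (path \<omega>))"
    using le by (intro integral_mono integrable_adapted)
  then show ?thesis
    using expectation_step [where \<Psi> = \<Psi>, OF \<Psi>] by (simp add: \<Psi>_def)
qed

lemma weight_leaf_ge_1: "l \<in> L \<Longrightarrow> 1 \<le> leafval (weight h n) l"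
  by (simp add: leafval_def weight_ge_1)

text \<open>A non-edge has weight 1, so its probability is the inverse of
  \<open>card S\<^sub>1\<close> times its row sum times its column sum. Either sum is at least
  \<open>\<kappa>\<close> times the total of some star: by the bound on its share for a leaf, by
  \<open>\<kappa> \<le> 1\<close> for a center. The product of two inverse totals is bounded by the
  sum of all squares, and \<open>nverts\<^sup>2\<close> bounds the number of non-edges.\<close>

lemma stray_le:
  assumes v: "flat v" and \<kappa>: "0 < \<kappa>" "\<kappa> \<le> 1"
    and u: "\<And>l. l \<in> L \<Longrightarrow> 1 \<le> leafval v l"
    and share: "\<And>l. l \<in> L \<Longrightarrow> \<kappa> \<le> share (leafval v) l"
  shows "stray v \<le> nverts\<^sup>2 / (\<kappa>\<^sup>2 * card S\<^sub>1) * (\<Sum>l\<in>L. 1 / (tot (leafval v) (f l))\<^sup>2)"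
proof -
  let ?t = "\<lambda>l. tot (leafval v) (f l)"
  let ?s = "\<Sum>l\<in>L. 1 / (?t l)\<^sup>2"
  have t: "1 \<le> ?t l" if "l \<in> L" for l by (rule tot_ge_1 [OF u that])
  have tot: "\<exists>l\<in>L. \<kappa> * ?t l \<le> (if a \<in> L then missing a + leafval v a else tot (leafval v) a)"
    if a: "a \<in> S\<^sub>1 \<union> S\<^sub>2" for a
  proof (cases "a \<in> L")
    case True
    have "\<kappa> * ?t a \<le> share (leafval v) a * ?t a"
      using t [OF True] by (intro mult_right_mono share True) auto
    also have "\<dots> = leafval v a" using t [OF True] by (simp add: share_def)
    also have "\<dots> \<le> missing a + leafval v a" by (simp add: d_nonneg)
    finally show ?thesis using True by auto
  next
    case False
    then obtain l where l: "l \<in> L" "f l = a" using center_has_leaf [OF a False] by auto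
    have "\<kappa> * ?t l \<le> 1 * ?t l" using t [OF l(1)] \<kappa> by (intro mult_right_mono) auto
    then show ?thesis using l False by auto
  qed
  have le: "success v i j \<le> 1 / (\<kappa>\<^sup>2 * card S\<^sub>1) * ?s" if i: "i \<in> S\<^sub>1" and j: "j \<in> S\<^sub>2" and ne: "\<not> edge i j" for i j
  proof -
    obtain k where k: "k \<in> L" "\<kappa> * ?t k \<le> (\<Sum>j\<in>S\<^sub>2. v i j)"
      using tot [of i] i by (auto simp: row_sum_flat [OF v i])
    obtain l where l: "l \<in> L" "\<kappa> * ?t l \<le> (\<Sum>i\<in>S\<^sub>1. v i j)"
      using tot [of j] j by (auto simp: col_sum_flat [OF v j])
    have vij: "v i j = 1" using v i j ne by (auto simp: flat_def)
    have pos: "0 < \<kappa> * ?t k" "0 < \<kappa> * ?t l" using \<kappa> t [OF k(1)] t [OF l(1)] by auto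
    have bound: "1 / n * (1 / x') * (1 / y') \<le> 1 / n * (1 / x) * (1 / y)"
      if "0 < x" "x \<le> x'" "0 < y" "y \<le> y'" "0 < n" for n x x' y y' :: real
      using that by (intro mult_mono frac_le) auto
    have "success v i j = 1 / card S\<^sub>1 * (1 / (\<Sum>j\<in>S\<^sub>2. v i j)) * (1 / (\<Sum>i\<in>S\<^sub>1. v i j))"
      by (simp add: success_def vij)
    also have "\<dots> \<le> 1 / card S\<^sub>1 * (1 / (\<kappa> * ?t k)) * (1 / (\<kappa> * ?t l))"
      by (rule bound) (use pos k l card_states_pos in simp_all)
    also have "\<dots> = 1 / (\<kappa>\<^sup>2 * card S\<^sub>1) * ((1 / ?t k) * (1 / ?t l))"
      by (simp add: power2_eq_square)
    also have "\<dots> \<le> 1 / (\<kappa>\<^sup>2 * card S\<^sub>1) * ?s"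
    proof (rule mult_left_mono)
      have "2 * ((1 / ?t k) * (1 / ?t l)) \<le> (1 / ?t k)\<^sup>2 + (1 / ?t l)\<^sup>2"
        using sum_squares_bound [of "1 / ?t k" "1 / ?t l"] by simp
      moreover have sq: "(1 / ?t m)\<^sup>2 \<le> ?s" if "m \<in> L" for m
        unfolding power_divide power_one
        by (rule member_le_sum [OF that]) (auto simp: finite_leaves)
      ultimately show "(1 / ?t k) * (1 / ?t l) \<le> ?s"
        using sq [OF k(1)] sq [OF l(1)] by linarith
    qed (use \<kappa> in auto)
    finally show ?thesis .
  qed
  have s: "0 \<le> 1 / (\<kappa>\<^sup>2 * card S\<^sub>1) * ?s" by (intro mult_nonneg_nonneg sum_nonneg) auto
  have "stray v \<le> (\<Sum>i\<in>S\<^sub>1. \<Sum>j\<in>S\<^sub>2. 1 / (\<kappa>\<^sup>2 * card S\<^sub>1) * ?s)"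
    unfolding stray_def using le s by (intro sum_mono) auto
  also have "\<dots> = (card S\<^sub>1 * card S\<^sub>2) * (1 / (\<kappa>\<^sup>2 * card S\<^sub>1) * ?s)" by simp
  also have "\<dots> \<le> nverts\<^sup>2 * (1 / (\<kappa>\<^sup>2 * card S\<^sub>1) * ?s)"
  proof (rule mult_right_mono [OF _ s])
    show "real (card S\<^sub>1 * card S\<^sub>2) \<le> nverts\<^sup>2"
      unfolding nverts_def power2_eq_square of_nat_mult by (intro mult_mono) auto
  qed
  finally show ?thesis by simp
qed

end

section \<open>Series and limits\<close>

text \<open>Monotone convergence: the mean of the whole series is at most the sum of the
  \<open>b k\<close>, so the series is finite almost surely.\<close>

lemma (in prob_space) AE_summable_of_expectation_le:
  fixes X :: "nat \<Rightarrow> 'a \<Rightarrow> real"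
  assumes int: "\<And>k. integrable M (X k)" and nonneg: "\<And>k \<omega>. 0 \<le> X k \<omega>"
    and le: "\<And>k. expectation (X k) \<le> b k" and b: "summable b"
  shows "AE \<omega> in M. summable (\<lambda>k. X k \<omega>)"
proof -
  have b_nonneg: "0 \<le> b k" for k
    using Bochner_Integration.integral_nonneg [of M "X k"] nonneg le [of k] by (meson order_trans)
  have meas: "(\<lambda>\<omega>. ennreal (X k \<omega>)) \<in> borel_measurable M" for k
    using borel_measurable_integrable [OF int] by measurable
  have "(\<integral>\<^sup>+\<omega>. (\<Sum>k. ennreal (X k \<omega>)) \<partial>M) = (\<Sum>k. \<integral>\<^sup>+\<omega>. ennreal (X k \<omega>) \<partial>M)"
    by (rule nn_integral_suminf) (rule meas)
  also have "\<dots> = (\<Sum>k. ennreal (expectation (X k)))"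
    using int nonneg by (intro suminf_cong nn_integral_eq_integral) auto
  also have "\<dots> \<le> (\<Sum>k. ennreal (b k))"
    by (intro suminf_le summableI ennreal_leI le)
  also have "\<dots> < \<infinity>"
    using suminf_ennreal2 [OF b_nonneg b] by (simp add: ennreal_less_top)
  finally have "AE \<omega> in M. (\<Sum>k. ennreal (X k \<omega>)) \<noteq> \<infinity>"
    by (intro nn_integral_PInf_AE borel_measurable_suminf_order meas) auto
  then show ?thesis
    by eventually_elim (auto intro!: summable_suminf_not_top nonneg)
qed

text \<open>For \<open>y = b * r i\<close>, the map \<open>y - y\<^sup>2\<close> is increasing up to
  \<open>1 / 2\<close>, and \<open>1 / (i + 2)\<close> is a supersolution because
  \<open>(i + 1) * (i + 3) \<le> (i + 2)\<^sup>2\<close>. The shift by 2 starts the comparison at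
  \<open>1 / 2\<close>.\<close>

lemma quadratic_recursion_decay:
  fixes r :: "nat \<Rightarrow> real"
  assumes nonneg: "\<And>i. 0 \<le> r i" and b: "0 < b" and r0: "b * r 0 \<le> 1 / 2"
    and step: "\<And>i. r (Suc i) \<le> r i - b * (r i)\<^sup>2"
  shows "b * r i \<le> 1 / (real i + 2)"
proof (induction i)
  case 0
  then show ?case using r0 by simp
next
  case (Suc i)
  define y where "y = b * r i"
  define z where "z = 1 / (real i + 2)"
  have y: "0 \<le> y" "y \<le> z" "z \<le> 1 / 2"
    using nonneg b Suc by (auto simp: y_def z_def divide_simps)
  have "0 \<le> (z - y) * (1 - (z + y))"
    using y by (intro mult_nonneg_nonneg) auto
  then have mono: "y - y\<^sup>2 \<le> z - z\<^sup>2"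
    by (simp add: algebra_simps power2_eq_square)
  have "b * r (Suc i) \<le> b * (r i - b * (r i)\<^sup>2)"
    using b step by (intro mult_left_mono) auto
  also have "\<dots> = y - y\<^sup>2" by (simp add: y_def power2_eq_square algebra_simps)
  also have "\<dots> \<le> z - z\<^sup>2" by (rule mono)
  also have "\<dots> \<le> 1 / (real (Suc i) + 2)"
  proof -
    have "1 / w - (1 / w)\<^sup>2 = (w - 1) / w\<^sup>2" if "0 < w" for w :: real
      using that by (simp add: power2_eq_square field_simps)
    from this [of "real i + 2"] have "z - z\<^sup>2 = (real i + 1) / (real i + 2)\<^sup>2"
      by (simp add: z_def)
    also have "\<dots> \<le> 1 / (real i + 3)"
      by (simp add: divide_simps power2_eq_square) (simp add: algebra_simps)
    finally show ?thesis by (simp add: add_ac)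
  qed
  finally show ?case .
qed

text \<open>For \<open>n\<close> between \<open>N k\<close> and \<open>N (Suc k)\<close>,
  monotonicity puts \<open>a n / n\<close> between \<open>a (N k) / N (Suc k)\<close> and
  \<open>a (N (Suc k)) / N k\<close>; both tend to \<open>y\<close> because the ratio of consecutive
  terms of \<open>N\<close> tends to 1.\<close>

lemma tendsto_mono_interpolation:
  fixes a :: "nat \<Rightarrow> real" and N :: "nat \<Rightarrow> nat"
  assumes mono: "\<And>m n. m \<le> n \<Longrightarrow> a m \<le> a n" and nonneg: "\<And>n. 0 \<le> a n"
    and N: "strict_mono N" "0 < N 0"
    and ratio: "(\<lambda>k. real (N (Suc k)) / real (N k)) \<longlonglongrightarrow> 1"
    and lim: "(\<lambda>k. a (N k) / real (N k)) \<longlonglongrightarrow> y"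
  shows "(\<lambda>n. a n / real n) \<longlonglongrightarrow> y"
proof -
  have N_pos: "0 < N k" for k
    using N strict_mono_less_eq [OF N(1), of 0 k] by (metis le0 less_le_trans)
  \<comment> \<open>The index of the block that contains \<open>n\<close>. Below \<open>N 0\<close>
    the value is 0 as well, so the bound \<open>lower\<close> holds only from \<open>N 0\<close>
    on.\<close>
  define \<kappa> where "\<kappa> n = (LEAST k. n < N (Suc k))" for n
  have ex: "\<exists>k. n < N (Suc k)" for n
    using strict_mono_imp_increasing [OF N(1), of "Suc n"] by (intro exI [of _ n]) auto
  have upper: "n < N (Suc (\<kappa> n))" for n
    unfolding \<kappa>_def by (rule LeastI_ex [OF ex])
  have lower: "N (\<kappa> n) \<le> n" if "N 0 \<le> n" for n
  proof (cases "\<kappa> n")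
    case 0
    then show ?thesis using that by simp
  next
    case (Suc k)
    then have "\<not> n < N (Suc k)" unfolding \<kappa>_def by (intro not_less_Least) simp
    then show ?thesis using Suc by simp
  qed
  have \<kappa>_top: "filterlim \<kappa> sequentially sequentially"
    unfolding filterlim_at_top
  proof
    fix Z
    show "\<forall>\<^sub>F n in sequentially. Z \<le> \<kappa> n"
    proof (rule eventually_sequentiallyI [of "N Z"])
      fix n assume "N Z \<le> n"
      then have "N Z < N (Suc (\<kappa> n))" using upper [of n] by linarith
      then show "Z \<le> \<kappa> n" using N(1) by (simp add: strict_mono_less)
    qed
  qed
  let ?g = "\<lambda>k. a (N k) / real (N k)" and ?\<rho> = "\<lambda>k. real (N (Suc k)) / real (N k)"
  have lo: "(\<lambda>k. ?g k / ?\<rho> k) \<longlonglongrightarrow> y / 1"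
    by (intro tendsto_divide lim ratio) simp
  have hi: "(\<lambda>k. ?g (Suc k) * ?\<rho> k) \<longlonglongrightarrow> y * 1"
    by (intro tendsto_mult LIMSEQ_Suc [OF lim] ratio)
  show ?thesis
  proof (rule tendsto_sandwich)
    show "(\<lambda>n. ?g (\<kappa> n) / ?\<rho> (\<kappa> n)) \<longlonglongrightarrow> y"
      using filterlim_compose [OF lo \<kappa>_top] by simp
    show "(\<lambda>n. ?g (Suc (\<kappa> n)) * ?\<rho> (\<kappa> n)) \<longlonglongrightarrow> y"
      using filterlim_compose [OF hi \<kappa>_top] by simp
    show "\<forall>\<^sub>F n in sequentially. ?g (\<kappa> n) / ?\<rho> (\<kappa> n) \<le> a n / real n"
    proof (rule eventually_sequentiallyI [of "N 0"])
      fix n assume n: "N 0 \<le> n"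
      have "?g (\<kappa> n) / ?\<rho> (\<kappa> n) = a (N (\<kappa> n)) / real (N (Suc (\<kappa> n)))"
        using N_pos by simp
      also have "\<dots> \<le> a n / real n"
        using nonneg mono [OF lower [OF n]] upper [of n] n N by (intro frac_le) auto
      finally show "?g (\<kappa> n) / ?\<rho> (\<kappa> n) \<le> a n / real n" .
    qed
    show "\<forall>\<^sub>F n in sequentially. a n / real n \<le> ?g (Suc (\<kappa> n)) * ?\<rho> (\<kappa> n)"
    proof (rule eventually_sequentiallyI [of "N 0"])
      fix n assume n: "N 0 \<le> n"
      have "a n / real n \<le> a (N (Suc (\<kappa> n))) / real (N (\<kappa> n))"
        using nonneg mono [of n "N (Suc (\<kappa> n))"] upper [of n] lower [OF n] N_pos
        by (intro frac_le) (auto simp: less_imp_le)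
      also have "\<dots> = ?g (Suc (\<kappa> n)) * ?\<rho> (\<kappa> n)"
        using N_pos [of "Suc (\<kappa> n)"] by simp
      finally show "a n / real n \<le> ?g (Suc (\<kappa> n)) * ?\<rho> (\<kappa> n)" .
    qed
  qed
qed

lemma convergent_if_summable_increments:
  fixes x :: "nat \<Rightarrow> real"
  assumes "summable (\<lambda>k. \<bar>x (Suc k) - x k\<bar>)"
  shows "convergent x"
proof -
  have "summable (\<lambda>k. x (Suc k) - x k)"
    by (rule summable_norm_cancel) (use assms in simp)
  then have "convergent (\<lambda>k. x k - x 0)"
    unfolding summable_iff_convergent sum_lessThan_telescope .
  then obtain c where "(\<lambda>k. x k - x 0) \<longlonglongrightarrow> c"
    by (auto simp: convergent_def)
  from tendsto_add [OF this tendsto_const, of "x 0"] show ?thesis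
    unfolding convergent_def by (intro exI [of _ "c + x 0"]) simp
qed

section \<open>Survival with positive probability and convergence\<close>

context star_signaling
begin

section \<open>Reaching the starting configuration\<close>

definition attainable :: "('a \<Rightarrow> 'a \<Rightarrow> real) \<Rightarrow> bool" where
  "attainable v \<longleftrightarrow> (\<exists>n. 0 < prob {\<omega> \<in> space M. \<forall>i\<in>S\<^sub>1. \<forall>j\<in>S\<^sub>2. weight (path \<omega>) n i j = v i j})"

text \<open>Weights are positive, so any given entry is reinforced next with positive probability.
  Instead of conditioning, the one-step identity is applied to the indicator of the target array,
  and only the term of \<open>(a, b)\<close> is kept.\<close>

lemma attainable_bump:
  assumes v: "attainable v" and a: "a \<in> S\<^sub>1" and b: "b \<in> S\<^sub>2"
  shows "attainable (bump a b v)"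
proof -
  define agree where "agree w w' \<longleftrightarrow> (\<forall>i\<in>S\<^sub>1. \<forall>j\<in>S\<^sub>2. w i j = w' i j)" for w w' :: "'a \<Rightarrow> 'a \<Rightarrow> real"
  obtain n where n: "0 < prob {\<omega> \<in> space M. agree (weight (path \<omega>) n) v}"
    using v by (auto simp: attainable_def agree_def)
  let ?A = "{\<omega> \<in> space M. agree (weight (path \<omega>) n) v}"
  let ?B = "{\<omega> \<in> space M. agree (weight (path \<omega>) (Suc n)) (bump a b v)}"
  have sets: "{\<omega> \<in> space M. agree (weight (path \<omega>) m) w} \<in> sets M" for m w
    using sets_adapted [OF adapted_comp [where g = "\<lambda>x. agree x w", OF adapted_weight]] .
  have success: "success w a b = success v a b" if "agree w v" for w
    using that a b by (simp add: success_def agree_def)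
  \<comment> \<open>Positivity of \<open>success v a b\<close> is read off an actual path that
    agrees with \<open>v\<close>; one exists because the event has positive probability.\<close>
  obtain \<omega> where \<omega>: "agree (weight (path \<omega>) n) v"
  proof -
    have "?A \<noteq> {}" using n by (metis less_irrefl measure_empty)
    then show ?thesis using that by auto
  qed
  have "0 < success (weight (path \<omega>) n) a b"
    unfolding success_def using card_states_pos
    by (intro divide_pos_pos mult_pos_pos zero_less_power weight_pos row_sum_pos col_sum_pos) simp
  then have pos: "0 < success v a b" by (simp add: success [OF \<omega>])
  define \<Psi> :: "('a \<Rightarrow> 'a \<Rightarrow> real) \<Rightarrow> real" where "\<Psi> w = (if agree w (bump a b v) then 1 else 0)" for w
  let ?step = "\<lambda>w. (1 - (\<Sum>i\<in>S\<^sub>1. \<Sum>j\<in>S\<^sub>2. success w i j)) * \<Psi> w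
        + (\<Sum>i\<in>S\<^sub>1. \<Sum>j\<in>S\<^sub>2. success w i j * \<Psi> (bump i j w))"
  have le: "success v a b * (if agree w v then 1 else 0) \<le> ?step w" if w: "w = weight h n" for w h
  proof -
    have nonneg: "0 \<le> success w i j * \<Psi> (bump i j w)" for i j
      unfolding w \<Psi>_def by (simp add: success_nonneg)
    have "success w a b * \<Psi> (bump a b w) \<le> (\<Sum>j\<in>S\<^sub>2. success w a j * \<Psi> (bump a j w))"
      by (rule member_le_sum) (use b nonneg finite_signals in auto)
    also have "\<dots> \<le> (\<Sum>i\<in>S\<^sub>1. \<Sum>j\<in>S\<^sub>2. success w i j * \<Psi> (bump i j w))"
      by (rule member_le_sum [where f = "\<lambda>i. \<Sum>j\<in>S\<^sub>2. success w i j * \<Psi> (bump i j w)"])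
        (use a nonneg finite_states in \<open>auto intro: sum_nonneg\<close>)
    also have "\<dots> \<le> ?step w"
      using sum_success_le_1 [of h n] by (simp add: w \<Psi>_def)
    finally have 1: "success w a b * \<Psi> (bump a b w) \<le> ?step w" .
    have "0 \<le> ?step w"
      using sum_success_le_1 [of h n] nonneg by (intro add_nonneg_nonneg mult_nonneg_nonneg sum_nonneg) (auto simp: w \<Psi>_def success_nonneg)
    moreover have "\<Psi> (bump a b w) = 1" if "agree w v"
      using that by (auto simp: \<Psi>_def agree_def bump_def)
    ultimately show ?thesis using 1 success by auto
  qed
  have "success v a b * prob ?A = expectation (\<lambda>\<omega>. success v a b * indicator ?A \<omega>)"
    using sets [of n v] by simp
  also have "\<dots> = expectation (\<lambda>\<omega>. success v a b * (if agree (weight (path \<omega>) n) v then 1 else 0))"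
    by (intro Bochner_Integration.integral_cong) auto
  also have "\<dots> \<le> expectation (\<lambda>\<omega>. ?step (weight (path \<omega>) n))"
    by (intro integral_mono le [OF refl]
        integrable_adapted [OF adapted_comp [where g = "\<lambda>w. success v a b * (if agree w v then 1 else 0)", OF adapted_weight]]
        integrable_adapted [OF adapted_comp [where g = ?step, OF adapted_weight]])
  also have "\<dots> = expectation (\<lambda>\<omega>. \<Psi> (weight (path \<omega>) (Suc n)))"
    by (rule expectation_step [symmetric, where \<Psi> = "\<lambda>h. \<Psi>", OF adapted_const])
  also have "\<dots> = expectation (indicator ?B)"
    by (intro Bochner_Integration.integral_cong) (auto simp: \<Psi>_def)
  also have "\<dots> = prob ?B"
    using sets [of "Suc n" "bump a b v"] by simp
  finally have "0 < prob ?B"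
    using n pos by (meson mult_pos_pos less_le_trans)
  then show ?thesis unfolding attainable_def agree_def by (rule exI)
qed

lemma attainable_cong:
  assumes "attainable v" "\<And>i j. i \<in> S\<^sub>1 \<Longrightarrow> j \<in> S\<^sub>2 \<Longrightarrow> v i j = w i j"
  shows "attainable w"
  using assms by (simp add: attainable_def)

lemma attainable_raise:
  assumes "attainable v" "A \<subseteq> L"
  shows "attainable (\<lambda>i j. v i j + (if \<exists>l\<in>A. i = st l \<and> j = sg l then 1 else 0))"
  using finite_subset [OF assms(2) finite_leaves] assms(2)
proof (induction rule: finite_induct)
  case empty
  then show ?case using assms(1) by simp
next
  case (insert l A)
  let ?w = "\<lambda>i j. v i j + (if \<exists>l\<in>A. i = st l \<and> j = sg l then 1 else 0)"
  have "attainable (bump (st l) (sg l) ?w)"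
    using insert by (intro attainable_bump st_in sg_in) auto
  moreover have "\<not> (\<exists>k\<in>A. st l = st k \<and> sg l = sg k)"
    using inj_st_sg insert by (metis insert_subset subset_iff)
  ultimately show ?case
    by (elim attainable_cong) (auto simp: bump_def)
qed

definition start :: "nat \<Rightarrow> nat \<Rightarrow> (nat \<Rightarrow> 'a play) \<Rightarrow> bool" where
  "start K n h \<longleftrightarrow> flat (weight h n) \<and> (\<forall>l\<in>L. leafval (weight h n) l = K)"

lemma ex_start:
  assumes "1 \<le> K"
  shows "\<exists>n. 0 < prob {\<omega> \<in> space M. start K n (path \<omega>)}"
proof -
  \<comment> \<open>The array after \<open>k\<close> rounds, each of which reinforces every edge
    once; from weight 1 it takes \<open>K - 1\<close> rounds to reach \<open>K\<close>.\<close>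
  let ?v = "\<lambda>k i j. 1 + real k * (if \<exists>l\<in>L. i = st l \<and> j = sg l then 1 else 0)"
  have "attainable (?v k)" for k
  proof (induction k)
    case 0
    have "attainable (\<lambda>i j. 1)" unfolding attainable_def
      by (intro exI [of _ 0]) (simp add: prob_space)
    then show ?case by simp
  next
    case (Suc k)
    show ?case
      by (rule attainable_cong [OF attainable_raise [OF Suc subset_refl]]) (auto simp: algebra_simps)
  qed
  from this [of "K - 1"] obtain n
    where n: "0 < prob {\<omega> \<in> space M. \<forall>i\<in>S\<^sub>1. \<forall>j\<in>S\<^sub>2. weight (path \<omega>) n i j = ?v (K - 1) i j}"
    by (auto simp: attainable_def)
  have "start K n (path \<omega>)" if "\<forall>i\<in>S\<^sub>1. \<forall>j\<in>S\<^sub>2. weight (path \<omega>) n i j = ?v (K - 1) i j" for \<omega>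
    using that assms by (auto simp: start_def flat_def leafval_def edge_iff_leaf st_in sg_in of_nat_diff)
  moreover have "adapted n (start K n)"
    unfolding start_def
    by (rule adapted_comp [where g = "\<lambda>w. flat w \<and> (\<forall>l\<in>L. leafval w l = real K)", OF adapted_weight])
  ultimately have "prob {\<omega> \<in> space M. \<forall>i\<in>S\<^sub>1. \<forall>j\<in>S\<^sub>2. weight (path \<omega>) n i j = ?v (K - 1) i j}
      \<le> prob {\<omega> \<in> space M. start K n (path \<omega>)}"
    by (intro finite_measure_mono sets_adapted) auto
  then show ?thesis using n by (intro exI [of _ n]) simp
qed

section \<open>The region where the stars dominate, and the cost of leaving it\<close>

context
  fixes K n0 :: nat
  assumes K_large: "384 * nverts ^ 5 < K"
    and start_pos: "0 < prob {\<omega> \<in> space M. start K n0 (path \<omega>)}"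
begin

text \<open>
  \<open>start\<close> puts all shares at \<open>1 / (2 * nverts)\<close> or above, so that leaving the region below takes a
  fluctuation of a fixed size.
\<close>

definition alive :: "nat \<Rightarrow> (nat \<Rightarrow> 'a play) \<Rightarrow> bool" where
  "alive n h \<longleftrightarrow> start K n0 h \<and> (\<forall>m. n0 \<le> m \<and> m \<le> n \<longrightarrow>
     flat (weight h m) \<and> (\<forall>l\<in>L. 1 / (4 * nverts) \<le> share (leafval (weight h m)) l))"

abbreviation val :: "nat \<Rightarrow> (nat \<Rightarrow> 'a play) \<Rightarrow> 'a \<Rightarrow> real" where
  "val n h \<equiv> leafval (weight h n)"

lemma K_ge: "4 * nverts\<^sup>2 \<le> K" "1 \<le> K"
proof -
  have "nverts ^ 2 \<le> nverts ^ 5" "1 \<le> nverts ^ 5"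
    using nverts_ge_1 by (auto intro: power_increasing one_le_power)
  then show "4 * nverts\<^sup>2 \<le> K" "1 \<le> K" using K_large by linarith+
qed

lemma adapted_val: "adapted n (val n)"
  by (rule adapted_comp [where g = leafval, OF adapted_weight])

lemma adapted_alive:
  assumes "n0 \<le> n" shows "adapted n (alive n)"
proof (rule adaptedI)
  fix h h' :: "nat \<Rightarrow> 'a play" assume "\<And>m. m < n \<Longrightarrow> h m = h' m"
  then have "weight h m = weight h' m" if "m \<le> n" for m
    by (intro adaptedD [OF adapted_weight]) (use that in auto)
  then show "alive n h = alive n h'" using assms by (auto simp: alive_def start_def)
qed

lemma alive_Suc: "alive (Suc n) h \<Longrightarrow> alive n h"
  by (auto simp: alive_def)

lemma alive_Suc_iff:
  "n0 \<le> n \<Longrightarrow> alive (Suc n) h \<longleftrightarrow> alive n h \<and>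
     flat (weight h (Suc n)) \<and> (\<forall>l\<in>L. 1 / (4 * nverts) \<le> share (leafval (weight h (Suc n))) l)"
  unfolding alive_def by (auto simp: le_Suc_eq)

lemma alive_mono: "alive n h \<Longrightarrow> m \<le> n \<Longrightarrow> alive m h"
  by (auto simp: alive_def)

lemma val_mono: "m \<le> n \<Longrightarrow> val m h l \<le> val n h l"
  by (simp add: leafval_def weight_mono)

lemma
  assumes "alive n h" "n0 \<le> n"
  shows alive_flat: "flat (weight h n)"
    and alive_share: "\<And>l. l \<in> L \<Longrightarrow> 1 / (4 * nverts) \<le> share (val n h) l"
    and alive_val: "\<And>l. l \<in> L \<Longrightarrow> K \<le> val n h l"
    and alive_tot: "\<And>l. l \<in> L \<Longrightarrow> 4 * nverts\<^sup>2 \<le> tot (val n h) (f l)"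
proof -
  show "flat (weight h n)" "\<And>l. l \<in> L \<Longrightarrow> 1 / (4 * nverts) \<le> share (val n h) l"
    using assms by (auto simp: alive_def)
  show K: "K \<le> val n h l" if "l \<in> L" for l
    using val_mono [OF assms(2), of h l] assms(1) that by (auto simp: alive_def start_def)
  show "4 * nverts\<^sup>2 \<le> tot (val n h) (f l)" if "l \<in> L" for l
    using leaf_le_tot [where u = "val n h", OF weight_leaf_ge_1 that] K [OF that] K_ge by linarith
qed

text \<open>The leaf weights on \<open>start\<close>, the same for every such history; this gives
  the potential a reference point that does not depend on the path.\<close>

definition val0 :: "'a \<Rightarrow> real" where "val0 l = (if l \<in> L then K else 0)"

lemma start_val: "start K n0 h \<Longrightarrow> val n0 h = val0"
  by (auto simp: start_def val0_def leafval_def)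

lemma val0_ge_1: "l \<in> L \<Longrightarrow> 1 \<le> val0 l"
  using K_ge by (simp add: val0_def)

text \<open>A star has at most \<open>nverts\<close> leaves of weight \<open>K\<close>, and the
  entries of weight 1 at its center amount to at most \<open>nverts \<le> nverts * K\<close>; its
  total is therefore at most \<open>2 * nverts * K\<close>.\<close>

lemma share_val0: assumes "l \<in> L" shows "1 / (2 * nverts) \<le> share val0 l"
proof -
  have "tot val0 (f l) = missing (f l) + card {k \<in> L. f k = f l} * real K"
    by (simp add: tot_def val0_def)
  also have "\<dots> \<le> nverts * real K + nverts * real K"
  proof (rule add_mono)
    show "missing (f l) \<le> nverts * real K"
    proof -
      have "nverts * 1 \<le> nverts * real K" using K_ge nverts_ge_1 by (intro mult_left_mono) auto
      then show ?thesis using d_le [of "f l"] by linarith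
    qed
    have "card {k \<in> L. f k = f l} \<le> card L" by (rule card_mono) (use finite_leaves in auto)
    then show "card {k \<in> L. f k = f l} * real K \<le> nverts * real K"
      using card_L_le by (intro mult_right_mono) auto
  qed
  finally have "tot val0 (f l) \<le> 2 * nverts * K" by (simp only: mult_2 distrib_right)
  then have "K / (2 * nverts * K) \<le> K / tot val0 (f l)"
    using tot_ge_1 [where u = val0, OF val0_ge_1 assms] K_ge nverts_ge_1
    by (intro divide_left_mono mult_pos_pos) auto
  then show ?thesis using K_ge assms by (simp add: share_def val0_def)
qed

lemma alive_n0: "alive n0 h \<longleftrightarrow> start K n0 h"
proof
  assume st: "start K n0 h"
  have "1 / (4 * nverts) \<le> share val0 l" if "l \<in> L" for l
    using share_val0 [OF that] nverts_ge_1 by (simp add: divide_simps)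
  then show "alive n0 h" using st start_val [OF st] by (auto simp: alive_def start_def)
qed (simp add: alive_def)

text \<open>
  The squares dominate 1 as soon as a share leaves the region of \<open>alive\<close>. Their drift and the rate of
  stray reinforcements are of order \<open>1 / tot\<^sup>2\<close>, which the drift of \<open>1 / tot\<close> compensates.
\<close>

definition potential :: "('a \<Rightarrow> real) \<Rightarrow> real" where
  "potential u = (\<Sum>l\<in>L. 16 * nverts\<^sup>2 * (share u l - share val0 l)\<^sup>2 + 384 * nverts ^ 4 * (1 / tot u (f l)))"

text \<open>A balance of the coefficients of
  \<open>nverts ^ 4 / (card S\<^sub>1 * tot\<^sup>2)\<close>, leaf by leaf: the squares cost at most
  \<open>16 * 5 = 80\<close>, \<open>stray_le\<close> with
  \<open>\<kappa> = 1 / (4 * nverts)\<close> costs 16, and the drift of \<open>1 / tot\<close>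
  returns \<open>384 / 4 = 96\<close>.\<close>

lemma gen_potential_le:
  assumes "alive n h" "n0 \<le> n"
  shows "gen potential (val n h) + stray (weight h n) \<le> 0"
proof -
  let ?u = "val n h" and ?N = "real (card S\<^sub>1)"
  note u = weight_leaf_ge_1 [of _ h n]
  have N: "1 \<le> ?N" by (rule N_ge)
  have "gen potential ?u = (\<Sum>l\<in>L. 16 * nverts\<^sup>2 * gen (\<lambda>u. (share u l - share val0 l)\<^sup>2) ?u
      + 384 * nverts ^ 4 * gen (\<lambda>u. 1 / tot u (f l)) ?u)"
    unfolding potential_def gen_sum gen_add gen_cmult ..
  also have "\<dots> \<le> (\<Sum>l\<in>L. 16 * nverts\<^sup>2 * (5 * nverts\<^sup>2 / (?N * (tot ?u (f l))\<^sup>2))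
      + 384 * nverts ^ 4 * (- (1 / (4 * ?N * (tot ?u (f l))\<^sup>2))))"
  proof (intro sum_mono add_mono mult_left_mono)
    fix l assume l: "l \<in> L"
    show "gen (\<lambda>u. (share u l - share val0 l)\<^sup>2) ?u \<le> 5 * nverts\<^sup>2 / (?N * (tot ?u (f l))\<^sup>2)"
      using gen_share_square_le [OF u l share_nonneg [OF val0_ge_1 l] share_le_1 [OF val0_ge_1 l]] by simp
    show "gen (\<lambda>u. 1 / tot u (f l)) ?u \<le> - (1 / (4 * ?N * (tot ?u (f l))\<^sup>2))"
      using gen_inverse_tot_le [OF u l alive_tot [OF assms l]] by simp
  qed (use nverts_ge_1 in auto)
  also have "\<dots> = (\<Sum>l\<in>L. - (16 * nverts ^ 4 / ?N) * (1 / (tot ?u (f l))\<^sup>2))"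
    by (intro sum.cong refl) (simp add: field_simps)
  also have "\<dots> = - (16 * nverts ^ 4 / ?N) * (\<Sum>l\<in>L. 1 / (tot ?u (f l))\<^sup>2)"
    by (simp only: sum_distrib_left)
  finally have 1: "gen potential ?u \<le> - (16 * nverts ^ 4 / ?N) * (\<Sum>l\<in>L. 1 / (tot ?u (f l))\<^sup>2)" .
  have "stray (weight h n) \<le> nverts\<^sup>2 / ((1 / (4 * nverts))\<^sup>2 * ?N) * (\<Sum>l\<in>L. 1 / (tot ?u (f l))\<^sup>2)"
    using nverts_ge_1 by (intro stray_le alive_flat [OF assms] alive_share [OF assms] u) (auto simp: divide_simps)
  also have "nverts\<^sup>2 / ((1 / (4 * nverts))\<^sup>2 * ?N) = 16 * nverts ^ 4 / ?N"
    using nverts_ge_1 N by (simp add: field_simps eval_nat_numeral)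
  finally show ?thesis using 1 by linarith
qed

lemma potential_term_nonneg:
  assumes "\<And>l. l \<in> L \<Longrightarrow> 1 \<le> u l" "l \<in> L"
  shows "0 \<le> 16 * nverts\<^sup>2 * (share u l - share val0 l)\<^sup>2 + 384 * nverts ^ 4 * (1 / tot u (f l))"
  using tot_ge_1 [where u = u, OF assms] nverts_ge_1
  by (intro add_nonneg_nonneg mult_nonneg_nonneg divide_nonneg_nonneg) auto

lemma potential_nonneg:
  assumes "\<And>l. l \<in> L \<Longrightarrow> 1 \<le> u l" shows "0 \<le> potential u"
  unfolding potential_def by (intro sum_nonneg potential_term_nonneg assms)

text \<open>The squares vanish and every \<open>tot\<close> is at least \<open>K\<close>, which
  leaves at most \<open>nverts\<close> terms of size \<open>384 * nverts ^ 4 / K\<close>. The lower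
  bound imposed on \<open>K\<close> makes their sum less than 1.\<close>

lemma potential_val0: "potential val0 < 1"
proof -
  have "potential val0 = (\<Sum>l\<in>L. 384 * nverts ^ 4 * (1 / tot val0 (f l)))"
    by (simp add: potential_def)
  also have "\<dots> \<le> (\<Sum>l\<in>L. 384 * nverts ^ 4 * (1 / K))"
  proof (intro sum_mono mult_left_mono divide_left_mono)
    fix l assume l: "l \<in> L"
    show K: "K \<le> tot val0 (f l)"
      using leaf_le_tot [where u = val0, OF val0_ge_1 l] l by (simp add: val0_def [of l])
    show "0 < tot val0 (f l) * K" using K K_ge by auto
  qed auto
  also have "\<dots> = card L * (384 * nverts ^ 4 * (1 / K))" by simp
  also have "\<dots> \<le> nverts * (384 * nverts ^ 4 * (1 / K))"
    using card_L_le by (intro mult_right_mono) auto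
  also have "\<dots> = 384 * nverts ^ 5 / K" by (simp add: eval_nat_numeral)
  also have "\<dots> < 1" using K_large K_ge by simp
  finally show ?thesis .
qed

text \<open>The share has dropped from at least \<open>1 / (2 * nverts)\<close> to below
  \<open>1 / (4 * nverts)\<close>; the factor \<open>16 * nverts\<^sup>2\<close> normalises the
  square of this gap to 1.\<close>

lemma potential_exit:
  assumes u: "\<And>l. l \<in> L \<Longrightarrow> 1 \<le> u l" and l: "l \<in> L" and exit: "share u l < 1 / (4 * nverts)"
  shows "1 \<le> potential u"
proof -
  have "1 / (4 * nverts) \<le> share val0 l - share u l"
    using share_val0 [OF l] exit nverts_ge_1 by (simp add: field_simps)
  then have "(1 / (4 * nverts))\<^sup>2 \<le> (share val0 l - share u l)\<^sup>2"
    using nverts_ge_1 by (intro power_mono) auto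
  then have "16 * nverts\<^sup>2 * (1 / (4 * nverts))\<^sup>2 \<le> 16 * nverts\<^sup>2 * (share u l - share val0 l)\<^sup>2"
    by (intro mult_left_mono) (auto simp: power2_commute)
  moreover have "16 * nverts\<^sup>2 * (1 / (4 * nverts))\<^sup>2 = 1"
    using nverts_ge_1 by (simp add: power2_eq_square)
  ultimately have "1 \<le> 16 * nverts\<^sup>2 * (share u l - share val0 l)\<^sup>2 + 384 * nverts ^ 4 * (1 / tot u (f l))"
    using tot_ge_1 [where u = u, OF u l] nverts_ge_1 by (simp add: add_increasing2)
  also have "\<dots> \<le> potential u"
    unfolding potential_def
    by (rule member_le_sum [OF l _ finite_leaves]) (rule potential_term_nonneg [OF u], auto)
  finally show ?thesis .
qed

section \<open>Survival with positive probability\<close>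

lemma integrable_alive:
  fixes g :: "(nat \<Rightarrow> 'a play) \<Rightarrow> ('a \<Rightarrow> real) \<Rightarrow> real"
  assumes "n0 \<le> n" and g: "\<And>u. adapted n (\<lambda>h. g h u)"
  shows "integrable M (\<lambda>\<omega>. if alive n (path \<omega>) then g (path \<omega>) (val n (path \<omega>)) else 0)"
  by (rule integrable_adapted [where F = "\<lambda>h. if alive n h then g h (val n h) else 0"],
      rule adapted_comp2 [where g = "\<lambda>p x. if p then x else 0", OF adapted_alive [OF assms(1)]],
      rule adapted_app [where X = "val n", OF g adapted_val])

text \<open>Every death uses up at least one unit: a stray reinforcement is charged 1 in
  \<open>?exit\<close>, and a share that leaves the region forces the potential to be at least 1.
  Since the potential does not drift upwards even after this charge, \<open>p n - e n\<close> never
  decreases, and as \<open>e n\<close> is nonnegative it bounds the survival probability from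
  below.\<close>

lemma prob_alive_pos: "0 < prob {\<omega> \<in> space M. \<forall>n\<ge>n0. alive n (path \<omega>)}"
proof -
  define p where "p n = prob {\<omega> \<in> space M. alive n (path \<omega>)}" for n
  define e where "e n = expectation (\<lambda>\<omega>. if alive n (path \<omega>) then potential (val n (path \<omega>)) else 0)" for n
  have sets: "{\<omega> \<in> space M. alive n (path \<omega>)} \<in> sets M" if "n0 \<le> n" for n
    by (rule sets_adapted [OF adapted_alive [OF that]])
  have p: "p n = expectation (\<lambda>\<omega>. if alive n (path \<omega>) then 1 else 0)" if "n0 \<le> n" for n
  proof -
    have "p n = expectation (indicator {\<omega> \<in> space M. alive n (path \<omega>)})"
      using sets [OF that] by (simp add: p_def)
    also have "\<dots> = expectation (\<lambda>\<omega>. if alive n (path \<omega>) then 1 else 0)"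
      by (intro Bochner_Integration.integral_cong) auto
    finally show ?thesis .
  qed
  have int1: "integrable M (\<lambda>\<omega>. if alive n (path \<omega>) then 1 else 0 :: real)"
    and intp: "integrable M (\<lambda>\<omega>. if alive n (path \<omega>) then potential (val n (path \<omega>)) else 0)" if "n0 \<le> n" for n
    using integrable_alive [OF that, where g = "\<lambda>h u. 1"] integrable_alive [OF that, where g = "\<lambda>h. potential"]
    by (simp_all add: adapted_const)
  have step: "p n - e n \<le> p (Suc n) - e (Suc n)" if n: "n0 \<le> n" for n
  proof -
    let ?one = "\<lambda>n \<omega>. if alive n (path \<omega>) then 1 else 0 :: real"
    let ?pot = "\<lambda>n \<omega>. if alive n (path \<omega>) then potential (val n (path \<omega>)) else 0"
    let ?exit = "\<lambda>h. if alive n h then (if flat (weight h (Suc n)) then potential (val (Suc n) h) else 1) else 0"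
    have "adapted (Suc n) ?exit"
      by (rule adapted_comp2 [where g = "\<lambda>p w. if p then (if flat w then potential (leafval w) else 1) else 0",
            OF adapted_mono [OF adapted_alive [OF n]] adapted_weight]) simp
    then have int_exit: "integrable M (\<lambda>\<omega>. ?exit (path \<omega>))" by (rule integrable_adapted)
    have "p n - p (Suc n) + e (Suc n) = expectation (\<lambda>\<omega>. ?one n \<omega> - ?one (Suc n) \<omega> + ?pot (Suc n) \<omega>)"
      using n by (simp add: p e_def int1 intp)
    also have "\<dots> \<le> expectation (\<lambda>\<omega>. ?exit (path \<omega>))"
    proof (rule integral_mono)
      show "integrable M (\<lambda>\<omega>. ?one n \<omega> - ?one (Suc n) \<omega> + ?pot (Suc n) \<omega>)"
        using n by (intro Bochner_Integration.integrable_add Bochner_Integration.integrable_diff int1 intp) auto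
      show "integrable M (\<lambda>\<omega>. ?exit (path \<omega>))" by (rule int_exit)
      fix \<omega>
      let ?h = "path \<omega>"
      note u = weight_leaf_ge_1 [of _ ?h "Suc n"]
      show "?one n \<omega> - ?one (Suc n) \<omega> + ?pot (Suc n) \<omega> \<le> ?exit ?h"
      proof (cases "alive (Suc n) ?h")
        case True
        then show ?thesis using alive_Suc alive_flat n by fastforce
      next
        case False
        have "1 \<le> potential (val (Suc n) ?h)" if a: "alive n ?h" and b: "flat (weight ?h (Suc n))"
        proof -
          obtain l where "l \<in> L" "share (val (Suc n) ?h) l < 1 / (4 * nverts)"
            using a b False by (auto simp: alive_Suc_iff [OF n] not_le)
          then show ?thesis using potential_exit u by blast
        qed
        then show ?thesis using False by auto
      qed
    qed
    also have "\<dots> \<le> expectation (\<lambda>\<omega>. if alive n (path \<omega>) then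
        potential (val n (path \<omega>)) + gen potential (val n (path \<omega>)) + 1 * stray (weight (path \<omega>) n) else 0)"
      by (rule expectation_killed_step [where \<phi> = "\<lambda>h. potential" and P = "alive n"])
        (auto intro: adapted_alive adapted_const alive_flat potential_nonneg weight_leaf_ge_1 n)
    also have "\<dots> \<le> e n"
      unfolding e_def
    proof (rule integral_mono [OF _ intp [OF n]])
      show "integrable M (\<lambda>\<omega>. if alive n (path \<omega>) then
        potential (val n (path \<omega>)) + gen potential (val n (path \<omega>)) + 1 * stray (weight (path \<omega>) n) else 0)"
        by (rule integrable_adapted [OF adapted_comp2 [where g = "\<lambda>p w. if p then potential (leafval w) + gen potential (leafval w) + 1 * stray w else 0",
            OF adapted_alive [OF n] adapted_weight]])
      show "(if alive n (path \<omega>) then potential (val n (path \<omega>)) + gen potential (val n (path \<omega>)) + 1 * stray (weight (path \<omega>) n) else 0)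
          \<le> (if alive n (path \<omega>) then potential (val n (path \<omega>)) else 0)" for \<omega>
        using gen_potential_le [OF _ n, of "path \<omega>"] by auto
    qed
    finally show ?thesis by simp
  qed
  have ge: "p n0 - e n0 \<le> p n" if n: "n0 \<le> n" for n
  proof -
    have "p n0 - e n0 \<le> p n - e n"
      using n by (induction rule: dec_induct) (use step in \<open>auto intro: order_trans\<close>)
    moreover have "0 \<le> e n"
      unfolding e_def by (intro Bochner_Integration.integral_nonneg) (auto intro: potential_nonneg weight_leaf_ge_1)
    ultimately show ?thesis by simp
  qed
  \<comment> \<open>On the starting event the potential is the constant
    \<open>potential val0 < 1\<close>, so a positive part of the initial mass can never be used
    up.\<close>
  have "e n0 = potential val0 * p n0"
  proof -
    have "e n0 = expectation (\<lambda>\<omega>. potential val0 * (if alive n0 (path \<omega>) then 1 else 0))"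
      unfolding e_def by (intro Bochner_Integration.integral_cong refl) (auto simp: alive_n0 start_val)
    then show ?thesis by (simp add: p)
  qed
  moreover have "0 < p n0" using start_pos by (simp add: p_def alive_n0)
  ultimately have pos: "0 < p n0 - e n0"
    using potential_val0 by simp
  let ?A = "\<lambda>k. {\<omega> \<in> space M. alive (n0 + k) (path \<omega>)}"
  have "(\<lambda>k. prob (?A k)) \<longlonglongrightarrow> prob (\<Inter>k. ?A k)"
    by (rule finite_Lim_measure_decseq) (auto simp: decseq_def sets intro: alive_mono)
  then have "p n0 - e n0 \<le> prob (\<Inter>k. ?A k)"
    by (rule LIMSEQ_le_const) (use ge in \<open>auto simp: p_def\<close>)
  also have "(\<Inter>k. ?A k) = {\<omega> \<in> space M. \<forall>n\<ge>n0. alive n (path \<omega>)}"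
    by (auto simp: le_iff_add)
  finally show ?thesis using pos by linarith
qed

section \<open>Moments on the event of being alive\<close>

lemma expectation_alive_step:
  fixes \<phi> :: "(nat \<Rightarrow> 'a play) \<Rightarrow> ('a \<Rightarrow> real) \<Rightarrow> real"
  assumes n: "n0 \<le> n" and \<phi>: "\<And>u. adapted n (\<lambda>h. \<phi> h u)"
    and nonneg: "\<And>h u. (\<And>l. l \<in> L \<Longrightarrow> 1 \<le> u l) \<Longrightarrow> 0 \<le> \<phi> h u"
    and le: "\<And>h. alive n h \<Longrightarrow> \<phi> h (val n h) + gen (\<phi> h) (val n h) \<le> \<psi> h (val n h)"
    and \<psi>: "\<And>u. adapted n (\<lambda>h. \<psi> h u)"
  shows "expectation (\<lambda>\<omega>. if alive (Suc n) (path \<omega>) then \<phi> (path \<omega>) (val (Suc n) (path \<omega>)) else 0)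
    \<le> expectation (\<lambda>\<omega>. if alive n (path \<omega>) then \<psi> (path \<omega>) (val n (path \<omega>)) else 0)"
proof -
  have \<phi>': "adapted (Suc n) (\<lambda>h. \<phi> h u)" for u by (rule adapted_mono [OF \<phi>]) simp
  \<comment> \<open>The value after one step with reward 0 for a stray reinforcement. It still
    counts the paths whose shares have become too small; as \<open>\<phi>\<close> is nonnegative,
    this only enlarges the expectation to be bounded.\<close>
  let ?mid = "\<lambda>h. if alive n h then (if flat (weight h (Suc n)) then \<phi> h (val (Suc n) h) else 0) else 0"
  have "adapted (Suc n) ?mid"
  proof (rule adapted_comp2 [where g = "\<lambda>p x. if p then x else 0", OF adapted_mono [OF adapted_alive [OF n]]])
    show "adapted (Suc n) (\<lambda>h. if flat (weight h (Suc n)) then \<phi> h (val (Suc n) h) else 0)"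
      by (rule adapted_comp2 [where g = "\<lambda>w x. if flat w then x else 0", OF adapted_weight
            adapted_app [where X = "val (Suc n)", OF \<phi>' adapted_val]])
  qed simp
  then have int_mid: "integrable M (\<lambda>\<omega>. ?mid (path \<omega>))" by (rule integrable_adapted)
  have "adapted n (\<lambda>h. \<phi> h (val n h) + gen (\<phi> h) (val n h))"
  proof (rule adapted_app [where X = "val n" and G = "\<lambda>h u. \<phi> h u + gen (\<phi> h) u"])
    fix u
    show "adapted n (\<lambda>h. \<phi> h u + gen (\<phi> h) u)"
    proof (rule adaptedI)
      fix h h' :: "nat \<Rightarrow> 'a play" assume eq: "\<And>m. m < n \<Longrightarrow> h m = h' m"
      have "\<phi> h = \<phi> h'" by (rule ext, rule adaptedD [OF \<phi> eq])
      then show "\<phi> h u + gen (\<phi> h) u = \<phi> h' u + gen (\<phi> h') u" by simp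
    qed
  qed (rule adapted_val)
  from integrable_adapted [OF adapted_comp2 [where g = "\<lambda>p x. if p then x else 0", OF adapted_alive [OF n] this]]
  have int_gen: "integrable M (\<lambda>\<omega>. if alive n (path \<omega>) then
      \<phi> (path \<omega>) (val n (path \<omega>)) + gen (\<phi> (path \<omega>)) (val n (path \<omega>)) + 0 * stray (weight (path \<omega>) n) else 0)"
    by (simp cong: if_cong)
  have "expectation (\<lambda>\<omega>. if alive (Suc n) (path \<omega>) then \<phi> (path \<omega>) (val (Suc n) (path \<omega>)) else 0)
      \<le> expectation (\<lambda>\<omega>. ?mid (path \<omega>))"
  proof (rule integral_mono [OF integrable_alive int_mid])
    show "(if alive (Suc n) (path \<omega>) then \<phi> (path \<omega>) (val (Suc n) (path \<omega>)) else 0) \<le> ?mid (path \<omega>)" for \<omega>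
    proof -
      have "0 \<le> \<phi> (path \<omega>) (val (Suc n) (path \<omega>))" by (rule nonneg) (rule weight_leaf_ge_1)
      then show ?thesis by (simp add: alive_Suc_iff [OF n])
    qed
  qed (use n \<phi>' in auto)
  also have "\<dots> \<le> expectation (\<lambda>\<omega>. if alive n (path \<omega>) then
      \<phi> (path \<omega>) (val n (path \<omega>)) + gen (\<phi> (path \<omega>)) (val n (path \<omega>)) + 0 * stray (weight (path \<omega>) n) else 0)"
  proof (rule expectation_killed_step [OF adapted_alive [OF n]])
    show "flat (weight h n)" if "alive n h" for h by (rule alive_flat [OF that n])
    show "adapted n (\<lambda>h. \<phi> h u)" for u by (rule \<phi>)
    show "0 \<le> \<phi> h (val n h)" for h by (rule nonneg) (rule weight_leaf_ge_1)
  qed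
  also have "\<dots> \<le> expectation (\<lambda>\<omega>. if alive n (path \<omega>) then \<psi> (path \<omega>) (val n (path \<omega>)) else 0)"
  proof (rule integral_mono [OF int_gen integrable_alive [OF n \<psi>]])
    show "(if alive n (path \<omega>) then \<phi> (path \<omega>) (val n (path \<omega>)) + gen (\<phi> (path \<omega>)) (val n (path \<omega>))
            + 0 * stray (weight (path \<omega>) n) else 0)
        \<le> (if alive n (path \<omega>) then \<psi> (path \<omega>) (val n (path \<omega>)) else 0)" for \<omega>
      using le [of "path \<omega>"] by simp
  qed
  finally show ?thesis .
qed

text \<open>For the mean \<open>r n\<close> of \<open>1 / tot\<close> on \<open>alive n\<close>, the
  negative drift and Jensen's inequality give the closed recursion
  \<open>r (Suc n) \<le> r n - b * (r n)\<^sup>2\<close>, a discrete version of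
  \<open>r' = - b * r\<^sup>2\<close>, hence decay of order \<open>1 / n\<close>. No pathwise lower
  bound on the growth of \<open>tot\<close> enters.\<close>

lemma inverse_tot_moment:
  assumes k: "k \<in> L"
  shows "\<exists>C\<ge>0. \<forall>n\<ge>n0. n * expectation (\<lambda>\<omega>. if alive n (path \<omega>) then 1 / tot (val n (path \<omega>)) (f k) else 0) \<le> C"
proof -
  define t where "t n h = tot (val n h) (f k)" for n h
  define r where "r n = expectation (\<lambda>\<omega>. if alive n (path \<omega>) then 1 / t n (path \<omega>) else 0)" for n
  define b where "b = 1 / (4 * real (card S\<^sub>1))"
  have b: "0 < b" "b \<le> 1 / 2" using card_states_pos by (auto simp: b_def divide_simps)
  have t: "1 \<le> t n h" for n h
    unfolding t_def by (rule tot_ge_1 [OF _ k]) (rule weight_leaf_ge_1)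
  have t_inv: "1 / t n h \<le> 1" for n h using t [of n h] by (simp add: divide_simps)
  have r_nonneg: "0 \<le> r n" for n
    unfolding r_def using t by (intro Bochner_Integration.integral_nonneg) (auto intro: order_trans [OF zero_le_one])
  have int1: "integrable M (\<lambda>\<omega>. if alive n (path \<omega>) then 1 / t n (path \<omega>) else 0)"
    and int2: "integrable M (\<lambda>\<omega>. if alive n (path \<omega>) then (1 / t n (path \<omega>))\<^sup>2 else 0)" if n: "n0 \<le> n" for n
    using integrable_alive [OF n, where g = "\<lambda>h u. 1 / tot u (f k)"]
      integrable_alive [OF n, where g = "\<lambda>h u. (1 / tot u (f k))\<^sup>2"]
    by (simp_all add: adapted_const t_def cong: if_cong)
  \<comment> \<open>Jensen's inequality for the defective law of \<open>t n\<close> on the event \<open>alive n\<close>\<close>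
  have jensen: "(r n)\<^sup>2 \<le> expectation (\<lambda>\<omega>. if alive n (path \<omega>) then (1 / t n (path \<omega>))\<^sup>2 else 0)" if n: "n0 \<le> n" for n
  proof -
    have "(r n)\<^sup>2 = expectation (\<lambda>\<omega>. 2 * r n * (if alive n (path \<omega>) then 1 / t n (path \<omega>) else 0) - (r n)\<^sup>2)"
      using int1 [OF n] by (simp add: r_def [of n, symmetric] prob_space power2_eq_square)
    also have "\<dots> \<le> expectation (\<lambda>\<omega>. if alive n (path \<omega>) then (1 / t n (path \<omega>))\<^sup>2 else 0)"
    proof (rule integral_mono [OF _ int2 [OF n]])
      show "integrable M (\<lambda>\<omega>. 2 * r n * (if alive n (path \<omega>) then 1 / t n (path \<omega>) else 0) - (r n)\<^sup>2)"
        by (intro Bochner_Integration.integrable_diff integrable_mult_right int1 n integrable_const)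
      show "2 * r n * (if alive n (path \<omega>) then 1 / t n (path \<omega>) else 0) - (r n)\<^sup>2
          \<le> (if alive n (path \<omega>) then (1 / t n (path \<omega>))\<^sup>2 else 0)" for \<omega>
        using sum_squares_bound [of "r n" "1 / t n (path \<omega>)"] by (cases "alive n (path \<omega>)") simp_all
    qed
    finally show ?thesis .
  qed
  have step: "r (Suc n) \<le> r n - b * (r n)\<^sup>2" if n: "n0 \<le> n" for n
  proof -
    have "r (Suc n) \<le> expectation (\<lambda>\<omega>. if alive n (path \<omega>) then 1 / t n (path \<omega>) - b * (1 / t n (path \<omega>))\<^sup>2 else 0)"
      unfolding r_def t_def
    proof (rule expectation_alive_step [OF n, where \<phi> = "\<lambda>h u. 1 / tot u (f k)" and \<psi> = "\<lambda>h u. 1 / tot u (f k) - b * (1 / tot u (f k))\<^sup>2"])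
      show "0 \<le> 1 / tot u (f k)" if "\<And>l. l \<in> L \<Longrightarrow> 1 \<le> u l" for u
        using tot_ge_1 [where u = u, OF that k] by simp
      show "1 / tot (val n h) (f k) + gen (\<lambda>u. 1 / tot u (f k)) (val n h)
          \<le> 1 / tot (val n h) (f k) - b * (1 / tot (val n h) (f k))\<^sup>2" if "alive n h" for h
        using gen_inverse_tot_le [where u = "val n h", OF weight_leaf_ge_1 k alive_tot [OF that n k]]
        by (simp add: b_def power_divide)
    qed (rule adapted_const)+
    also have "\<dots> = expectation (\<lambda>\<omega>. (if alive n (path \<omega>) then 1 / t n (path \<omega>) else 0)
        - b * (if alive n (path \<omega>) then (1 / t n (path \<omega>))\<^sup>2 else 0))"
      by (intro Bochner_Integration.integral_cong) auto
    also have "\<dots> = r n - b * expectation (\<lambda>\<omega>. if alive n (path \<omega>) then (1 / t n (path \<omega>))\<^sup>2 else 0)"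
      using int1 [OF n] int2 [OF n] by (simp add: r_def)
    also have "\<dots> \<le> r n - b * (r n)\<^sup>2"
      using mult_left_mono [OF jensen [OF n], of b] b by simp
    finally show ?thesis .
  qed
  have "r n0 \<le> expectation (\<lambda>\<omega>. 1)"
    unfolding r_def using t_inv by (intro integral_mono int1) auto
  then have "b * r n0 \<le> 1 / 2"
    using mult_mono [of b "1 / 2" "r n0" 1] b r_nonneg [of n0] by (simp add: prob_space)
  then have decay: "b * r (n0 + i) \<le> 1 / (real i + 2)" for i
    using quadratic_recursion_decay [of "\<lambda>i. r (n0 + i)" b i] b r_nonneg step by simp
  \<comment> \<open>Passing from the time \<open>i\<close> elapsed since \<open>n0\<close> to
    \<open>n = n0 + i\<close> costs the factor \<open>n0 + 1\<close>, as
    \<open>n0 + i \<le> (n0 + 1) * (i + 2)\<close>.\<close>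
  have "n * r n \<le> (n0 + 1) / b" if n: "n0 \<le> n" for n
  proof -
    obtain i where i: "n = n0 + i" using n by (auto simp: le_iff_add)
    have "b * (n * r n) = n * (b * r (n0 + i))" by (simp add: i)
    also have "\<dots> \<le> n * (1 / (real i + 2))" using decay by (intro mult_left_mono) auto
    also have "\<dots> \<le> n0 + 1" by (simp add: i divide_simps) (simp add: algebra_simps)
    finally show ?thesis using b by (simp add: pos_le_divide_eq mult.commute)
  qed
  moreover have "0 \<le> (n0 + 1) / b" using b by simp
  ultimately show ?thesis unfolding r_def t_def by blast
qed

text \<open>With the share at time \<open>n\<close> frozen as the constant, \<open>\<phi>\<close> is
  a supermartingale from time \<open>n\<close> on: the factor 20 scales the \<open>1 / 4\<close> in
  the drift of \<open>1 / tot\<close> to the 5 that the square costs. At time \<open>n\<close>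
  itself the square vanishes, so only the compensator is left.\<close>

lemma share_increment_moment:
  assumes l: "l \<in> L" and n: "n0 \<le> n" and m: "n \<le> m"
  shows "expectation (\<lambda>\<omega>. if alive m (path \<omega>) then (share (val m (path \<omega>)) l - share (val n (path \<omega>)) l)\<^sup>2 else 0)
    \<le> 20 * nverts\<^sup>2 * expectation (\<lambda>\<omega>. if alive n (path \<omega>) then 1 / tot (val n (path \<omega>)) (f l) else 0)"
proof -
  define \<phi> where "\<phi> h u = (share u l - share (val n h) l)\<^sup>2 + 20 * nverts\<^sup>2 * (1 / tot u (f l))" for h u
  have \<phi>: "adapted k (\<lambda>h. \<phi> h u)" if "n \<le> k" for k u
    unfolding \<phi>_def
    by (rule adapted_mono [OF adapted_comp [where g = "\<lambda>w. (share u l - share w l)\<^sup>2 + 20 * nverts\<^sup>2 * (1 / tot u (f l))",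
          OF adapted_val] that])
  have \<phi>_ge: "(share u l - share (val n h) l)\<^sup>2 \<le> \<phi> h u" if "\<And>l. l \<in> L \<Longrightarrow> 1 \<le> u l" for h u
    using tot_ge_1 [where u = u, OF that l] by (simp add: \<phi>_def)
  then have \<phi>_nonneg: "0 \<le> \<phi> h u" if "\<And>l. l \<in> L \<Longrightarrow> 1 \<le> u l" for h u
    using that by (meson order_trans zero_le_power2)
  let ?E = "\<lambda>m. expectation (\<lambda>\<omega>. if alive m (path \<omega>) then \<phi> (path \<omega>) (val m (path \<omega>)) else 0)"
  have "expectation (\<lambda>\<omega>. if alive m (path \<omega>) then (share (val m (path \<omega>)) l - share (val n (path \<omega>)) l)\<^sup>2 else 0) \<le> ?E m"
  proof (rule integral_mono)
    show "integrable M (\<lambda>\<omega>. if alive m (path \<omega>) then (share (val m (path \<omega>)) l - share (val n (path \<omega>)) l)\<^sup>2 else 0)"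
      using n m by (intro integrable_alive [where g = "\<lambda>h u. (share u l - share (val n h) l)\<^sup>2"]
        adapted_mono [OF adapted_comp [where g = "\<lambda>w. (share _ l - share w l)\<^sup>2", OF adapted_val]]) auto
    show "integrable M (\<lambda>\<omega>. if alive m (path \<omega>) then \<phi> (path \<omega>) (val m (path \<omega>)) else 0)"
      using n m by (intro integrable_alive \<phi>) auto
    show "(if alive m (path \<omega>) then (share (val m (path \<omega>)) l - share (val n (path \<omega>)) l)\<^sup>2 else 0)
        \<le> (if alive m (path \<omega>) then \<phi> (path \<omega>) (val m (path \<omega>)) else 0)" for \<omega>
      using \<phi>_ge [of "val m (path \<omega>)" "path \<omega>", OF weight_leaf_ge_1] by simp
  qed
  also have "?E m \<le> ?E n"
    using m
  proof (induction rule: dec_induct)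
    case (step k)
    have k: "n0 \<le> k" using n step by simp
    have "?E (Suc k) \<le> ?E k"
    proof (rule expectation_alive_step [OF k \<phi> [OF step(1)] \<phi>_nonneg _ \<phi> [OF step(1)]])
      fix h assume alive: "alive k h"
      let ?u = "val k h"
      note u = weight_leaf_ge_1 [of _ h k]
      have "gen (\<phi> h) ?u = gen (\<lambda>u. (share u l - share (val n h) l)\<^sup>2) ?u + 20 * nverts\<^sup>2 * gen (\<lambda>u. 1 / tot u (f l)) ?u"
        unfolding \<phi>_def gen_add gen_cmult ..
      also have "\<dots> \<le> 5 * nverts\<^sup>2 / (card S\<^sub>1 * (tot ?u (f l))\<^sup>2) + 20 * nverts\<^sup>2 * (- (1 / (4 * real (card S\<^sub>1) * (tot ?u (f l))\<^sup>2)))"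
      proof (intro add_mono mult_left_mono)
        show "gen (\<lambda>u. (share u l - share (val n h) l)\<^sup>2) ?u \<le> 5 * nverts\<^sup>2 / (card S\<^sub>1 * (tot ?u (f l))\<^sup>2)"
          by (rule gen_share_square_le [OF u l share_nonneg [OF weight_leaf_ge_1 l] share_le_1 [OF weight_leaf_ge_1 l]])
        show "gen (\<lambda>u. 1 / tot u (f l)) ?u \<le> - (1 / (4 * real (card S\<^sub>1) * (tot ?u (f l))\<^sup>2))"
          by (rule gen_inverse_tot_le [OF u l alive_tot [OF alive k l]])
      qed auto
      also have "\<dots> = 0" by simp
      finally show "\<phi> h ?u + gen (\<phi> h) ?u \<le> \<phi> h ?u" by simp
    qed auto
    then show ?case using step by simp
  qed simp
  also have "?E n = expectation (\<lambda>\<omega>. 20 * nverts\<^sup>2 * (if alive n (path \<omega>) then 1 / tot (val n (path \<omega>)) (f l) else 0))"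
    by (intro Bochner_Integration.integral_cong) (auto simp: \<phi>_def)
  also have "\<dots> = 20 * nverts\<^sup>2 * expectation (\<lambda>\<omega>. if alive n (path \<omega>) then 1 / tot (val n (path \<omega>)) (f l) else 0)"
    by (rule integral_mult_right_zero)
  finally show ?thesis .
qed

text \<open>The deviation behaves like a random walk with a small bias. Each step adds a bounded
  variance and the product of the deviation with the bias of the arrival rate, which is at most a
  multiple of \<open>1 + n / tot\<close>; its mean on \<open>alive n\<close> stays bounded by
  \<open>inverse_tot_moment\<close>.\<close>

lemma tot_deviation_moment:
  assumes k: "k \<in> L"
  shows "\<exists>C\<ge>0. \<forall>n\<ge>Suc n0. expectation (\<lambda>\<omega>. if alive n (path \<omega>) then (tot (val n (path \<omega>)) (f k) - n / card S\<^sub>1)\<^sup>2 else 0) \<le> C * n"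
proof -
  let ?N = "real (card S\<^sub>1)"
  have N: "1 \<le> ?N" by (rule N_ge)
  obtain C where C: "0 \<le> C"
    "\<And>n. n0 \<le> n \<Longrightarrow> n * expectation (\<lambda>\<omega>. if alive n (path \<omega>) then 1 / tot (val n (path \<omega>)) (f k) else 0) \<le> C"
    using inverse_tot_moment [OF k] by blast
  define E where "E n = expectation (\<lambda>\<omega>. if alive n (path \<omega>) then (tot (val n (path \<omega>)) (f k) - n / ?N)\<^sup>2 else 0)" for n
  define B where "B = 6 * nverts\<^sup>2 + 4 * nverts\<^sup>2 * C"
  have B: "0 \<le> B" using C by (simp add: B_def)
  have step: "E (Suc n) \<le> E n + B" if n: "n0 \<le> n" for n
  proof -
    let ?\<psi> = "\<lambda>u. (tot u (f k) - n / ?N)\<^sup>2 + (6 * nverts\<^sup>2 + 4 * nverts\<^sup>2 * (n * (1 / tot u (f k))))"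
    let ?i = "\<lambda>x \<omega>. if alive n (path \<omega>) then x else (0::real)"
    have "E (Suc n) \<le> expectation (\<lambda>\<omega>. if alive n (path \<omega>) then ?\<psi> (val n (path \<omega>)) else 0)"
      unfolding E_def
    proof (rule expectation_alive_step [OF n, where \<phi> = "\<lambda>h u. (tot u (f k) - Suc n / ?N)\<^sup>2" and \<psi> = "\<lambda>h. ?\<psi>"])
      fix h
      let ?t = "tot (val n h) (f k)" and ?q = "arrival (val n h) (f k)"
      have u: "1 \<le> val n h l" if "l \<in> L" for l by (rule weight_leaf_ge_1 [OF that])
      have t: "1 \<le> ?t" by (rule tot_ge_1 [OF u k])
      have q: "0 \<le> ?q" "?q \<le> 1 / ?N" "(1 - 2 * nverts\<^sup>2 / ?t) / ?N \<le> ?q"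
        using arrival_nonneg [where u = "val n h", OF u] arrival_le [where u = "val n h", OF u k]
          arrival_ge [where u = "val n h", OF u k] by blast+
      define \<delta> where "\<delta> = 1 / ?N"
      define D where "D = ?t - n / ?N"
      have \<delta>: "0 < \<delta>" "\<delta> \<le> 1" using N by (auto simp: \<delta>_def)
      have "(?t - Suc n / ?N)\<^sup>2 + gen (\<lambda>u. (tot u (f k) - Suc n / ?N)\<^sup>2) (val n h)
          = (D - \<delta>)\<^sup>2 + ?q * ((D - \<delta> + 1)\<^sup>2 - (D - \<delta>)\<^sup>2)"
        using gen_tot [where g = "\<lambda>t. (t - Suc n / ?N)\<^sup>2"] by (simp add: D_def \<delta>_def add_divide_distrib algebra_simps)
      also have "\<dots> = D\<^sup>2 + 2 * (D * (?q - \<delta>)) + (\<delta>\<^sup>2 + ?q * (1 - 2 * \<delta>))"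
        by (simp add: power2_eq_square algebra_simps)
      also have "\<dots> \<le> D\<^sup>2 + 2 * (2 * nverts\<^sup>2 * (1 + n * (1 / ?t))) + 2 * nverts\<^sup>2"
      proof (intro add_mono order_refl mult_left_mono)
        have "\<bar>?q - \<delta>\<bar> \<le> 2 * nverts\<^sup>2 / ?t * \<delta>"
          using q by (simp add: \<delta>_def abs_le_iff diff_divide_distrib)
        also have "\<dots> \<le> 2 * nverts\<^sup>2 / ?t * 1" using \<delta> t by (intro mult_left_mono) auto
        finally have qd: "\<bar>?q - \<delta>\<bar> \<le> 2 * nverts\<^sup>2 / ?t" by simp
        \<comment> \<open>The crude bound \<open>?t + n\<close> on the deviation is enough, since
          the bias is of order \<open>1 / ?t\<close>.\<close>
        have "real n / ?N \<le> real n / 1" using N by (intro divide_left_mono) auto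
        moreover have "0 \<le> real n / ?N" by simp
        ultimately have Dle: "\<bar>D\<bar> \<le> ?t + n" unfolding D_def abs_le_iff using t by linarith
        have "D * (?q - \<delta>) \<le> \<bar>D\<bar> * \<bar>?q - \<delta>\<bar>" by (simp add: abs_mult [symmetric])
        also have "\<dots> \<le> (?t + n) * (2 * nverts\<^sup>2 / ?t)" by (intro mult_mono Dle qd) (use t in auto)
        also have "\<dots> = 2 * nverts\<^sup>2 * (1 + n * (1 / ?t))" using t by (simp add: field_simps)
        finally show "D * (?q - \<delta>) \<le> 2 * nverts\<^sup>2 * (1 + n * (1 / ?t))" .
        have "\<delta>\<^sup>2 \<le> 1" using \<delta> by (simp add: power_le_one)
        moreover have "?q * (1 - 2 * \<delta>) \<le> ?q * 1"
          using q(1) \<delta> by (intro mult_left_mono) auto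
        moreover have "?q \<le> 1" using q(2) \<delta>(2) unfolding \<delta>_def by linarith
        moreover have "1 \<le> nverts\<^sup>2" using nverts_ge_1 by simp
        ultimately show "\<delta>\<^sup>2 + ?q * (1 - 2 * \<delta>) \<le> 2 * nverts\<^sup>2" by linarith
      qed auto
      also have "\<dots> = ?\<psi> (val n h)"
        by (simp add: D_def algebra_simps)
      finally show "(?t - Suc n / ?N)\<^sup>2 + gen (\<lambda>u. (tot u (f k) - Suc n / ?N)\<^sup>2) (val n h) \<le> ?\<psi> (val n h)" .
    qed (auto intro: adapted_const)
    also have "\<dots> \<le> expectation (\<lambda>\<omega>. (if alive n (path \<omega>) then (tot (val n (path \<omega>)) (f k) - n / ?N)\<^sup>2 else 0)
        + (6 * nverts\<^sup>2 + 4 * nverts\<^sup>2 * (n * (if alive n (path \<omega>) then 1 / tot (val n (path \<omega>)) (f k) else 0))))"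
    proof (rule integral_mono)
      show "integrable M (\<lambda>\<omega>. if alive n (path \<omega>) then ?\<psi> (val n (path \<omega>)) else 0)"
        by (rule integrable_alive [OF n, where g = "\<lambda>h. ?\<psi>", OF adapted_const])
      show "integrable M (\<lambda>\<omega>. (if alive n (path \<omega>) then (tot (val n (path \<omega>)) (f k) - n / ?N)\<^sup>2 else 0)
        + (6 * nverts\<^sup>2 + 4 * nverts\<^sup>2 * (n * (if alive n (path \<omega>) then 1 / tot (val n (path \<omega>)) (f k) else 0))))"
        by (intro Bochner_Integration.integrable_add integrable_const integrable_mult_right
            integrable_alive [OF n, where g = "\<lambda>h u. (tot u (f k) - n / ?N)\<^sup>2", OF adapted_const]
            integrable_alive [OF n, where g = "\<lambda>h u. 1 / tot u (f k)", OF adapted_const])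
    qed auto
    also have "\<dots> = E n + (6 * nverts\<^sup>2 + 4 * nverts\<^sup>2 * (n * expectation (\<lambda>\<omega>. if alive n (path \<omega>) then 1 / tot (val n (path \<omega>)) (f k) else 0)))"
      using integrable_alive [OF n, where g = "\<lambda>h u. (tot u (f k) - n / ?N)\<^sup>2", OF adapted_const]
        integrable_alive [OF n, where g = "\<lambda>h u. 1 / tot u (f k)", OF adapted_const]
      by (simp add: E_def prob_space)
    also have "\<dots> \<le> E n + B"
      unfolding B_def by (intro add_mono order_refl mult_left_mono C(2) n) auto
    finally show ?thesis .
  qed
  have E_nonneg: "0 \<le> E n" for n
    unfolding E_def by (intro Bochner_Integration.integral_nonneg) auto
  have bound: "E (n0 + i) \<le> E n0 + B * i" for i
  proof (induction i)
    case (Suc i)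
    then show ?case using step [of "n0 + i"] by (simp add: algebra_simps)
  qed simp
  \<comment> \<open>\<open>Suc n0 \<le> n\<close> gives \<open>1 \<le> n\<close>, which absorbs the
    initial value \<open>E n0\<close> into a bound linear in \<open>n\<close>.\<close>
  have "E n \<le> (E n0 + B) * n" if n: "Suc n0 \<le> n" for n
  proof -
    have "E n0 * 1 \<le> E n0 * n" using n E_nonneg by (intro mult_left_mono) auto
    moreover have "B * real (n - n0) \<le> B * n" using B by (intro mult_left_mono) auto
    ultimately show ?thesis using bound [of "n - n0"] n by (simp add: algebra_simps)
  qed
  moreover have "0 \<le> E n0 + B" using B E_nonneg [of n0] by simp
  ultimately show ?thesis unfolding E_def [symmetric] by blast
qed

text \<open>The weight over \<open>n\<close> is the share times \<open>tot / n\<close>. Along a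
  subsequence the share converges because its increments are summable, with a limit of at least
  \<open>1 / (4 * nverts)\<close> inherited from \<open>alive\<close>, and \<open>tot / n\<close>
  tends to \<open>1 / card S\<^sub>1\<close>.\<close>

lemma AE_alive_leaf_limit:
  assumes l: "l \<in> L"
  shows "AE \<omega> in M. (\<forall>n\<ge>n0. alive n (path \<omega>)) \<longrightarrow> (\<exists>y>0. (\<lambda>n. val n (path \<omega>) l / n) \<longlonglongrightarrow> y)"
proof -
  let ?c = "real (card S\<^sub>1)"
  \<comment> \<open>Along this subsequence the moment bounds are summable even after taking square roots, and the
    ratio of consecutive terms tends to 1, so that monotonicity of the weights fills the gaps.\<close>
  define N where "N k = (n0 + k + 1) ^ 4" for k
  have N_ge: "Suc n0 \<le> N k" for k
    using self_le_power [of "n0 + k + 1" 4] by (simp add: N_def)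
  have N_ge4: "(real k + 1) ^ 4 \<le> N k" for k
    unfolding N_def of_nat_power by (rule power_mono) auto
  have N_mono: "strict_mono N"
    by (rule strict_monoI) (auto simp: N_def intro: power_strict_mono)
  have N_pos: "0 < N k" for k by (simp add: N_def)
  have n0_le: "n0 \<le> N k" for k using N_ge [of k] by simp
  obtain C1 where C1: "0 \<le> C1"
    "\<And>n. n0 \<le> n \<Longrightarrow> n * expectation (\<lambda>\<omega>. if alive n (path \<omega>) then 1 / tot (val n (path \<omega>)) (f l) else 0) \<le> C1"
    using inverse_tot_moment [OF l] by blast
  obtain C2 where C2: "0 \<le> C2"
    "\<And>n. Suc n0 \<le> n \<Longrightarrow> expectation (\<lambda>\<omega>. if alive n (path \<omega>) then (tot (val n (path \<omega>)) (f l) - n / ?c)\<^sup>2 else 0) \<le> C2 * n"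
    using tot_deviation_moment [OF l] by blast
  define X where "X k \<omega> = (if alive (N (Suc k)) (path \<omega>)
    then \<bar>share (val (N (Suc k)) (path \<omega>)) l - share (val (N k) (path \<omega>)) l\<bar> else 0)" for k \<omega>
  define Z where "Z k \<omega> = (if alive (N (Suc k)) (path \<omega>)
    then (share (val (N (Suc k)) (path \<omega>)) l - share (val (N k) (path \<omega>)) l)\<^sup>2 else 0)" for k \<omega>
  define Y where "Y k \<omega> = (if alive (N k) (path \<omega>)
    then (tot (val (N k) (path \<omega>)) (f l) / N k - 1 / ?c)\<^sup>2 else 0)" for k \<omega>
  note int = integrable_alive
  have ad: "adapted (N (Suc k)) (\<lambda>h. g u (share (val (N k) h) l))" for k u and g :: "('a \<Rightarrow> real) \<Rightarrow> real \<Rightarrow> real"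
    by (rule adapted_mono [OF adapted_comp [where g = "\<lambda>w. g u (share w l)", OF adapted_val]])
      (use N_mono in \<open>simp add: strict_mono_less_eq\<close>)
  have intX: "integrable M (X k)" and intZ: "integrable M (Z k)" and intY: "integrable M (Y k)" for k
    unfolding X_def Z_def Y_def
    using int [OF n0_le, where g = "\<lambda>h u. \<bar>share u l - share (val (N k) h) l\<bar>", OF ad [of k "\<lambda>u x. \<bar>share u l - x\<bar>"]]
      int [OF n0_le, where g = "\<lambda>h u. (share u l - share (val (N k) h) l)\<^sup>2", OF ad [of k "\<lambda>u x. (share u l - x)\<^sup>2"]]
      int [OF n0_le, where g = "\<lambda>h u. (tot u (f l) / N k - 1 / ?c)\<^sup>2", OF adapted_const]
    by blast+
  have EX: "expectation (X k) \<le> (20 * nverts\<^sup>2 * C1 + 1) / (real k + 1)\<^sup>2" for k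
  proof -
    \<comment> \<open>The inequality \<open>amgm\<close> converts second moments into first ones.
      The exponent 4 in \<open>N\<close> serves this purpose: \<open>a\<^sup>2 \<le> N k\<close>
      makes the second moment of order \<open>1 / a\<^sup>2\<close>, so that both terms are of the
      summable order \<open>1 / a\<close>.\<close>
    define a where "a = (real k + 1)\<^sup>2"
    have a: "0 < a" by (simp add: a_def)
    have amgm: "\<bar>z\<bar> \<le> a * z\<^sup>2 + 1 / a" for z
    proof -
      have "0 \<le> (a * \<bar>z\<bar> - 1)\<^sup>2" by simp
      then have "2 * (a * \<bar>z\<bar>) \<le> a * (a * z\<^sup>2) + 1"
        by (simp add: power2_eq_square algebra_simps flip: abs_mult)
      moreover have "0 \<le> a * \<bar>z\<bar>" using a by simp
      ultimately have "a * \<bar>z\<bar> \<le> a * (a * z\<^sup>2) + 1" by linarith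
      also have "\<dots> = a * (a * z\<^sup>2 + 1 / a)" using a by (simp add: distrib_left)
      finally have "a * \<bar>z\<bar> \<le> a * (a * z\<^sup>2 + 1 / a)" .
      then show ?thesis using a by simp
    qed
    have "expectation (X k) \<le> expectation (\<lambda>\<omega>. a * Z k \<omega> + 1 / a)"
    proof (rule integral_mono [OF intX])
      show "integrable M (\<lambda>\<omega>. a * Z k \<omega> + 1 / a)" using intZ by simp
      show "X k \<omega> \<le> a * Z k \<omega> + 1 / a" for \<omega>
        using amgm a by (simp add: X_def Z_def)
    qed
    also have "\<dots> = a * expectation (Z k) + 1 / a"
      using intZ by (simp add: prob_space)
    also have "\<dots> \<le> a * (20 * nverts\<^sup>2 * (C1 / a\<^sup>2)) + 1 / a"
    proof -
      have "expectation (Z k) \<le> 20 * nverts\<^sup>2 * expectation (\<lambda>\<omega>. if alive (N k) (path \<omega>) then 1 / tot (val (N k) (path \<omega>)) (f l) else 0)"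
        unfolding Z_def by (rule share_increment_moment [OF l n0_le])
          (use N_mono in \<open>simp add: strict_mono_less_eq\<close>)
      also have "\<dots> \<le> 20 * nverts\<^sup>2 * (C1 / N k)"
        using C1(2) [OF n0_le, of k] N_pos [of k]
        by (intro mult_left_mono) (simp_all add: pos_le_divide_eq mult.commute)
      also have "\<dots> \<le> 20 * nverts\<^sup>2 * (C1 / a\<^sup>2)"
        using N_ge4 [of k] C1 by (intro mult_left_mono divide_left_mono) (auto simp: a_def N_pos simp flip: power_mult)
      finally show ?thesis using a by (intro add_mono mult_left_mono) auto
    qed
    also have "a * (20 * nverts\<^sup>2 * (C1 / a\<^sup>2)) + 1 / a = (20 * nverts\<^sup>2 * C1 + 1) / a"
      using a by (simp add: power2_eq_square add_divide_distrib)
    finally show ?thesis using a by (simp add: a_def)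
  qed
  have EY: "expectation (Y k) \<le> C2 / (real k + 1)\<^sup>2" for k
  proof -
    have "Y k = (\<lambda>\<omega>. (if alive (N k) (path \<omega>) then (tot (val (N k) (path \<omega>)) (f l) - N k / ?c)\<^sup>2 else 0) * (1 / (real (N k))\<^sup>2))"
    proof
      fix \<omega>
      have "(t / N k - 1 / ?c)\<^sup>2 = (t - N k / ?c)\<^sup>2 * (1 / (real (N k))\<^sup>2)" for t
      proof -
        have "t / N k - 1 / ?c = (t - N k / ?c) / N k"
          using N_pos [of k] by (simp add: diff_divide_distrib)
        then show ?thesis by (simp add: power_divide)
      qed
      then show "Y k \<omega> = (if alive (N k) (path \<omega>) then (tot (val (N k) (path \<omega>)) (f l) - N k / ?c)\<^sup>2 else 0) * (1 / (real (N k))\<^sup>2)"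
        by (simp add: Y_def)
    qed
    then have "expectation (Y k) = expectation (\<lambda>\<omega>. if alive (N k) (path \<omega>) then (tot (val (N k) (path \<omega>)) (f l) - N k / ?c)\<^sup>2 else 0) * (1 / (real (N k))\<^sup>2)"
      by (simp only: integral_mult_left_zero)
    also have "\<dots> \<le> (C2 * N k) * (1 / (real (N k))\<^sup>2)"
      by (intro mult_right_mono C2(2) N_ge) auto
    also have "\<dots> = C2 / N k" using N_pos [of k] by (simp add: power2_eq_square)
    also have "\<dots> \<le> C2 / (real k + 1)\<^sup>2"
    proof (intro divide_left_mono C2)
      have "(real k + 1)\<^sup>2 \<le> (real k + 1) ^ 4" by (rule power_increasing) auto
      then show "(real k + 1)\<^sup>2 \<le> N k" using N_ge4 [of k] by linarith
    qed (simp add: N_pos)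
    finally show ?thesis .
  qed
  have inv2: "summable (\<lambda>k. c / (real k + 1)\<^sup>2)" for c :: real
  proof -
    have "summable (\<lambda>k. inverse (real (Suc k) ^ 2))"
      by (subst summable_Suc_iff) (rule inverse_power_summable, simp)
    then show ?thesis
      by (simp add: divide_inverse summable_mult add.commute)
  qed
  have "AE \<omega> in M. summable (\<lambda>k. X k \<omega>)"
    by (rule AE_summable_of_expectation_le [OF intX _ EX inv2]) (simp add: X_def)
  moreover have "AE \<omega> in M. summable (\<lambda>k. Y k \<omega>)"
    by (rule AE_summable_of_expectation_le [OF intY _ EY inv2]) (simp add: Y_def)
  ultimately show ?thesis
  proof eventually_elim
    case (elim \<omega>)
    let ?u = "\<lambda>n. val n (path \<omega>)"
    show ?case
    proof
      assume "\<forall>n\<ge>n0. alive n (path \<omega>)"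
      then have alive: "alive (N k) (path \<omega>)" for k using n0_le by simp
      have "convergent (\<lambda>k. share (?u (N k)) l)"
        by (rule convergent_if_summable_increments) (use elim(1) alive in \<open>simp add: X_def\<close>)
      then obtain s where s: "(\<lambda>k. share (?u (N k)) l) \<longlonglongrightarrow> s"
        by (auto simp: convergent_def)
      have "1 / (4 * nverts) \<le> s"
        by (rule LIMSEQ_le_const [OF s]) (use alive_share [OF alive n0_le l] in auto)
      then have s_pos: "0 < s" using nverts_ge_1 by (intro less_le_trans [of 0 "1 / (4 * nverts)" s]) auto
      have "(\<lambda>k. (tot (?u (N k)) (f l) / N k - 1 / ?c)\<^sup>2) \<longlonglongrightarrow> 0"
        using summable_LIMSEQ_zero [OF elim(2)] alive by (simp add: Y_def)
      then have "(\<lambda>k. sqrt ((tot (?u (N k)) (f l) / N k - 1 / ?c)\<^sup>2)) \<longlonglongrightarrow> sqrt 0"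
        by (rule tendsto_real_sqrt)
      then have "(\<lambda>k. tot (?u (N k)) (f l) / N k - 1 / ?c) \<longlonglongrightarrow> 0"
        by (simp add: tendsto_rabs_zero_iff)
      then have t: "(\<lambda>k. tot (?u (N k)) (f l) / N k) \<longlonglongrightarrow> 1 / ?c"
        by (simp add: LIM_zero_iff)
      have "(\<lambda>k. share (?u (N k)) l * (tot (?u (N k)) (f l) / N k)) \<longlonglongrightarrow> s * (1 / ?c)"
        by (intro tendsto_mult s t)
      moreover have "share (?u n) l * (tot (?u n) (f l) / m) = ?u n l / m" for n m
        using tot_ge_1 [where u = "?u n", OF weight_leaf_ge_1 l] by (simp add: share_def)
      ultimately have lim: "(\<lambda>k. ?u (N k) l / N k) \<longlonglongrightarrow> s * (1 / ?c)" by (simp only:)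
      have ratio: "(\<lambda>k. real (N (Suc k)) / real (N k)) \<longlonglongrightarrow> 1"
      proof -
        have "(\<lambda>k. 1 + inverse (real (Suc k))) \<longlonglongrightarrow> 1"
          using tendsto_add [OF tendsto_const [of "1::real"] LIMSEQ_inverse_real_of_nat] by simp
        from filterlim_compose [OF this filterlim_add_const_nat_at_top [of n0]]
        have "(\<lambda>k. (1 + inverse (real (Suc (k + n0)))) ^ 4) \<longlonglongrightarrow> 1 ^ 4"
          by (intro tendsto_power)
        moreover have "(1 + inverse (real (Suc (k + n0)))) ^ 4 = real (N (Suc k)) / real (N k)" for k
        proof -
          have "1 + inverse (real (Suc (k + n0))) = real (n0 + Suc k + 1) / real (n0 + k + 1)"
            by (simp add: field_simps)
          then show ?thesis by (simp only: N_def of_nat_power power_divide)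
        qed
        ultimately show ?thesis by simp
      qed
      \<comment> \<open>The share itself is not monotone; the weight is, and is therefore the
        quantity that gets interpolated.\<close>
      have "(\<lambda>n. ?u n l / n) \<longlonglongrightarrow> s * (1 / ?c)"
        by (rule tendsto_mono_interpolation [OF _ _ N_mono N_pos ratio lim])
          (auto intro: val_mono order_trans [OF zero_le_one weight_leaf_ge_1 [OF l]])
      moreover have "0 < s * (1 / ?c)" using s_pos card_states_pos by simp
      ultimately show "\<exists>y>0. (\<lambda>n. ?u n l / n) \<longlonglongrightarrow> y" by blast
    qed
  qed
qed

end

end

section \<open>Graphs with property (P) are unions of stars\<close>

lemma bipartite_graph_edge:
  assumes "bipartite_graph S\<^sub>1 S\<^sub>2 G" "{u, v} \<in> G"
  shows "u \<in> S\<^sub>1 \<and> v \<in> S\<^sub>2 \<or> u \<in> S\<^sub>2 \<and> v \<in> S\<^sub>1"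
proof -
  obtain i j where "i \<in> S\<^sub>1" "j \<in> S\<^sub>2" "{u, v} = {i, j}"
    using assms unfolding bipartite_graph_def by blast
  then show ?thesis by (auto simp: doubleton_eq_iff)
qed

text \<open>The component of \<open>i\<close> contains all neighbours of \<open>i\<close> and, by
  paths through \<open>j\<close>, all neighbours of \<open>j\<close>. Whichever side of the
  component is a singleton, the endpoint on the other side has only one neighbour.\<close>

lemma property_P_leaf:
  assumes G: "bipartite_graph S\<^sub>1 S\<^sub>2 G" and P: "property_P S\<^sub>1 S\<^sub>2 G" and disj: "S\<^sub>1 \<inter> S\<^sub>2 = {}"
    and ij: "{i, j} \<in> G" and i: "i \<in> S\<^sub>1" and j: "j \<in> S\<^sub>2"
  shows "(\<forall>j'. {i, j'} \<in> G \<longrightarrow> j' = j) \<or> (\<forall>i'. {i', j} \<in> G \<longrightarrow> i' = i)"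
proof -
  let ?E = "{(u, v). {u, v} \<in> G}"
  let ?R = "{(u, v) \<in> (S\<^sub>1 \<union> S\<^sub>2) \<times> (S\<^sub>1 \<union> S\<^sub>2). (u, v) \<in> ?E\<^sup>*}"
  let ?C = "?R `` {i}"
  have opposite: "v \<in> S\<^sub>2" if "{u, v} \<in> G" "u \<in> S\<^sub>1" for u v
    using bipartite_graph_edge [OF G that(1)] that(2) disj by blast
  have opposite': "u \<in> S\<^sub>1" if "{u, v} \<in> G" "v \<in> S\<^sub>2" for u v
    using bipartite_graph_edge [OF G that(1)] that(2) disj by blast
  have "?C \<in> connected_components (S\<^sub>1 \<union> S\<^sub>2) G"
    unfolding connected_components_def by (rule quotientI) (use i in simp)
  then have "is_singleton (?C \<inter> S\<^sub>1) \<or> is_singleton (?C \<inter> S\<^sub>2)"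
    using P by (simp add: property_P_def)
  then show ?thesis
  proof
    assume "is_singleton (?C \<inter> S\<^sub>1)"
    then obtain a where a: "?C \<inter> S\<^sub>1 = {a}" by (auto simp: is_singleton_def)
    have mem: "i' \<in> ?C \<inter> S\<^sub>1" if "{i', j} \<in> G" for i'
    proof -
      have "(i, j) \<in> ?E\<^sup>*" "(j, i') \<in> ?E" using ij that by (auto simp: insert_commute)
      then have "(i, i') \<in> ?E\<^sup>*" by (rule rtrancl_into_rtrancl)
      then show ?thesis using i opposite' [OF that j] by auto
    qed
    have "i' = i" if "{i', j} \<in> G" for i'
      using mem [OF that] mem [OF ij] unfolding a by simp
    then show ?thesis by blast
  next
    assume "is_singleton (?C \<inter> S\<^sub>2)"
    then obtain b where b: "?C \<inter> S\<^sub>2 = {b}" by (auto simp: is_singleton_def)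
    have mem: "j' \<in> ?C \<inter> S\<^sub>2" if "{i, j'} \<in> G" for j'
      using that i opposite [OF that i] by auto
    have "j' = j" if "{i, j'} \<in> G" for j'
      using mem [OF that] mem [OF ij] unfolding b by simp
    then show ?thesis by blast
  qed
qed

text \<open>
  A component with a single edge has no distinguished center; its state is taken as the center.
\<close>

lemma star_decomposition:
  assumes G: "bipartite_graph S\<^sub>1 S\<^sub>2 G" and P: "property_P S\<^sub>1 S\<^sub>2 G" and disj: "S\<^sub>1 \<inter> S\<^sub>2 = {}"
  obtains L f where "L \<subseteq> S\<^sub>1 \<union> S\<^sub>2"
    "\<And>l. l \<in> L \<Longrightarrow> l \<in> S\<^sub>1 \<Longrightarrow> f l \<in> S\<^sub>2 - L"
    "\<And>l. l \<in> L \<Longrightarrow> l \<in> S\<^sub>2 \<Longrightarrow> f l \<in> S\<^sub>1 - L"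
    "\<And>a. a \<in> S\<^sub>1 \<union> S\<^sub>2 \<Longrightarrow> a \<notin> L \<Longrightarrow> \<exists>l\<in>L. f l = a"
    "\<And>i j. i \<in> S\<^sub>1 \<Longrightarrow> j \<in> S\<^sub>2 \<Longrightarrow> {i, j} \<in> G \<longleftrightarrow> i \<in> L \<and> f i = j \<or> j \<in> L \<and> f j = i"
proof -
  define adj where "adj u v \<longleftrightarrow> {u, v} \<in> G" for u v
  define deg1 where "deg1 v \<longleftrightarrow> (\<forall>w w'. adj v w \<longrightarrow> adj v w' \<longrightarrow> w = w')" for v
  \<comment> \<open>Together with \<open>nbr\<close> below, \<open>deg1\<close> means exactly one
    neighbour. The excluded states are those whose component is a single edge.\<close>
  define L where "L = {v \<in> S\<^sub>1 \<union> S\<^sub>2. deg1 v \<and> \<not> (v \<in> S\<^sub>1 \<and> (\<forall>w. adj v w \<longrightarrow> deg1 w))}"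
  define f where "f v = (SOME w. adj v w)" for v
  have sym: "adj v u" if "adj u v" for u v using that by (simp add: adj_def insert_commute)
  have opp1: "v \<in> S\<^sub>2" "v \<notin> S\<^sub>1" if "adj u v" "u \<in> S\<^sub>1" for u v
    using bipartite_graph_edge [OF G that(1) [unfolded adj_def]] that(2) disj by blast+
  have opp2: "v \<in> S\<^sub>1" "v \<notin> S\<^sub>2" if "adj u v" "u \<in> S\<^sub>2" for u v
    using bipartite_graph_edge [OF G that(1) [unfolded adj_def]] that(2) disj by blast+
  have nbr: "\<exists>w. adj v w" if v: "v \<in> S\<^sub>1 \<union> S\<^sub>2" for v
  proof -
    obtain e where "e \<in> G" "v \<in> e" using P v by (auto simp: property_P_def)
    then obtain i j where "e = {i, j}" using G by (auto simp: bipartite_graph_def)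
    then show ?thesis using \<open>e \<in> G\<close> \<open>v \<in> e\<close> by (auto simp: adj_def insert_commute)
  qed
  have f: "adj v (f v)" if "v \<in> S\<^sub>1 \<union> S\<^sub>2" for v
    unfolding f_def by (rule someI_ex [OF nbr [OF that]])
  have f_eq: "f v = w" if "deg1 v" "adj v w" for v w
    unfolding f_def by (rule some_equality) (use that in \<open>auto simp: deg1_def\<close>)
  have leaf': "deg1 i \<or> deg1 j" if "adj i j" "i \<in> S\<^sub>1" for i j
    using property_P_leaf [OF G P disj that(1) [unfolded adj_def] that(2) opp1(1) [OF that]] sym
    unfolding deg1_def adj_def by blast
  have leaf: "deg1 u \<or> deg1 v" if "adj u v" "u \<in> S\<^sub>1 \<union> S\<^sub>2" for u v
    using leaf' [OF that(1)] leaf' [OF sym [OF that(1)]] opp2(1) [OF that(1)] that(2) by blast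
  show thesis
  proof
    show "L \<subseteq> S\<^sub>1 \<union> S\<^sub>2" by (auto simp: L_def)
    show "f l \<in> S\<^sub>2 - L" if l: "l \<in> L" "l \<in> S\<^sub>1" for l
    proof -
      have a: "adj l (f l)" using f l by blast
      obtain w where "deg1 l" "adj l w" "\<not> deg1 w" using l by (auto simp: L_def)
      then have "f l \<notin> L" using f_eq [of l w] by (simp add: L_def)
      then show ?thesis using opp1(1) [OF a l(2)] by simp
    qed
    show "f l \<in> S\<^sub>1 - L" if l: "l \<in> L" "l \<in> S\<^sub>2" for l
    proof -
      have a: "adj l (f l)" using f l by blast
      have "f l \<notin> L"
      proof
        assume "f l \<in> L"
        then obtain w where w: "deg1 (f l)" "adj (f l) w" "\<not> deg1 w"
          using opp2(1) [OF a l(2)] by (auto simp: L_def)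
        then have "w = l" using sym [OF a] unfolding deg1_def by blast
        then show False using w l by (simp add: L_def)
      qed
      then show ?thesis using opp2(1) [OF a l(2)] by simp
    qed
    show "\<exists>l\<in>L. f l = a" if a: "a \<in> S\<^sub>1 \<union> S\<^sub>2" "a \<notin> L" for a
    proof -
      obtain w where w: "adj a w" using nbr a by blast
      have wS: "w \<in> S\<^sub>1 \<union> S\<^sub>2" using opp1(1) [OF w] opp2(1) [OF w] a(1) by blast
      \<comment> \<open>If \<open>a\<close> has degree one, it is an excluded state, and its
        neighbour is a signal of degree one. Otherwise the edge to \<open>w\<close> must have its
        end of degree one at \<open>w\<close>.\<close>
      have "deg1 w \<and> w \<in> L"
      proof (cases "deg1 a")
        case True
        then have "a \<in> S\<^sub>1" "deg1 w" using a w unfolding L_def by blast+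
        then show ?thesis using opp1(2) [OF w] wS unfolding L_def by blast
      next
        case False
        then have "deg1 w" using leaf [OF w a(1)] by simp
        then show ?thesis using wS False sym [OF w] unfolding L_def by blast
      qed
      then show ?thesis using f_eq [OF _ sym [OF w]] by blast
    qed
    show "{i, j} \<in> G \<longleftrightarrow> i \<in> L \<and> f i = j \<or> j \<in> L \<and> f j = i" if i: "i \<in> S\<^sub>1" and j: "j \<in> S\<^sub>2" for i j
    proof
      assume "{i, j} \<in> G"
      then have ij: "adj i j" "adj j i" using sym by (unfold adj_def) blast+
      have "i \<in> L \<or> j \<in> L"
        using leaf' [OF ij(1) i] opp1(2) [OF ij(1) i] i j ij unfolding L_def by blast
      moreover have "deg1 v" if "v \<in> L" for v using that by (simp add: L_def)
      ultimately show "i \<in> L \<and> f i = j \<or> j \<in> L \<and> f j = i"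
        using f_eq [OF _ ij(1)] f_eq [OF _ ij(2)] by blast
    next
      assume "i \<in> L \<and> f i = j \<or> j \<in> L \<and> f j = i"
      then show "{i, j} \<in> G"
        using f [of i] sym [OF f [of j]] i j unfolding adj_def by blast
    qed
  qed
qed

section \<open>Measurability and conclusion\<close>

lemma bipartite_edge_unique:
  assumes "S\<^sub>1 \<inter> S\<^sub>2 = {}" "i \<in> S\<^sub>1" "j \<in> S\<^sub>2" "i' \<in> S\<^sub>1" "j' \<in> S\<^sub>2" "{i, j} = {i', j'}"
  shows "i' = i \<and> j' = j"
  using assms by (auto simp: doubleton_eq_iff)

context signaling_process
begin

section \<open>Measurability of the limits\<close>

lemma measurable_weight [measurable]: "(\<lambda>\<omega>. weight (path \<omega>) n i j) \<in> borel_measurable M"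
  using integrable_adapted [OF adapted_comp [where g = "\<lambda>w. w i j", OF adapted_weight]]
  by (rule borel_measurable_integrable)

lemma measurable_V [measurable]: "(\<lambda>\<omega>. V S\<^sub>1 S\<^sub>2 (path \<omega>) n i j) \<in> borel_measurable M"
  unfolding V_def by measurable

lemma measurable_proportion [measurable]:
  "(\<lambda>\<omega>. proportion S\<^sub>1 S\<^sub>2 (path \<omega>) n i j) \<in> borel_measurable M"
  unfolding proportion_def total_weight_def by measurable

lemma measurable_V_infinity [measurable]:
  "(\<lambda>\<omega>. V_infinity S\<^sub>1 S\<^sub>2 (path \<omega>) i j) \<in> borel_measurable M"
  unfolding V_infinity_def by measurable

lemma sets_proportion_limit:
  "{\<omega> \<in> space M. convergent (\<lambda>n. proportion S\<^sub>1 S\<^sub>2 (path \<omega>) n i j)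
     \<and> (0 < lim (\<lambda>n. proportion S\<^sub>1 S\<^sub>2 (path \<omega>) n i j) \<longleftrightarrow> Q)} \<in> sets M"
proof (rule sets.sets_Collect_conj)
  show "{\<omega> \<in> space M. convergent (\<lambda>n. proportion S\<^sub>1 S\<^sub>2 (path \<omega>) n i j)} \<in> sets M"
    unfolding Cauchy_convergent_iff [symmetric] by (rule sets_Collect_Cauchy) (rule measurable_proportion)
  have "(\<lambda>\<omega>. lim (\<lambda>n. proportion S\<^sub>1 S\<^sub>2 (path \<omega>) n i j)) \<in> borel_measurable M"
    by (rule borel_measurable_lim_metric) (rule measurable_proportion)
  then show "{\<omega> \<in> space M. 0 < lim (\<lambda>n. proportion S\<^sub>1 S\<^sub>2 (path \<omega>) n i j) \<longleftrightarrow> Q} \<in> sets M"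
    by measurable
qed

lemma sets_V_infinity: "{\<omega> \<in> space M. V_infinity S\<^sub>1 S\<^sub>2 (path \<omega>) i j = \<infinity> \<longleftrightarrow> Q} \<in> sets M"
  by measurable

lemma V_sym: "V S\<^sub>1 S\<^sub>2 h n i j = V S\<^sub>1 S\<^sub>2 h n j i"
  using disjoint by (auto simp: V_def)

lemma V_same_part: "i \<in> S\<^sub>1 \<and> j \<in> S\<^sub>1 \<or> i \<in> S\<^sub>2 \<and> j \<in> S\<^sub>2 \<Longrightarrow> V S\<^sub>1 S\<^sub>2 h n i j = 0"
  using disjoint by (auto simp: V_def)

lemma proportion_sym: "proportion S\<^sub>1 S\<^sub>2 h n i j = proportion S\<^sub>1 S\<^sub>2 h n j i"
  by (simp add: proportion_def V_sym [of h n i j])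

lemma total_weight_eq: "total_weight S\<^sub>1 S\<^sub>2 h n = (\<Sum>i\<in>S\<^sub>1. \<Sum>j\<in>S\<^sub>2. weight h n i j)"
  unfolding total_weight_def by (intro sum.cong refl) (simp add: V_def)

lemma total_weight_pos: "0 < total_weight S\<^sub>1 S\<^sub>2 h n"
  unfolding total_weight_eq
  using finite_states states_nonempty by (rule sum_pos) (rule row_sum_pos)

lemma proportion_nonneg: "0 \<le> proportion S\<^sub>1 S\<^sub>2 h n i j"
  using total_weight_pos [of h n] less_imp_le [OF weight_pos]
  by (auto simp: proportion_def V_def intro!: divide_nonneg_pos)

lemma sum_proportion: "(\<Sum>i\<in>S\<^sub>1. \<Sum>j\<in>S\<^sub>2. proportion S\<^sub>1 S\<^sub>2 h n i j) = 1"
  using total_weight_pos [of h n]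
  by (simp add: proportion_def sum_divide_distrib [symmetric]) (simp add: total_weight_def)

text \<open>An existential quantifier over limit arrays does not display a measurable event, whereas
  \<open>convergent\<close> and \<open>lim\<close> of finitely many entries do. These entries
  determine the array, and it lies in \<open>Delta\<close> because the finite sum of the proportions
  passes to the limit.\<close>

lemma Delta_limit_iff:
  assumes G: "bipartite_graph S\<^sub>1 S\<^sub>2 G"
  shows "(\<exists>x\<in>Delta S\<^sub>1 S\<^sub>2. (\<forall>i\<in>S\<^sub>1 \<union> S\<^sub>2. \<forall>j\<in>S\<^sub>1 \<union> S\<^sub>2. (\<lambda>n. proportion S\<^sub>1 S\<^sub>2 h n i j) \<longlonglongrightarrow> x i j) \<and>
        graph_of S\<^sub>1 S\<^sub>2 x = G)
    \<longleftrightarrow> (\<forall>i\<in>S\<^sub>1. \<forall>j\<in>S\<^sub>2. convergent (\<lambda>n. proportion S\<^sub>1 S\<^sub>2 h n i j)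
        \<and> (0 < lim (\<lambda>n. proportion S\<^sub>1 S\<^sub>2 h n i j) \<longleftrightarrow> {i, j} \<in> G))"
    (is "?L \<longleftrightarrow> ?R")
proof
  assume ?L
  then obtain x where lim: "\<And>i j. i \<in> S\<^sub>1 \<union> S\<^sub>2 \<Longrightarrow> j \<in> S\<^sub>1 \<union> S\<^sub>2 \<Longrightarrow> (\<lambda>n. proportion S\<^sub>1 S\<^sub>2 h n i j) \<longlonglongrightarrow> x i j"
    and x: "graph_of S\<^sub>1 S\<^sub>2 x = G" by blast
  show ?R
  proof (intro ballI conjI)
    fix i j assume i: "i \<in> S\<^sub>1" and j: "j \<in> S\<^sub>2"
    have l: "(\<lambda>n. proportion S\<^sub>1 S\<^sub>2 h n i j) \<longlonglongrightarrow> x i j" using lim i j by simp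
    show "convergent (\<lambda>n. proportion S\<^sub>1 S\<^sub>2 h n i j)" by (rule convergentI [OF l])
    have "{i, j} \<in> G \<longleftrightarrow> (\<exists>i' j'. {i, j} = {i', j'} \<and> i' \<in> S\<^sub>1 \<and> j' \<in> S\<^sub>2 \<and> 0 < x i' j')"
      unfolding x [symmetric] graph_of_def by blast
    also have "\<dots> \<longleftrightarrow> 0 < x i j"
      using bipartite_edge_unique [OF disjoint i j] i j by blast
    finally show "0 < lim (\<lambda>n. proportion S\<^sub>1 S\<^sub>2 h n i j) \<longleftrightarrow> {i, j} \<in> G"
      by (simp add: limI [OF l])
  qed
next
  assume R: ?R
  define y where "y i j = lim (\<lambda>n. proportion S\<^sub>1 S\<^sub>2 h n i j)" for i j
  define x where "x i j = (if i \<in> S\<^sub>1 \<and> j \<in> S\<^sub>2 then y i j else if i \<in> S\<^sub>2 \<and> j \<in> S\<^sub>1 then y j i else 0)" for i j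
  have y: "(\<lambda>n. proportion S\<^sub>1 S\<^sub>2 h n i j) \<longlonglongrightarrow> y i j" if "i \<in> S\<^sub>1" "j \<in> S\<^sub>2" for i j
    unfolding y_def using R that by (intro convergent_LIMSEQ_iff [THEN iffD1]) blast
  have y_nonneg: "0 \<le> y i j" if "i \<in> S\<^sub>1" "j \<in> S\<^sub>2" for i j
    by (rule LIMSEQ_le_const [OF y [OF that]]) (use proportion_nonneg in auto)
  have "(\<lambda>n. \<Sum>i\<in>S\<^sub>1. \<Sum>j\<in>S\<^sub>2. proportion S\<^sub>1 S\<^sub>2 h n i j) \<longlonglongrightarrow> (\<Sum>i\<in>S\<^sub>1. \<Sum>j\<in>S\<^sub>2. y i j)"
    by (intro tendsto_sum y)
  then have "(\<Sum>i\<in>S\<^sub>1. \<Sum>j\<in>S\<^sub>2. y i j) = 1"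
    unfolding sum_proportion using LIMSEQ_unique tendsto_const by blast
  moreover have "(\<Sum>i\<in>S\<^sub>1. \<Sum>j\<in>S\<^sub>2. x i j) = (\<Sum>i\<in>S\<^sub>1. \<Sum>j\<in>S\<^sub>2. y i j)"
    by (intro sum.cong refl) (simp add: x_def)
  ultimately have "x \<in> Delta S\<^sub>1 S\<^sub>2"
    unfolding Delta_def using disjoint y_nonneg by (auto simp: x_def)
  moreover have "(\<lambda>n. proportion S\<^sub>1 S\<^sub>2 h n i j) \<longlonglongrightarrow> x i j" if ij: "i \<in> S\<^sub>1 \<union> S\<^sub>2" "j \<in> S\<^sub>1 \<union> S\<^sub>2" for i j
  proof -
    consider "i \<in> S\<^sub>1" "j \<in> S\<^sub>2" | "i \<in> S\<^sub>2" "j \<in> S\<^sub>1" | "i \<in> S\<^sub>1 \<and> j \<in> S\<^sub>1 \<or> i \<in> S\<^sub>2 \<and> j \<in> S\<^sub>2"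
      using ij by blast
    then show ?thesis
    proof cases
      case 1
      then show ?thesis using y by (simp add: x_def)
    next
      case 2
      then have "i \<notin> S\<^sub>1" using disjoint by blast
      then show ?thesis using 2 y by (simp add: x_def proportion_sym [of h _ i j])
    next
      case 3
      then have "x i j = 0" using disjoint by (auto simp: x_def)
      then show ?thesis using 3 by (simp add: proportion_def V_same_part)
    qed
  qed
  moreover have "graph_of S\<^sub>1 S\<^sub>2 x = G"
  proof
    show "graph_of S\<^sub>1 S\<^sub>2 x \<subseteq> G" using R unfolding graph_of_def x_def y_def by auto
    show "G \<subseteq> graph_of S\<^sub>1 S\<^sub>2 x"
    proof
      fix e assume e: "e \<in> G"
      then obtain i j where ij: "i \<in> S\<^sub>1" "j \<in> S\<^sub>2" "e = {i, j}"
        using G by (auto simp: bipartite_graph_def)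
      then have "0 < x i j" using R e by (simp add: x_def y_def)
      then show "e \<in> graph_of S\<^sub>1 S\<^sub>2 x" using ij by (auto simp: graph_of_def)
    qed
  qed
  ultimately show ?L by blast
qed

end

section \<open>From leaf limits to the two conclusions\<close>

context star_signaling
begin

text \<open>A statement about a single history. After division by \<open>n\<close>, edges have
  positive limits, and the other entries, equal to 1 from \<open>n0\<close> on, tend to 0; the total
  then has a positive limit, by which one can divide.\<close>

lemma star_limits:
  assumes flat: "\<And>n. n0 \<le> n \<Longrightarrow> flat (weight h n)"
    and lim: "\<And>l. l \<in> L \<Longrightarrow> \<exists>y>0. (\<lambda>n. leafval (weight h n) l / n) \<longlonglongrightarrow> y"
    and i: "i \<in> S\<^sub>1" and j: "j \<in> S\<^sub>2"
  shows "convergent (\<lambda>n. proportion S\<^sub>1 S\<^sub>2 h n i j)"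
    and "0 < lim (\<lambda>n. proportion S\<^sub>1 S\<^sub>2 h n i j) \<longleftrightarrow> edge i j"
    and "V_infinity S\<^sub>1 S\<^sub>2 h i j = \<infinity> \<longleftrightarrow> edge i j"
proof -
  define y where "y l = (SOME y. 0 < y \<and> (\<lambda>n. leafval (weight h n) l / n) \<longlonglongrightarrow> y)" for l
  have y: "0 < y l" "(\<lambda>n. leafval (weight h n) l / n) \<longlonglongrightarrow> y l" if "l \<in> L" for l
    unfolding y_def using someI_ex [OF lim [OF that]] by (rule conjunct1, rule conjunct2)
  define z where "z i j = (if \<exists>l\<in>L. i = st l \<and> j = sg l then y (SOME l. l \<in> L \<and> i = st l \<and> j = sg l) else 0)" for i j
  have z_edge: "z (st l) (sg l) = y l" if "l \<in> L" for l
  proof -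
    have "(SOME k. k \<in> L \<and> st l = st k \<and> sg l = sg k) = l"
      by (rule some_equality) (use that inj_st_sg in auto)
    then show ?thesis using that by (auto simp: z_def)
  qed
  have z_none: "z i j = 0" if "i \<in> S\<^sub>1" "j \<in> S\<^sub>2" "\<not> edge i j" for i j
  proof -
    have "\<not> (\<exists>l\<in>L. i = st l \<and> j = sg l)" using that edge_iff_leaf by blast
    then show ?thesis unfolding z_def by (rule if_not_P)
  qed
  have z_pos: "0 < z i j \<longleftrightarrow> edge i j" if ij: "i \<in> S\<^sub>1" "j \<in> S\<^sub>2" for i j
  proof (cases "edge i j")
    case True
    then obtain l where "l \<in> L" "i = st l" "j = sg l" using edge_iff_leaf [OF ij] by blast
    then show ?thesis using True z_edge y(1) by simp
  next
    case False
    then show ?thesis using z_none [OF ij] by simp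
  qed
  have w: "(\<lambda>n. weight h n i j / n) \<longlonglongrightarrow> z i j" if ij: "i \<in> S\<^sub>1" "j \<in> S\<^sub>2" for i j
  proof (cases "edge i j")
    case True
    then obtain l where l: "l \<in> L" "i = st l" "j = sg l" using edge_iff_leaf [OF ij] by blast
    show ?thesis using y(2) [OF l(1)] l by (simp add: z_edge leafval_def)
  next
    case False
    have "(\<lambda>n. 1 / real n) \<longlonglongrightarrow> z i j"
      unfolding z_none [OF ij False] by (rule lim_1_over_n)
    moreover have "\<forall>\<^sub>F n in sequentially. 1 / real n = weight h n i j / n"
      by (rule eventually_sequentiallyI [of n0]) (use flat False ij in \<open>auto simp: flat_def\<close>)
    ultimately show ?thesis by (rule Lim_transform_eventually)
  qed
  let ?T = "\<Sum>i\<in>S\<^sub>1. \<Sum>j\<in>S\<^sub>2. z i j"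
  have "(\<lambda>n. \<Sum>i\<in>S\<^sub>1. \<Sum>j\<in>S\<^sub>2. weight h n i j / n) \<longlonglongrightarrow> ?T"
    by (intro tendsto_sum w)
  then have T: "(\<lambda>n. total_weight S\<^sub>1 S\<^sub>2 h n / n) \<longlonglongrightarrow> ?T"
    by (simp add: total_weight_eq sum_divide_distrib)
  have T_pos: "0 < ?T"
  proof -
    \<comment> \<open>Every vertex is a leaf or the center of one, so the existence of a state
      forces \<open>L\<close> to be nonempty.\<close>
    obtain a where a: "a \<in> S\<^sub>1" using states_nonempty by blast
    then obtain l where l: "l \<in> L" using center_has_leaf by blast
    have nonneg: "0 \<le> z i j" if "i \<in> S\<^sub>1" "j \<in> S\<^sub>2" for i j
      using z_pos [OF that] z_none [OF that] by (cases "edge i j") auto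
    have "0 < z (st l) (sg l)" using l y(1) by (simp add: z_edge)
    also have "\<dots> \<le> (\<Sum>j\<in>S\<^sub>2. z (st l) j)"
      by (rule member_le_sum) (use l sg_in finite_signals nonneg st_in in auto)
    also have "\<dots> \<le> ?T"
      by (rule member_le_sum [where f = "\<lambda>i. \<Sum>j\<in>S\<^sub>2. z i j"])
        (use l st_in finite_states nonneg in \<open>auto intro: sum_nonneg\<close>)
    finally show ?thesis .
  qed
  have "(\<lambda>n. (weight h n i j / n) / (total_weight S\<^sub>1 S\<^sub>2 h n / n)) \<longlonglongrightarrow> z i j / ?T"
    by (intro tendsto_divide w i j T) (use T_pos in simp)
  moreover have "\<forall>\<^sub>F n in sequentially. (weight h n i j / n) / (total_weight S\<^sub>1 S\<^sub>2 h n / n) = proportion S\<^sub>1 S\<^sub>2 h n i j"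
    by (rule eventually_sequentiallyI [of 1]) (use i j in \<open>auto simp: proportion_def V_def\<close>)
  ultimately have p: "(\<lambda>n. proportion S\<^sub>1 S\<^sub>2 h n i j) \<longlonglongrightarrow> z i j / ?T"
    by (rule Lim_transform_eventually)
  show "convergent (\<lambda>n. proportion S\<^sub>1 S\<^sub>2 h n i j)" by (rule convergentI [OF p])
  show "0 < lim (\<lambda>n. proportion S\<^sub>1 S\<^sub>2 h n i j) \<longleftrightarrow> edge i j"
    unfolding limI [OF p] using T_pos z_pos [OF i j] by (simp add: zero_less_divide_iff)
  have V: "V S\<^sub>1 S\<^sub>2 h n i j = weight h n i j" for n using i j by (simp add: V_def)
  show "V_infinity S\<^sub>1 S\<^sub>2 h i j = \<infinity> \<longleftrightarrow> edge i j"
  proof (cases "edge i j")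
    case True
    have "filterlim (\<lambda>n. (weight h n i j / n) * real n) at_top sequentially"
      by (rule filterlim_tendsto_pos_mult_at_top [OF w [OF i j] _ filterlim_real_sequentially])
        (use z_pos [OF i j] True in simp)
    moreover have "\<forall>\<^sub>F n in sequentially. (weight h n i j / n) * real n = weight h n i j"
      by (rule eventually_sequentiallyI [of 1]) auto
    ultimately have "filterlim (\<lambda>n. weight h n i j) at_top sequentially"
      by (rule filterlim_cong [OF refl refl, THEN iffD1, rotated])
    then have "(\<lambda>n. ereal (weight h n i j)) \<longlonglongrightarrow> \<infinity>"
      by (simp add: tendsto_PInfty_eq_at_top)
    then have "V_infinity S\<^sub>1 S\<^sub>2 h i j = \<infinity>" unfolding V_infinity_def V by (rule limI)
    then show ?thesis using True by simp
  next
    case False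
    have "\<forall>\<^sub>F n in sequentially. ereal 1 = ereal (weight h n i j)"
      by (rule eventually_sequentiallyI [of n0]) (use flat False i j in \<open>auto simp: flat_def\<close>)
    then have "(\<lambda>n. ereal (weight h n i j)) \<longlonglongrightarrow> ereal 1"
      by (rule Lim_transform_eventually [OF tendsto_const])
    then have "V_infinity S\<^sub>1 S\<^sub>2 h i j = ereal 1" unfolding V_infinity_def V by (rule limI)
    then show ?thesis using False by simp
  qed
qed

lemma ex_prob_limits_pos:
  "\<exists>A\<in>sets M. 0 < prob A \<and> (AE \<omega> in M. \<omega> \<in> A \<longrightarrow>
     (\<forall>i\<in>S\<^sub>1. \<forall>j\<in>S\<^sub>2. convergent (\<lambda>n. proportion S\<^sub>1 S\<^sub>2 (path \<omega>) n i j) \<and>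
       (0 < lim (\<lambda>n. proportion S\<^sub>1 S\<^sub>2 (path \<omega>) n i j) \<longleftrightarrow> edge i j) \<and>
       (V_infinity S\<^sub>1 S\<^sub>2 (path \<omega>) i j = \<infinity> \<longleftrightarrow> edge i j)))"
proof -
  obtain K :: nat where K: "384 * nverts ^ 5 < K"
    using reals_Archimedean2 by blast
  have "1 \<le> nverts ^ 5" using nverts_ge_1 by (rule one_le_power)
  then have "1 \<le> K" using K by simp
  then obtain n0 where n0: "0 < prob {\<omega> \<in> space M. start K n0 (path \<omega>)}"
    using ex_start by blast
  let ?A = "{\<omega> \<in> space M. \<forall>n\<ge>n0. alive K n0 n (path \<omega>)}"
  have pos: "0 < prob ?A" by (rule prob_alive_pos [OF K n0])
  \<comment> \<open>Positivity already implies measurability, because \<open>measure\<close> is 0 on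
    sets outside \<open>sets M\<close>.\<close>
  have sets: "?A \<in> sets M"
  proof (rule ccontr)
    assume "?A \<notin> sets M"
    then have "prob ?A = 0" by (rule measure_notin_sets)
    with pos show False by simp
  qed
  have "AE \<omega> in M. \<forall>l\<in>L. (\<forall>n\<ge>n0. alive K n0 n (path \<omega>)) \<longrightarrow> (\<exists>y>0. (\<lambda>n. leafval (weight (path \<omega>) n) l / n) \<longlonglongrightarrow> y)"
    by (intro AE_finite_allI finite_leaves AE_alive_leaf_limit [OF K n0])
  then have "AE \<omega> in M. \<omega> \<in> ?A \<longrightarrow>
     (\<forall>i\<in>S\<^sub>1. \<forall>j\<in>S\<^sub>2. convergent (\<lambda>n. proportion S\<^sub>1 S\<^sub>2 (path \<omega>) n i j) \<and>
       (0 < lim (\<lambda>n. proportion S\<^sub>1 S\<^sub>2 (path \<omega>) n i j) \<longleftrightarrow> edge i j) \<and>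
       (V_infinity S\<^sub>1 S\<^sub>2 (path \<omega>) i j = \<infinity> \<longleftrightarrow> edge i j))"
  proof eventually_elim
    case (elim \<omega>)
    show ?case
    proof
      assume "\<omega> \<in> ?A"
      then have alive: "\<And>n. n0 \<le> n \<Longrightarrow> alive K n0 n (path \<omega>)" by simp
      have flat: "flat (weight (path \<omega>) n)" if "n0 \<le> n" for n
        by (rule alive_flat [OF K n0 alive [OF that] that])
      have lim: "\<exists>y>0. (\<lambda>n. leafval (weight (path \<omega>) n) l / n) \<longlonglongrightarrow> y" if "l \<in> L" for l
        using elim that alive by blast
      show "\<forall>i\<in>S\<^sub>1. \<forall>j\<in>S\<^sub>2. convergent (\<lambda>n. proportion S\<^sub>1 S\<^sub>2 (path \<omega>) n i j) \<and>
         (0 < lim (\<lambda>n. proportion S\<^sub>1 S\<^sub>2 (path \<omega>) n i j) \<longleftrightarrow> edge i j) \<and>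
         (V_infinity S\<^sub>1 S\<^sub>2 (path \<omega>) i j = \<infinity> \<longleftrightarrow> edge i j)"
        by (intro ballI conjI star_limits [OF flat lim])
    qed
  qed
  with pos sets show ?thesis by blast
qed

end

theorem theorem2p3:
  fixes M :: "'w measure"
    and S\<^sub>1 S\<^sub>2 :: "'a set"
    and play :: "nat \<Rightarrow> 'w \<Rightarrow> 'a play"
    and G :: "'a set set"
  assumes "signaling_process M S\<^sub>1 S\<^sub>2 play"
    and "bipartite_graph S\<^sub>1 S\<^sub>2 G"
    and "property_P S\<^sub>1 S\<^sub>2 G"
  shows "\<P>(\<omega> in M.
           (\<exists>x\<in>Delta S\<^sub>1 S\<^sub>2.
              (\<forall>i\<in>S\<^sub>1 \<union> S\<^sub>2. \<forall>j\<in>S\<^sub>1 \<union> S\<^sub>2.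
                 (\<lambda>n. proportion S\<^sub>1 S\<^sub>2 (\<lambda>m. play m \<omega>) n i j) \<longlonglongrightarrow> x i j) \<and>
              graph_of S\<^sub>1 S\<^sub>2 x = G) \<and>
           (\<forall>i\<in>S\<^sub>1 \<union> S\<^sub>2. \<forall>j\<in>S\<^sub>1 \<union> S\<^sub>2.
              V_infinity S\<^sub>1 S\<^sub>2 (\<lambda>m. play m \<omega>) i j = \<infinity> \<longleftrightarrow> {i, j} \<in> G)) > 0"
proof -
  interpret signaling_process M S\<^sub>1 S\<^sub>2 play by fact
  note G = assms(2)
  obtain L f where L: "L \<subseteq> S\<^sub>1 \<union> S\<^sub>2"
    "\<And>l. l \<in> L \<Longrightarrow> l \<in> S\<^sub>1 \<Longrightarrow> f l \<in> S\<^sub>2 - L"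
    "\<And>l. l \<in> L \<Longrightarrow> l \<in> S\<^sub>2 \<Longrightarrow> f l \<in> S\<^sub>1 - L"
    "\<And>a. a \<in> S\<^sub>1 \<union> S\<^sub>2 \<Longrightarrow> a \<notin> L \<Longrightarrow> \<exists>l\<in>L. f l = a"
    and edges: "\<And>i j. i \<in> S\<^sub>1 \<Longrightarrow> j \<in> S\<^sub>2 \<Longrightarrow> {i, j} \<in> G \<longleftrightarrow> i \<in> L \<and> f i = j \<or> j \<in> L \<and> f j = i"
    using star_decomposition [OF assms(2,3) disjoint] by blast
  interpret star_signaling M S\<^sub>1 S\<^sub>2 play L f
    by unfold_locales (fact L)+
  have edge_iff: "edge i j \<longleftrightarrow> {i, j} \<in> G" if "i \<in> S\<^sub>1" "j \<in> S\<^sub>2" for i j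
    using edges [OF that] by (simp add: edge_def)
  let ?lim = "\<lambda>\<omega>. \<forall>i\<in>S\<^sub>1. \<forall>j\<in>S\<^sub>2. convergent (\<lambda>n. proportion S\<^sub>1 S\<^sub>2 (path \<omega>) n i j)
        \<and> (0 < lim (\<lambda>n. proportion S\<^sub>1 S\<^sub>2 (path \<omega>) n i j) \<longleftrightarrow> {i, j} \<in> G)"
  let ?inf = "\<lambda>\<omega>. \<forall>i\<in>S\<^sub>1 \<union> S\<^sub>2. \<forall>j\<in>S\<^sub>1 \<union> S\<^sub>2. V_infinity S\<^sub>1 S\<^sub>2 (path \<omega>) i j = \<infinity> \<longleftrightarrow> {i, j} \<in> G"
  \<comment> \<open>Passing from \<open>A\<close> to this event by monotonicity of the measure
    requires its measurability, which is why the limits were rewritten with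
    \<open>convergent\<close> and \<open>lim\<close>.\<close>
  have sets: "{\<omega> \<in> space M. ?lim \<omega> \<and> ?inf \<omega>} \<in> sets M"
    by (rule sets.sets_Collect_conj; intro sets.sets_Collect_finite_All sets_proportion_limit
        sets_V_infinity finite_UnI finite_states finite_signals)
  obtain A where A: "A \<in> sets M" "0 < prob A" and AE: "AE \<omega> in M. \<omega> \<in> A \<longrightarrow>
     (\<forall>i\<in>S\<^sub>1. \<forall>j\<in>S\<^sub>2. convergent (\<lambda>n. proportion S\<^sub>1 S\<^sub>2 (path \<omega>) n i j) \<and>
       (0 < lim (\<lambda>n. proportion S\<^sub>1 S\<^sub>2 (path \<omega>) n i j) \<longleftrightarrow> edge i j) \<and>
       (V_infinity S\<^sub>1 S\<^sub>2 (path \<omega>) i j = \<infinity> \<longleftrightarrow> edge i j))"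
    using ex_prob_limits_pos by blast
  \<comment> \<open>A signal and a state are reduced to a state and a signal by symmetry; for two
    vertices of the same part \<open>V\<close> is identically 0 and they are not adjacent.\<close>
  have inf: "V_infinity S\<^sub>1 S\<^sub>2 h i j = \<infinity> \<longleftrightarrow> {i, j} \<in> G"
    if ij: "i \<in> S\<^sub>1 \<union> S\<^sub>2" "j \<in> S\<^sub>1 \<union> S\<^sub>2"
      and h: "\<And>i j. i \<in> S\<^sub>1 \<Longrightarrow> j \<in> S\<^sub>2 \<Longrightarrow> V_infinity S\<^sub>1 S\<^sub>2 h i j = \<infinity> \<longleftrightarrow> {i, j} \<in> G" for h i j
  proof -
    consider "i \<in> S\<^sub>1" "j \<in> S\<^sub>2" | "i \<in> S\<^sub>2" "j \<in> S\<^sub>1" | "i \<in> S\<^sub>1 \<and> j \<in> S\<^sub>1 \<or> i \<in> S\<^sub>2 \<and> j \<in> S\<^sub>2"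
      using ij by blast
    then show ?thesis
    proof cases
      case 1
      then show ?thesis by (rule h)
    next
      case 2
      have "V_infinity S\<^sub>1 S\<^sub>2 h i j = V_infinity S\<^sub>1 S\<^sub>2 h j i"
        unfolding V_infinity_def by (simp only: V_sym [of h _ i j])
      then show ?thesis using h [OF 2(2,1)] by (simp only: insert_commute)
    next
      case 3
      then have "V_infinity S\<^sub>1 S\<^sub>2 h i j = lim (\<lambda>n. ereal 0)"
        unfolding V_infinity_def by (simp only: V_same_part)
      also have "\<dots> = ereal 0" by (rule limI) (rule tendsto_const)
      finally show ?thesis
        using 3 bipartite_graph_edge [OF G, of i j] disjoint by auto
    qed
  qed
  have "AE \<omega> in M. \<omega> \<in> A \<longrightarrow> \<omega> \<in> {\<omega> \<in> space M. ?lim \<omega> \<and> ?inf \<omega>}"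
    using AE AE_space
  proof eventually_elim
    case (elim \<omega>)
    show ?case
    proof
      assume "\<omega> \<in> A"
      then have *: "convergent (\<lambda>n. proportion S\<^sub>1 S\<^sub>2 (path \<omega>) n i j)"
        "0 < lim (\<lambda>n. proportion S\<^sub>1 S\<^sub>2 (path \<omega>) n i j) \<longleftrightarrow> {i, j} \<in> G"
        "V_infinity S\<^sub>1 S\<^sub>2 (path \<omega>) i j = \<infinity> \<longleftrightarrow> {i, j} \<in> G" if "i \<in> S\<^sub>1" "j \<in> S\<^sub>2" for i j
        using elim(1) that edge_iff [OF that] by blast+
      have "?lim \<omega>" using * by blast
      moreover have "?inf \<omega>"
      proof (intro ballI)
        fix i j assume "i \<in> S\<^sub>1 \<union> S\<^sub>2" "j \<in> S\<^sub>1 \<union> S\<^sub>2"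
        then show "V_infinity S\<^sub>1 S\<^sub>2 (path \<omega>) i j = \<infinity> \<longleftrightarrow> {i, j} \<in> G"
          by (rule inf) (rule *(3))
      qed
      ultimately show "\<omega> \<in> {\<omega> \<in> space M. ?lim \<omega> \<and> ?inf \<omega>}" using elim(2) by blast
    qed
  qed
  then have "prob A \<le> prob {\<omega> \<in> space M. ?lim \<omega> \<and> ?inf \<omega>}"
    by (rule finite_measure_mono_AE [OF _ sets])
  then have "0 < prob {\<omega> \<in> space M. ?lim \<omega> \<and> ?inf \<omega>}" using A by linarith
  then show ?thesis
    unfolding Delta_limit_iff [OF G] path_def [symmetric] by simp
qed

end
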